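(* There exist a non-extreme point $b$ of the closed unit ball of $H^\infty$ and a function $f\in\mathcal{H}(b)$ such that $$\lim_{r\to1^-}\|L_r[f]\|_b=\infty .$$
   Context: $\mathbb{D}$ is the open unit disk, $\mathbb{T}$ the unit circle, $H^2$ and $H^\infty$ the usual Hardy spaces on $\mathbb{D}$ (identified with their boundary functions on $\mathbb{T}$), and $P_+:L^2(\mathbb{T})\to H^2$ the orthogonal projection. For $\phi\in L^\infty(\mathbb{T})$, the Toeplitz operator is $T_\phi:H^2\to H^2$, $T_\phi f:=P_+(\phi f)$. For $b\in H^\infty$ with $\|b\|_\infty\le1$, the de Branges--Rovnyak space $\mathcal{H}(b)$ is the range $(I-T_bT_{\overline b})^{1/2}H^2$ with inner product $$\langle (I-T_bT_{\overline b})^{1/2}f,(I-T_bT_{\overline b})^{1/2}g\rangle_b:=\langle f,g\rangle_{H^2}\quad (f,g\in H^2\ominus\ker(I-T_bT_{\overline b})^{1/2}),$$ and norm denoted $\|\cdot\|_b$. The function $b$ is called non-extreme if it is not an extreme point of the closed unit ball of $H^\infty$. For $f(z)=\sum_{n\ge0}a_nz^n$ holomorphic on $\mathbb{D}$, let $s_n[f](z):=\sum_{k=0}^na_kz^k$. The logarithmic means of $f$ are $$L_r[f](z):=\frac{r}{\log\frac1{1-r}}\sum_{n\ge0}\frac{s_n[f](z)}{n+1}r^n\quad(0<r<1,\ z\in\mathbb{D}).$$ If $b$ is non-extreme and $f\in\mathcal{H}(b)$, then $L_r[f]\in\mathcal{H}(b)$ for every such $r$, so that $\|L_r[f]\|_b$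 is defined. *)

theory Defs
  imports "HOL-Complex_Analysis.Complex_Analysis"
begin

text \<open>
  Functions on the open unit disk are represented by functions \<open>complex \<Rightarrow> complex\<close> vanishing off
  the disk, so that HOL equality of representatives is equality on the disk.
\<close>

definition disk_holomorphic :: "(complex \<Rightarrow> complex) set" where
  "disk_holomorphic =
     {f. f holomorphic_on ball 0 1 \<and> (\<forall>z. z \<notin> ball 0 1 \<longrightarrow> f z = 0)}"

text \<open>Normalised Lebesgue (arc length) measure on the unit circle, as a measure on the plane.\<close>

definition circle_measure :: "complex measure" where
  "circle_measure = distr (uniform_measure lborel {0..2 * pi}) borel cis"

definition L2_inner :: "(complex \<Rightarrow> complex) \<Rightarrow> (complex \<Rightarrow> complex) \<Rightarrow> complex" where
  "L2_inner f g = (\<integral>w. f w * cnj (g w) \<partial>circle_measure)"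

definition H2 :: "(complex \<Rightarrow> complex) set" where
  "H2 = {f \<in> disk_holomorphic.
     bdd_above ((\<lambda>r. \<integral>w. (cmod (f (complex_of_real r * w)))\<^sup>2 \<partial>circle_measure) ` {0<..<1})}"

definition Hinf :: "(complex \<Rightarrow> complex) set" where
  "Hinf = {f \<in> disk_holomorphic. bounded (f ` ball 0 1)}"

definition Hinf_norm :: "(complex \<Rightarrow> complex) \<Rightarrow> real" where
  "Hinf_norm f = (SUP z\<in>ball 0 1. cmod (f z))"

definition Hinf_unit_ball :: "(complex \<Rightarrow> complex) set" where
  "Hinf_unit_ball = {b \<in> Hinf. Hinf_norm b \<le> 1}"

text \<open>
  The library's \<open>extreme_point_of\<close> requires a type of class \<open>real_vector\<close>, of which function
  types are not an instance; this is the same notion with pointwise operations.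
\<close>

definition extreme_in :: "(complex \<Rightarrow> complex) \<Rightarrow> (complex \<Rightarrow> complex) set \<Rightarrow> bool" where
  "extreme_in b K \<longleftrightarrow> b \<in> K \<and>
     \<not> (\<exists>g\<in>K. \<exists>h\<in>K. g \<noteq> h \<and>
         (\<exists>t::real. 0 < t \<and> t < 1 \<and>
           b = (\<lambda>z. complex_of_real (1 - t) * g z + complex_of_real t * h z)))"

text \<open>
  Boundary function, by radial limits. For \<open>f\<close> in \<open>H2\<close> (in particular in \<open>Hinf\<close>) the limit
  exists at almost every point of the circle by Fatou's theorem; elsewhere the value is irrelevant.
\<close>

definition boundary :: "(complex \<Rightarrow> complex) \<Rightarrow> complex \<Rightarrow> complex" where
  "boundary f w = Lim (at_left 1) (\<lambda>r::real. f (complex_of_real r * w))"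

definition H2_inner :: "(complex \<Rightarrow> complex) \<Rightarrow> (complex \<Rightarrow> complex) \<Rightarrow> complex" where
  "H2_inner f g = L2_inner (boundary f) (boundary g)"

definition H2_norm :: "(complex \<Rightarrow> complex) \<Rightarrow> real" where
  "H2_norm f = sqrt (Re (H2_inner f f))"

text \<open>The orthogonal projection of \<open>L2\<close> of the circle onto \<open>H2\<close>; meaningful for square-integrable \<open>g\<close>.\<close>

definition P_plus :: "(complex \<Rightarrow> complex) \<Rightarrow> complex \<Rightarrow> complex" where
  "P_plus g = (THE h. h \<in> H2 \<and>
     (\<forall>k\<in>H2. L2_inner (\<lambda>w. g w - boundary h w) (boundary k) = 0))"

definition toeplitz :: "(complex \<Rightarrow> complex) \<Rightarrow> (complex \<Rightarrow> complex) \<Rightarrow> complex \<Rightarrow> complex" where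
  "toeplitz \<phi> f = P_plus (\<lambda>w. \<phi> w * boundary f w)"

definition H2_bounded_linear ::
    "((complex \<Rightarrow> complex) \<Rightarrow> (complex \<Rightarrow> complex)) \<Rightarrow> bool" where
  "H2_bounded_linear S \<longleftrightarrow>
     (\<forall>f\<in>H2. S f \<in> H2) \<and>
     (\<forall>f\<in>H2. \<forall>g\<in>H2. S (\<lambda>z. f z + g z) = (\<lambda>z. S f z + S g z)) \<and>
     (\<forall>c. \<forall>f\<in>H2. S (\<lambda>z. c * f z) = (\<lambda>z. c * S f z)) \<and>
     (\<exists>C. \<forall>f\<in>H2. H2_norm (S f) \<le> C * H2_norm f)"

definition H2_positive :: "((complex \<Rightarrow> complex) \<Rightarrow> (complex \<Rightarrow> complex)) \<Rightarrow> bool" where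
  "H2_positive S \<longleftrightarrow> (\<forall>f\<in>H2. H2_inner (S f) f \<in> \<real> \<and> 0 \<le> Re (H2_inner (S f) f))"

text \<open>
  The positive square root of a positive operator on \<open>H2\<close>. The condition \<open>S \<in> extensional H2\<close>
  only pins down the values off \<open>H2\<close>, as uniqueness under \<open>THE\<close> requires.
\<close>

definition H2_sqrt ::
    "((complex \<Rightarrow> complex) \<Rightarrow> (complex \<Rightarrow> complex)) \<Rightarrow> (complex \<Rightarrow> complex) \<Rightarrow> (complex \<Rightarrow> complex)"
  where
  "H2_sqrt A = (THE S. S \<in> extensional H2 \<and> H2_bounded_linear S \<and> H2_positive S \<and>
     (\<forall>f\<in>H2. S (S f) = A f))"

definition defect_sqrt :: "(complex \<Rightarrow> complex) \<Rightarrow> (complex \<Rightarrow> complex) \<Rightarrow> (complex \<Rightarrow> complex)" where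
  "defect_sqrt b = H2_sqrt (\<lambda>f z.
     f z - toeplitz (boundary b) (toeplitz (\<lambda>w. cnj (boundary b w)) f) z)"

definition Hb :: "(complex \<Rightarrow> complex) \<Rightarrow> (complex \<Rightarrow> complex) set" where
  "Hb b = defect_sqrt b ` H2"

definition H2_kernel :: "((complex \<Rightarrow> complex) \<Rightarrow> (complex \<Rightarrow> complex)) \<Rightarrow> (complex \<Rightarrow> complex) set"
  where
  "H2_kernel S = {f \<in> H2. S f = (\<lambda>_. 0)}"

definition H2_ortho :: "(complex \<Rightarrow> complex) set \<Rightarrow> (complex \<Rightarrow> complex) set" where
  "H2_ortho K = {f \<in> H2. \<forall>g\<in>K. H2_inner f g = 0}"

text \<open>
  \<open>Hb_lift b h\<close> is the preimage of \<open>h\<close> under the square root that is orthogonal to its kernel. For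
  \<open>h\<close> outside \<open>Hb b\<close> no preimage exists and \<open>Hb_lift b h\<close>, hence also \<open>Hb_norm b h\<close>, is one
  unspecified value independent of \<open>h\<close>; so \<open>Hb_norm b (F r)\<close> can only tend to infinity if \<open>F r\<close>
  eventually lies in \<open>Hb b\<close>.
\<close>

definition Hb_lift :: "(complex \<Rightarrow> complex) \<Rightarrow> (complex \<Rightarrow> complex) \<Rightarrow> (complex \<Rightarrow> complex)" where
  "Hb_lift b h = (THE f. f \<in> H2_ortho (H2_kernel (defect_sqrt b)) \<and> defect_sqrt b f = h)"

definition Hb_inner :: "(complex \<Rightarrow> complex) \<Rightarrow> (complex \<Rightarrow> complex) \<Rightarrow> (complex \<Rightarrow> complex) \<Rightarrow> complex"
  where
  "Hb_inner b h k = H2_inner (Hb_lift b h) (Hb_lift b k)"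

definition Hb_norm :: "(complex \<Rightarrow> complex) \<Rightarrow> (complex \<Rightarrow> complex) \<Rightarrow> real" where
  "Hb_norm b h = sqrt (Re (Hb_inner b h h))"

definition taylor_sum :: "nat \<Rightarrow> (complex \<Rightarrow> complex) \<Rightarrow> complex \<Rightarrow> complex" where
  "taylor_sum n f z = (\<Sum>k\<le>n. (deriv ^^ k) f 0 / fact k * z ^ k)"

definition log_mean :: "real \<Rightarrow> (complex \<Rightarrow> complex) \<Rightarrow> complex \<Rightarrow> complex" where
  "log_mean r f z =
     (if z \<in> ball 0 1
      then complex_of_real (r / ln (1 / (1 - r))) *
        (\<Sum>n. taylor_sum n f z / of_nat (n + 1) * complex_of_real r ^ n)
      else 0)"

end

theory Submission
  imports Defs "HOL-Real_Asymp.Real_Asymp"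
begin

text \<open>
  Let \<open>w\<^sub>m = 1 - 16\<^sup>-\<^sup>m\<close>, let \<open>B\<close> be the Blaschke product with zeros \<open>w\<^sub>m\<close>, and take
  \<open>b = (1 + z) / 2 * B\<^sup>2\<close>, \<open>a = (1 - z) / 2\<close>, so that \<open>\<bar>a\<bar>\<^sup>2 + \<bar>b\<bar>\<^sup>2 = 1\<close> on the circle. The function
  \<open>f = \<Sum>\<^sub>m 16\<^sup>-\<^sup>m k\<^bsub>w\<^sub>m\<^esub>\<close>, a sum of Szego kernels, is annihilated by the adjoint of multiplication by
  \<open>b\<close>, hence lies in \<open>H(b)\<close>. For \<open>h\<close> in \<open>H(b)\<close> and \<open>g\<close> in \<open>H\<^sup>2\<close> one has
  \<open>\<bar>\<langle>h, b g\<rangle>\<bar> \<le> \<parallel>h\<parallel>\<^sub>b \<parallel>a g\<parallel>\<close>. With \<open>f\<^sub>t\<close> the dilation \<open>z \<mapsto> f (t z)\<close>,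
  \<open>log (1 / (1 - r)) L\<^sub>r f\<close> is the integral of \<open>f\<^sub>t / (1 - t)\<close> over \<open>0 \<le> t \<le> r\<close>, and
  \<open>\<langle>f\<^sub>t, b g\<rangle> = \<Sum>\<^sub>m 16\<^sup>-\<^sup>m (b g) (t w\<^sub>m)\<close> is a sum of nonnegative terms when \<open>g = k\<^sub>x\<^sup>2\<close> with \<open>0 < x < 1\<close>,
  because \<open>b \<ge> 0\<close> on the radius. Choosing \<open>x = w\<^sub>n\<close> with \<open>16\<^sup>-\<^sup>n\<close> comparable to \<open>1 - r\<close>, the
  single term \<open>m = n\<close> with \<open>1 - t\<close> between \<open>16\<^sup>-\<^sup>n\<close> and \<open>2 * 16\<^sup>-\<^sup>n\<close>, where \<open>t w\<^sub>n\<close> stays away from the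
  zeros, already gives \<open>\<parallel>L\<^sub>r f\<parallel>\<^sub>b \<ge> c / (sqrt (1 - r) log (1 / (1 - r)))\<close>.
\<close>

section \<open>Square roots of positive operators\<close>

text \<open>Pairing \<open>f\<close> itself with \<open>b g\<close> samples \<open>b g\<close> at
  zeros of \<open>b\<close> and gives 0; dilation moves the samples off the zeros, and a logarithmic
  mean averages dilations with a positive weight, so nonnegative samples cannot cancel. This is why
  B enters squared: on the radius it is real but changes sign. The factor (1 + z) / 2 provides an
  explicit mate \<open>a\<close>, whose zero at 1 makes \<open>a g\<close> small: for g = e k_x^2
  with e = 1 - x one has |a g| <= e |k_x| pointwise, so the norm is at most sqrt e, while the one
  sample that is kept stays bounded below independently of e. The ratio 1/16 separates the zeros
  enough for an explicit lower bound of B between them. The length comes from the definitions.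
  Boundary values are radial limits, so Fatou's theorem is required; it is derived from an L2
  maximal inequality. The projection, the square root and the preimage behind the H(b) norm are
  definite descriptions, so existence and uniqueness are established for each, after moving from H2
  to square-summable Taylor coefficients.\<close>

lemma quadratic_nonneg_imp_linear_zero:
  fixes a c :: real
  assumes "\<And>t. 0 \<le> 2 * t * a + t\<^sup>2 * c"
  shows "a = 0"
proof (rule ccontr)
  assume "a \<noteq> 0"
  define d where "d = \<bar>c\<bar> + 1"
  have d: "d > 0" "c < d" by (auto simp: d_def)
  \<comment> \<open>With \<open>d\<close> above both 0 and \<open>c\<close>, the linear term at
    \<open>t = - a / d\<close> outweighs the quadratic one.\<close>
  have "0 \<le> 2 * (- a / d) * a + (- a / d)\<^sup>2 * c" by (rule assms)
  also have "\<dots> = (a\<^sup>2 / d) * (c / d - 2)"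
    using d by (simp add: power2_eq_square field_simps)
  finally have "0 \<le> (a\<^sup>2 / d) * (c / d - 2)" .
  moreover have "a\<^sup>2 / d > 0" using d \<open>a \<noteq> 0\<close> by simp
  moreover have "c / d - 2 < 0" using d by (simp add: field_simps)
  ultimately show False by (smt (verit) mult_pos_neg)
qed

text \<open>
  The Riesz representation theorem and Douglas' range inclusion lemma in one: \<open>u\<close> is the limit
  of \<open>S g\<^sub>n\<close> along a minimising sequence of \<open>\<parallel>S g\<parallel>\<^sup>2 - 2 l g\<close>.
\<close>

lemma functional_representation:
  fixes S :: "'a::real_vector \<Rightarrow> 'b::{real_inner,banach}" and l :: "'a \<Rightarrow> real"
  assumes S: "linear S" and l: "linear l" and M: "\<And>g. \<bar>l g\<bar> \<le> M * norm (S g)"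
  obtains u where "\<And>g. l g = inner u (S g)"
proof -
  define J where "J g = (norm (S g))\<^sup>2 - 2 * l g" for g
  \<comment> \<open>Completing the square: \<open>J g\<close> is at least (||S g|| - M)^2 -
    M^2.\<close>
  have J_lower: "- (M\<^sup>2) \<le> J g" for g
  proof -
    have "l g \<le> M * norm (S g)" using M[of g] by linarith
    moreover have "0 \<le> (norm (S g) - M)\<^sup>2" by simp
    ultimately show ?thesis unfolding J_def by (simp add: power2_diff algebra_simps)
  qed
  define m where "m = Inf (range J)"
  have bdd: "bdd_below (range J)" using J_lower by (auto intro!: bdd_belowI)
  have m_le: "m \<le> J g" for g unfolding m_def using bdd by (auto intro: cInf_lower)
  have "\<exists>g. J g < m + 1 / real (Suc n)" for n
  proof -
    have "m < m + 1 / real (Suc n)" by simp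
    then show ?thesis unfolding m_def
      using cInf_lessD[of "range J"] by blast
  qed
  then obtain g where g: "\<And>n. J (g n) < m + 1 / real (Suc n)" by metis
  have S_add: "S (x + y) = S x + S y" and l_add: "l (x + y) = l x + l y"
    and S_sc: "S (c *\<^sub>R x) = c *\<^sub>R S x" and l_sc: "l (c *\<^sub>R x) = c * l x" for x y c
    using S l by (auto simp: linear_add linear_scale)
  \<comment> \<open>The midpoint of \<open>g i\<close> and \<open>g j\<close> cannot push
    \<open>J\<close> below \<open>m\<close>, so by the parallelogram law near-minimisers have nearby
    images under \<open>S\<close>. The domain carries no norm, so only the images can
    converge.\<close>
  have par: "(norm (S (g i) - S (g j)))\<^sup>2 \<le> 2 / real (Suc i) + 2 / real (Suc j)" for i j
  proof -
    let ?x = "S (g i)" and ?y = "S (g j)"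
    have "m \<le> J ((1/2) *\<^sub>R (g i + g j))" by (rule m_le)
    also have "\<dots> = (norm (?x + ?y))\<^sup>2 / 4 - (l (g i) + l (g j))"
      unfolding J_def S_sc l_sc S_add l_add by (simp add: power_divide) (simp add: field_simps)
    finally have 1: "4 * m \<le> (norm (?x + ?y))\<^sup>2 - 4 * (l (g i) + l (g j))" by simp
    have "(norm (?x - ?y))\<^sup>2 = 2 * (norm ?x)\<^sup>2 + 2 * (norm ?y)\<^sup>2 - (norm (?x + ?y))\<^sup>2"
      by (simp add: power2_norm_eq_inner inner_add inner_diff inner_commute algebra_simps)
    also have "\<dots> = 2 * J (g i) + 2 * J (g j) - ((norm (?x + ?y))\<^sup>2 - 4 * (l (g i) + l (g j)))"
      unfolding J_def by (simp add: algebra_simps)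
    finally have "(norm (?x - ?y))\<^sup>2 \<le> 2 * J (g i) + 2 * J (g j) - 4 * m" using 1 by linarith
    also have "\<dots> \<le> 2 * (1 / real (Suc i)) + 2 * (1 / real (Suc j))" using g[of i] g[of j] by linarith
    finally show ?thesis by simp
  qed
  have "Cauchy (\<lambda>n. S (g n))"
  proof (rule metric_CauchyI)
    fix e :: real assume e: "e > 0"
    obtain N where N: "4 / e\<^sup>2 < real N" using reals_Archimedean2 by blast
    show "\<exists>N. \<forall>i\<ge>N. \<forall>j\<ge>N. dist (S (g i)) (S (g j)) < e"
    proof (intro exI allI impI)
      fix i j assume ij: "i \<ge> N" "j \<ge> N"
      have Npos: "real N > 0" using N e by (smt (verit) divide_pos_pos zero_less_power)
      have "2 / real (Suc i) \<le> 2 / real N" "2 / real (Suc j) \<le> 2 / real N"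
        using ij Npos by (auto intro!: divide_left_mono mult_pos_pos)
      then have "(norm (S (g i) - S (g j)))\<^sup>2 \<le> 4 / real N" using par[of i j] by linarith
      also have "\<dots> < e\<^sup>2" using N e Npos by (simp add: field_simps)
      finally show "dist (S (g i)) (S (g j)) < e"
        using e by (simp add: dist_norm power_less_imp_less_base)
    qed
  qed
  then obtain u where u: "(\<lambda>n. S (g n)) \<longlonglongrightarrow> u" using Cauchy_convergent_iff convergent_def by blast
  have "l h = inner u (S h)" for h
  proof -
    \<comment> \<open>First-order condition at the minimum: perturb \<open>g n\<close> in the
      direction \<open>h\<close>, then let n tend to infinity.\<close>
    have "0 \<le> 2 * t * (inner u (S h) - l h) + t\<^sup>2 * (norm (S h))\<^sup>2" for t
    proof -
      have "0 \<le> 1 / real (Suc n) + 2 * t * (inner (S (g n)) (S h) - l h) + t\<^sup>2 * (norm (S h))\<^sup>2" for n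
      proof -
        have "m \<le> J (g n + t *\<^sub>R h)" by (rule m_le)
        also have "\<dots> = J (g n) + 2 * t * (inner (S (g n)) (S h) - l h) + t\<^sup>2 * (norm (S h))\<^sup>2"
          unfolding J_def S_sc l_sc S_add l_add power2_norm_eq_inner power2_eq_square[of t]
          by (simp add: inner_add inner_commute algebra_simps)
        finally show ?thesis using g[of n] by linarith
      qed
      moreover have "(\<lambda>n. 1 / real (Suc n) + 2 * t * (inner (S (g n)) (S h) - l h) + t\<^sup>2 * (norm (S h))\<^sup>2)
         \<longlonglongrightarrow> 0 + 2 * t * (inner u (S h) - l h) + t\<^sup>2 * (norm (S h))\<^sup>2"
        by (intro tendsto_intros u) (use lim_inverse_n' LIMSEQ_Suc in fastforce)
      ultimately show ?thesis using Lim_bounded2[where C=0] by (metis (no_types, lifting) add_0)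
    qed
    then show ?thesis using quadratic_nonneg_imp_linear_zero[of "inner u (S h) - l h"] by (metis right_minus_eq)
  qed
  then show ?thesis by (rule that)
qed

text \<open>The Cauchy-Schwarz inequality for a semidefinite form: expanded at y + t S y, the form
  has linear term 2 t ||S y||^2 and no constant term.\<close>

lemma positive_form_zero:
  fixes S :: "'a::real_inner \<Rightarrow> 'a"
  assumes S: "linear S" and sa: "\<And>x y. inner (S x) y = inner x (S y)"
    and pos: "\<And>x. 0 \<le> inner (S x) x" and z: "inner (S y) y = 0"
  shows "S y = 0"
proof -
  have "0 \<le> 2 * t * inner (S y) (S y) + t\<^sup>2 * inner (S (S y)) (S y)" for t
  proof -
    have "0 \<le> inner (S (y + t *\<^sub>R S y)) (y + t *\<^sub>R S y)" by (rule pos)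
    also have "\<dots> = 2 * t * inner (S y) (S y) + t\<^sup>2 * inner (S (S y)) (S y)"
      using z by (simp add: linear_add[OF S] linear_scale[OF S] inner_add sa power2_eq_square algebra_simps)
    finally show ?thesis .
  qed
  then have "inner (S y) (S y) = 0" by (rule quadratic_nonneg_imp_linear_zero)
  then show ?thesis by simp
qed

section \<open>Taylor coefficients of sqrt(1 - x)\<close>

definition root_coeff :: "nat \<Rightarrow> real" where
  "root_coeff n = ((1/2) gchoose n) * (-1) ^ n"

lemma root_coeff_0 [simp]: "root_coeff 0 = 1"
  by (simp add: root_coeff_def)

text \<open>Partial sums are the coefficients of the series divided by 1 - x, here of (1 -
  x)^(-1/2), and those are \<open>pochhammer (1/2) n / fact n\<close>.\<close>

lemma sum_root_coeff_nonneg: "0 \<le> (\<Sum>k\<le>n. root_coeff k)"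
proof -
  have "(\<Sum>k\<le>n. root_coeff k) = (-1) ^ n * ((- 1 / 2) gchoose n)"
    unfolding root_coeff_def using gbinomial_sum_lower_neg[of "1/2::real" n] by simp
  also have "\<dots> = pochhammer (1/2) n / fact n"
    by (simp add: gbinomial_pochhammer)
  also have "\<dots> \<ge> 0" by (simp add: pochhammer_nonneg)
  finally show ?thesis .
qed

lemma root_coeff_Suc_nonpos: "root_coeff (Suc n) \<le> 0"
proof -
  have "root_coeff (Suc n) = - (1 / 2) * pochhammer (1 / 2) n / fact (Suc n)"
    unfolding root_coeff_def by (simp add: gbinomial_pochhammer pochhammer_rec)
  also have "\<dots> \<le> 0" by (simp add: pochhammer_nonneg)
  finally show ?thesis .
qed

text \<open>Only the zeroth coefficient is positive, so the absolute values sum to 2 minus the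
  partial sum. The series thus converges absolutely even at |x| = 1, as is required for operators of
  norm 1.\<close>

lemma sum_abs_root_coeff: "(\<Sum>k\<le>n. \<bar>root_coeff k\<bar>) \<le> 2"
proof -
  have "(\<Sum>k\<le>n. \<bar>root_coeff k\<bar>) = 2 - (\<Sum>k\<le>n. root_coeff k)"
  proof (induction n)
    case (Suc n)
    then show ?case using root_coeff_Suc_nonpos[of n] by simp
  qed simp
  then show ?thesis using sum_root_coeff_nonneg[of n] by simp
qed

lemma summable_abs_root_coeff: "summable (\<lambda>n. \<bar>root_coeff n\<bar>)"
proof (rule bounded_imp_summable)
  show "sum (\<lambda>n. \<bar>root_coeff n\<bar>) {..n} \<le> 2" for n by (rule sum_abs_root_coeff)
qed simp

lemma suminf_root_coeff_nonneg: "0 \<le> suminf root_coeff"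
proof -
  have "(\<lambda>n. \<Sum>k\<le>n. root_coeff k) \<longlonglongrightarrow> suminf root_coeff"
    using summable_abs_root_coeff by (intro summable_LIMSEQ') (rule summable_rabs_cancel)
  then show ?thesis by (rule Lim_bounded2) (auto intro: sum_root_coeff_nonneg)
qed

text \<open>The square of the series is 1 - x: Vandermonde's convolution with 1/2 + 1/2 = 1.\<close>

lemma root_coeff_convolution:
  "(\<Sum>k\<le>n. root_coeff k * root_coeff (n - k)) = (if n = 0 then 1 else if n = 1 then -1 else 0)"
proof -
  have "(\<Sum>k\<le>n. root_coeff k * root_coeff (n - k)) =
      (\<Sum>k\<le>n. ((1/2) gchoose k) * ((1/2) gchoose (n - k))) * (-1) ^ n"
    unfolding root_coeff_def sum_distrib_right
    by (rule sum.cong) (auto simp: mult_ac simp flip: power_add)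
  also have "(\<Sum>k\<le>n. ((1/2) gchoose k) * ((1/2) gchoose (n - k))) = ((1/2 + 1/2 :: real) gchoose n)"
    by (simp only: gbinomial_Vandermonde atMost_atLeast0)
  also have "\<dots> = (of_nat 1 :: real) gchoose n" by simp
  also have "\<dots> = of_nat (1 choose n)" by (simp only: binomial_gbinomial)
  finally show ?thesis by (cases n) (auto simp: binomial_eq_0)
qed

text \<open>The binomial series of sqrt(1 - x) evaluated at the operator \<open>X\<close>, which
  yields the positive square root of I - X without spectral theory.\<close>

definition root_op :: "('a::real_normed_vector \<Rightarrow> 'a) \<Rightarrow> 'a \<Rightarrow> 'a" where
  "root_op X x = (\<Sum>n. root_coeff n *\<^sub>R (X ^^ n) x)"

locale contraction =
  fixes X :: "'a::{real_inner,banach} \<Rightarrow> 'a"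
  assumes lin: "linear X" and contr: "\<And>x. norm (X x) \<le> norm x"
    and self_adj: "\<And>x y. inner (X x) y = inner x (X y)"
begin

lemma pow_linear: "linear (X ^^ n)"
proof (induction n)
  case (Suc n)
  show ?case unfolding funpow.simps by (rule linear_compose[OF Suc lin])
qed (simp add: linear_iff)

lemma pow_contr: "norm ((X ^^ n) x) \<le> norm x"
  by (induction n) (auto intro: order_trans[OF contr])

lemma pow_self_adj: "inner ((X ^^ n) x) y = inner x ((X ^^ n) y)"
proof (induction n arbitrary: x y)
  case (Suc n)
  have "inner ((X ^^ Suc n) x) y = inner x ((X ^^ n) (X y))" by (simp add: self_adj Suc)
  then show ?case by (simp add: funpow_swap1)
qed simp

lemma root_summable_norm: "summable (\<lambda>n. norm (root_coeff n *\<^sub>R (X ^^ n) x))"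
proof (rule summable_comparison_test')
  show "summable (\<lambda>n. \<bar>root_coeff n\<bar> * norm x)"
    by (rule summable_mult2[OF summable_abs_root_coeff])
  show "norm (norm (root_coeff n *\<^sub>R (X ^^ n) x)) \<le> \<bar>root_coeff n\<bar> * norm x" for n
    by (simp add: mult_left_mono pow_contr)
qed

lemma root_sums: "(\<lambda>n. root_coeff n *\<^sub>R (X ^^ n) x) sums root_op X x"
  unfolding root_op_def by (rule summable_sums[OF summable_norm_cancel[OF root_summable_norm]])

text \<open>The root is a limit of polynomials in \<open>X\<close>. This is used with
  \<open>T\<close> another square root of I - X, for uniqueness, and with \<open>T\<close> a complex
  scalar.\<close>

lemma root_commute:
  assumes T: "bounded_linear T" and c: "\<And>x. T (X x) = X (T x)"
  shows "T (root_op X x) = root_op X (T x)"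
proof -
  have "T ((X ^^ n) x) = (X ^^ n) (T x)" for n
    by (induction n arbitrary: x) (auto simp: c)
  then have "(\<lambda>n. T (root_coeff n *\<^sub>R (X ^^ n) x)) = (\<lambda>n. root_coeff n *\<^sub>R (X ^^ n) (T x))"
    by (simp add: linear_scale[OF bounded_linear.linear[OF T]])
  with bounded_linear.sums[OF T root_sums[of x]]
  have "(\<lambda>n. root_coeff n *\<^sub>R (X ^^ n) (T x)) sums T (root_op X x)" by simp
  then show ?thesis using root_sums sums_unique2 by blast
qed

lemma root_bounded_linear: "bounded_linear (root_op X)"
proof (rule bounded_linear_intro[where K = 2])
  fix x y
  have "(\<lambda>n. root_coeff n *\<^sub>R (X ^^ n) (x + y)) sums (root_op X x + root_op X y)"
    using sums_add[OF root_sums[of x] root_sums[of y]] by (simp add: linear_add[OF pow_linear] algebra_simps)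
  then show "root_op X (x + y) = root_op X x + root_op X y" using root_sums sums_unique2 by blast
next
  fix r x
  have "(\<lambda>n. root_coeff n *\<^sub>R (X ^^ n) (r *\<^sub>R x)) sums (r *\<^sub>R root_op X x)"
    using sums_scaleR_right[OF root_sums[of x], of r] by (simp add: linear_scale[OF pow_linear] algebra_simps)
  then show "root_op X (r *\<^sub>R x) = r *\<^sub>R root_op X x" using root_sums sums_unique2 by blast
next
  fix x
  have "norm (root_op X x) \<le> (\<Sum>n. norm (root_coeff n *\<^sub>R (X ^^ n) x))"
    unfolding root_op_def by (rule summable_norm[OF root_summable_norm])
  also have "\<dots> \<le> (\<Sum>n. \<bar>root_coeff n\<bar> * norm x)"
    by (intro suminf_le root_summable_norm summable_mult2[OF summable_abs_root_coeff])
      (simp add: mult_left_mono pow_contr)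
  also have "\<dots> = (\<Sum>n. \<bar>root_coeff n\<bar>) * norm x"
    by (rule suminf_mult2[symmetric, OF summable_abs_root_coeff])
  also have "\<dots> \<le> 2 * norm x"
  proof (rule mult_right_mono)
    show "(\<Sum>n. \<bar>root_coeff n\<bar>) \<le> 2"
      by (rule LIMSEQ_le_const2[OF summable_LIMSEQ'[OF summable_abs_root_coeff]])
        (auto intro: sum_abs_root_coeff)
  qed simp
  finally show "norm (root_op X x) \<le> norm x * 2" by (simp add: mult.commute)
qed

lemma root_self_adj: "inner (root_op X x) y = inner x (root_op X y)"
proof -
  have "(\<lambda>n. inner (root_coeff n *\<^sub>R (X ^^ n) x) y) sums inner (root_op X x) y"
    by (rule bounded_linear.sums[OF bounded_linear_inner_left root_sums])
  moreover have "(\<lambda>n. inner x (root_coeff n *\<^sub>R (X ^^ n) y)) sums inner x (root_op X y)"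
    by (rule bounded_linear.sums[OF bounded_linear_inner_right root_sums])
  ultimately show ?thesis by (simp add: pow_self_adj sums_unique2)
qed

text \<open>All coefficients after the zeroth are nonpositive and <X^n x, x> <= ||x||^2, so the form
  is at least the coefficient sum times ||x||^2, and that sum is a limit of nonnegative partial
  sums.\<close>

lemma root_pos: "0 \<le> inner (root_op X x) x"
proof -
  have s: "(\<lambda>n. inner (root_coeff n *\<^sub>R (X ^^ n) x) x) sums inner (root_op X x) x"
    by (rule bounded_linear.sums[OF bounded_linear_inner_left root_sums])
  have t: "(\<lambda>n. root_coeff n * (norm x)\<^sup>2) sums (suminf root_coeff * (norm x)\<^sup>2)"
    by (rule sums_mult2[OF summable_sums[OF summable_rabs_cancel[OF summable_abs_root_coeff]]])
  have "suminf root_coeff * (norm x)\<^sup>2 \<le> inner (root_op X x) x"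
  proof (rule sums_le[OF _ t s])
    fix n
    have "inner ((X ^^ n) x) x \<le> (norm x)\<^sup>2"
      using norm_cauchy_schwarz[of "(X ^^ n) x" x] mult_right_mono[OF pow_contr[of n x] norm_ge_zero[of x]]
      by (simp add: power2_eq_square)
    then show "root_coeff n * (norm x)\<^sup>2 \<le> inner (root_coeff n *\<^sub>R (X ^^ n) x) x"
    proof (cases n)
      case 0
      then show ?thesis by (simp add: power2_norm_eq_inner)
    next
      case (Suc m)
      show ?thesis
        using mult_left_mono_neg[OF \<open>inner ((X ^^ n) x) x \<le> _\<close> root_coeff_Suc_nonpos[of m]]
        unfolding Suc by simp
    qed
  qed
  moreover have "0 \<le> suminf root_coeff * (norm x)\<^sup>2"
    by (rule mult_nonneg_nonneg[OF suminf_root_coeff_nonneg]) simp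
  ultimately show ?thesis by linarith
qed

text \<open>The double series of the product converges absolutely. Summed by rows it is the iterated
  root; summed by diagonals it collapses by \<open>root_coeff_convolution\<close>.\<close>

lemma root_square: "root_op X (root_op X x) = x - X x"
proof -
  define F where "F = (\<lambda>(i, j). (root_coeff i * root_coeff j) *\<^sub>R (X ^^ (i + j)) x)"
  have F_row: "F (i, j) = root_coeff i *\<^sub>R (X ^^ i) (root_coeff j *\<^sub>R (X ^^ j) x)" for i j
    by (simp add: F_def funpow_add linear_scale[OF pow_linear])
  define C where "C = (\<Sum>n. \<bar>root_coeff n\<bar>)"
  have nF: "norm (F (i, j)) \<le> \<bar>root_coeff i\<bar> * norm x * \<bar>root_coeff j\<bar>" for i j
    using mult_left_mono[OF pow_contr[of "i + j" x], of "\<bar>root_coeff i\<bar> * \<bar>root_coeff j\<bar>"]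
    by (simp add: F_def abs_mult mult_ac)
  have sm: "summable (\<lambda>j. \<bar>root_coeff i\<bar> * norm x * \<bar>root_coeff j\<bar>)" for i
    by (rule summable_mult[OF summable_abs_root_coeff])
  have row_sm: "summable (\<lambda>j. norm (F (i, j)))" for i
    by (rule summable_comparison_test'[OF sm[of i], where N = 0]) (simp add: nF)
  have row_has_sum: "((\<lambda>j. norm (F (i, j))) has_sum (\<Sum>j. norm (F (i, j)))) UNIV" for i
    by (rule norm_summable_imp_has_sum) (use row_sm in \<open>auto intro: summable_sums\<close>)
  have row_le: "(\<Sum>j. norm (F (i, j))) \<le> \<bar>root_coeff i\<bar> * norm x * C" for i
    unfolding C_def
    by (subst suminf_mult[symmetric, OF summable_abs_root_coeff], rule suminf_le[OF nF row_sm sm])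
  have F_abs: "(\<lambda>p. norm (F p)) summable_on (UNIV \<times> UNIV)"
  proof (rule iffD2[OF Infinite_Sum.abs_summable_on_Sigma_iff], intro conjI ballI)
    show "(\<lambda>j. norm (F (i, j))) summable_on UNIV" for i
      using row_has_sum summable_on_def by blast
    have "summable (\<lambda>i. \<Sum>j. norm (F (i, j)))"
    proof (rule summable_comparison_test')
      show "summable (\<lambda>i. \<bar>root_coeff i\<bar> * (norm x * C))"
        by (rule summable_mult2[OF summable_abs_root_coeff])
      show "norm (\<Sum>j. norm (F (i, j))) \<le> \<bar>root_coeff i\<bar> * (norm x * C)" for i
        using row_le[of i] suminf_nonneg[OF row_sm[of i]] by (simp add: mult.assoc)
    qed
    then have "summable (\<lambda>i. norm (\<Sum>\<^sub>\<infinity>j. norm (F (i, j))))"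
      using infsumI[OF row_has_sum] suminf_nonneg[OF row_sm] by simp
    then show "(\<lambda>i. norm (\<Sum>\<^sub>\<infinity>j. norm (F (i, j)))) summable_on UNIV"
      by (intro norm_summable_imp_summable_on) simp
  qed
  then obtain T where T: "(F has_sum T) (UNIV \<times> UNIV)"
    using Infinite_Sum.abs_summable_summable summable_on_def by blast
  have rows: "((\<lambda>j. F (i, j)) has_sum (root_coeff i *\<^sub>R (X ^^ i) (root_op X x))) UNIV" for i
  proof (rule norm_summable_imp_has_sum[OF row_sm])
    have bl: "bounded_linear (X ^^ i)"
      by (rule bounded_linear_intro[where K=1])
        (auto simp: linear_add[OF pow_linear] linear_scale[OF pow_linear] pow_contr)
    show "(\<lambda>j. F (i, j)) sums (root_coeff i *\<^sub>R (X ^^ i) (root_op X x))"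
      unfolding F_row by (intro sums_scaleR_right bounded_linear.sums[OF bl root_sums])
  qed
  have "((\<lambda>i. root_coeff i *\<^sub>R (X ^^ i) (root_op X x)) has_sum T) UNIV"
    by (rule has_sum_SigmaD[OF T]) (rule rows)
  then have T1: "root_op X (root_op X x) = T"
    using has_sum_imp_sums root_sums sums_unique2 by blast
  \<comment> \<open>Diagonal \<open>n\<close> consists of the entries \<open>(k, n - k)\<close>; on
    the triangle \<open>k \<le> n\<close> the natural-number subtraction is exact.\<close>
  have bij: "bij_betw (\<lambda>(n, k). (k, n - k)) (Sigma UNIV (\<lambda>n::nat. {..n})) (UNIV \<times> UNIV)"
    by (rule bij_betw_byWitness[where f' = "\<lambda>(i, j). (i + j, i)"]) auto
  have "((\<lambda>p. F ((\<lambda>(n, k). (k, n - k)) p)) has_sum T) (Sigma UNIV (\<lambda>n::nat. {..n}))"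
    using T by (subst has_sum_reindex_bij_betw[OF bij])
  then have "((\<lambda>n. \<Sum>k\<le>n. F (k, n - k)) has_sum T) UNIV"
    by (rule has_sum_SigmaD) (auto intro: has_sum_finite)
  moreover have "(\<Sum>k\<le>n. F (k, n - k)) = (if n = 0 then x else if n = 1 then - X x else 0)" for n
  proof -
    have "(\<Sum>k\<le>n. F (k, n - k)) = (\<Sum>k\<le>n. root_coeff k * root_coeff (n - k)) *\<^sub>R (X ^^ n) x"
      unfolding scaleR_sum_left by (rule sum.cong) (auto simp: F_def)
    then show ?thesis by (auto simp: root_coeff_convolution)
  qed
  ultimately have "(\<lambda>n. if n = 0 then x else if n = 1 then - X x else 0) sums T"
    by (simp add: has_sum_imp_sums)
  moreover have "(\<lambda>n. if n = 0 then x else if n = 1 then - X x else 0) sums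
      (\<Sum>n\<in>{0, 1::nat}. if n = 0 then x else if n = 1 then - X x else 0)"
    by (rule sums_finite) auto
  ultimately have "T = x - X x" using sums_unique2 by fastforce
  then show ?thesis using T1 by simp
qed

text \<open>Since X = I - T^2, \<open>T\<close> commutes with \<open>X\<close> and so with the root
  S. At y = S x - T x the sum S + T vanishes, so both nonnegative forms vanish there; hence S y = T
  y = 0 and ||y||^2 = <x, S y - T y> = 0.\<close>

lemma root_unique:
  assumes T: "bounded_linear T" and sa: "\<And>x y. inner (T x) y = inner x (T y)"
    and pos: "\<And>x. 0 \<le> inner (T x) x" and sq: "\<And>x. T (T x) = x - X x"
  shows "T = root_op X"
proof
  fix x
  let ?S = "root_op X"
  note linT = bounded_linear.linear[OF T] and linS = bounded_linear.linear[OF root_bounded_linear]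
  have X_eq: "X x = x - T (T x)" for x by (simp add: sq)
  have "T (X x) = X (T x)" for x by (simp add: X_eq linear_diff[OF linT])
  then have comm: "T (?S x) = ?S (T x)" for x by (rule root_commute[OF T])
  define y where "y = ?S x - T x"
  have "?S y + T y = 0"
    unfolding y_def by (simp add: linear_diff[OF linT] linear_diff[OF linS] comm sq root_square)
  then have "inner (?S y) y + inner (T y) y = 0" by (simp flip: inner_add_left)
  then have "inner (?S y) y = 0" "inner (T y) y = 0" using root_pos[of y] pos[of y] by linarith+
  then have "?S y = 0" "T y = 0"
    using positive_form_zero[OF linS root_self_adj root_pos] positive_form_zero[OF linT sa pos] by auto
  moreover have "inner y y = inner x (?S y) - inner x (T y)"
    by (subst (1) y_def) (simp add: inner_diff_left root_self_adj sa)
  ultimately have "inner y y = 0" by simp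
  then show "T x = ?S x" by (simp add: y_def)
qed

end

section \<open>The Hilbert space of square-summable sequences\<close>

text \<open>Sequences of Taylor coefficients of H2 functions, made a type so that the theory of
  \<open>real_inner\<close> and \<open>banach\<close> applies. The complex structure is carried
  alongside by \<open>cscale\<close> and \<open>ip\<close>.\<close>

typedef ell2 = "{x :: nat \<Rightarrow> complex. summable (\<lambda>n. (cmod (x n))\<^sup>2)}"
  morphisms coeff Abs_ell2
  by (rule exI[of _ "\<lambda>_. 0"]) simp

setup_lifting type_definition_ell2

lemma summable_coeff: "summable (\<lambda>n. (cmod (coeff x n))\<^sup>2)"
  using coeff[of x] by simp

lemma ell2_eqI: "(\<And>n. coeff x n = coeff y n) \<Longrightarrow> x = y"
  by (metis coeff_inject ext)

lemma square_add_le: "(cmod (a + b))\<^sup>2 \<le> 2 * (cmod a)\<^sup>2 + 2 * (cmod b)\<^sup>2"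
proof -
  have "(cmod (a + b))\<^sup>2 \<le> (cmod a + cmod b)\<^sup>2" by (simp add: norm_triangle_ineq power_mono)
  also have "\<dots> \<le> 2 * (cmod a)\<^sup>2 + 2 * (cmod b)\<^sup>2"
    using sum_squares_bound[of "cmod a" "cmod b"] by (simp add: power2_sum)
  finally show ?thesis .
qed

lemma ell2_add_summable:
  assumes "summable (\<lambda>n. (cmod (x n))\<^sup>2)" "summable (\<lambda>n. (cmod (y n))\<^sup>2)"
  shows "summable (\<lambda>n. (cmod (x n + y n))\<^sup>2)"
proof (rule summable_comparison_test'[where N = 0])
  show "summable (\<lambda>n. 2 * (cmod (x n))\<^sup>2 + 2 * (cmod (y n))\<^sup>2)"
    using assms by (intro summable_add summable_mult)
qed (use square_add_le in auto)

lemma ell2_mult_summable: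
  "summable (\<lambda>n. (cmod (x n))\<^sup>2) \<Longrightarrow> summable (\<lambda>n. (cmod (c * x n))\<^sup>2)"
  by (simp add: norm_mult power_mult_distrib summable_mult)

instantiation ell2 :: real_vector
begin

lift_definition zero_ell2 :: ell2 is "\<lambda>_. 0" by simp
lift_definition plus_ell2 :: "ell2 \<Rightarrow> ell2 \<Rightarrow> ell2" is "\<lambda>x y n. x n + y n"
  by (rule ell2_add_summable)
lift_definition uminus_ell2 :: "ell2 \<Rightarrow> ell2" is "\<lambda>x n. - x n" by simp
lift_definition minus_ell2 :: "ell2 \<Rightarrow> ell2 \<Rightarrow> ell2" is "\<lambda>x y n. x n - y n"
  using ell2_add_summable[of _ "\<lambda>n. - _ n"] by simp
lift_definition scaleR_ell2 :: "real \<Rightarrow> ell2 \<Rightarrow> ell2" is "\<lambda>c x n. of_real c * x n"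
  by (rule ell2_mult_summable)

instance
  by standard (transfer, auto simp: algebra_simps fun_eq_iff)+

end

lift_definition cscale :: "complex \<Rightarrow> ell2 \<Rightarrow> ell2" is "\<lambda>c x n. c * x n"
  by (rule ell2_mult_summable)

lemma coeff_simps [simp]:
  "coeff 0 n = 0" "coeff (x + y) n = coeff x n + coeff y n" "coeff (- x) n = - coeff x n"
  "coeff (x - y) n = coeff x n - coeff y n" "coeff (c *\<^sub>R x) n = of_real c * coeff x n"
  "coeff (cscale a x) n = a * coeff x n"
  by (transfer; simp)+

lemma summable_coeff_prod: "summable (\<lambda>n. norm (coeff x n * cnj (coeff y n)))"
proof (rule summable_comparison_test'[where N = 0])
  show "summable (\<lambda>n. (cmod (coeff x n))\<^sup>2 + (cmod (coeff y n))\<^sup>2)"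
    by (intro summable_add summable_coeff)
  show "norm (norm (coeff x n * cnj (coeff y n))) \<le> (cmod (coeff x n))\<^sup>2 + (cmod (coeff y n))\<^sup>2" for n
    using sum_squares_bound[of "cmod (coeff x n)" "cmod (coeff y n)"]
      mult_nonneg_nonneg[OF norm_ge_zero[of "coeff x n"] norm_ge_zero[of "coeff y n"]]
    unfolding norm_mult complex_mod_cnj real_norm_def abs_mult abs_norm_cancel by linarith
qed

definition ip :: "ell2 \<Rightarrow> ell2 \<Rightarrow> complex" where
  "ip x y = (\<Sum>n. coeff x n * cnj (coeff y n))"

lemma ip_sums: "(\<lambda>n. coeff x n * cnj (coeff y n)) sums ip x y"
  unfolding ip_def by (rule summable_sums[OF summable_norm_cancel[OF summable_coeff_prod]])

lemma ip_add_left: "ip (x + y) z = ip x z + ip y z"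
  using sums_add[OF ip_sums[of x z] ip_sums[of y z]] ip_sums[of "x + y" z]
  by (simp add: algebra_simps sums_unique2)

lemma ip_cscale_left: "ip (cscale c x) z = c * ip x z"
  using sums_mult[OF ip_sums[of x z], of c] ip_sums[of "cscale c x" z]
  by (simp add: mult.assoc sums_unique2)

lemma ip_commute: "ip y x = cnj (ip x y)"
  using ip_sums[of x y] ip_sums[of y x]
  by (subst (asm) sums_cnj[symmetric]) (auto simp: mult.commute sums_unique2)

lemma scaleR_eq_cscale: "c *\<^sub>R x = cscale (of_real c) x"
  by (rule ell2_eqI) simp

lemma ip_self: "ip x x = of_real (\<Sum>n. (cmod (coeff x n))\<^sup>2)"
  unfolding ip_def complex_norm_square[symmetric]
  by (rule suminf_of_real[symmetric, OF summable_coeff])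

instantiation ell2 :: real_inner
begin

definition inner_ell2 :: "ell2 \<Rightarrow> ell2 \<Rightarrow> real" where "inner_ell2 x y = Re (ip x y)"
definition norm_ell2 :: "ell2 \<Rightarrow> real" where "norm_ell2 x = sqrt (inner x x)"
definition dist_ell2 :: "ell2 \<Rightarrow> ell2 \<Rightarrow> real" where "dist_ell2 x y = norm (x - y)"
definition sgn_ell2 :: "ell2 \<Rightarrow> ell2" where "sgn_ell2 x = x /\<^sub>R norm x"
definition uniformity_ell2 :: "(ell2 \<times> ell2) filter" where
  "uniformity_ell2 = (INF e\<in>{0<..}. principal {(x, y). dist x y < e})"
definition open_ell2 :: "ell2 set \<Rightarrow> bool" where
  "open_ell2 U \<longleftrightarrow> (\<forall>x\<in>U. eventually (\<lambda>(x', y). x' = x \<longrightarrow> y \<in> U) uniformity)"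

instance
proof
  fix x y z :: ell2 and c :: real
  show "inner x y = inner y x" unfolding inner_ell2_def by (subst ip_commute) simp
  show "inner (x + y) z = inner x z + inner y z" by (simp add: inner_ell2_def ip_add_left)
  show "inner (c *\<^sub>R x) y = c * inner x y"
    by (simp add: inner_ell2_def scaleR_eq_cscale ip_cscale_left)
  show "0 \<le> inner x x" by (simp add: inner_ell2_def ip_self suminf_nonneg[OF summable_coeff])
  show "inner x x = 0 \<longleftrightarrow> x = 0"
    by (auto simp: inner_ell2_def ip_self suminf_eq_zero_iff[OF summable_coeff] intro: ell2_eqI)
qed (simp_all add: norm_ell2_def dist_ell2_def sgn_ell2_def uniformity_ell2_def open_ell2_def)

end

lemma norm_ell2_sq: "(norm x)\<^sup>2 = (\<Sum>n. (cmod (coeff x n))\<^sup>2)"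
  by (simp add: power2_norm_eq_inner inner_ell2_def ip_self)

lemma ip_self_norm: "ip x x = of_real ((norm x)\<^sup>2)"
  by (simp add: norm_ell2_sq ip_self)

lemma coeff_le_norm: "cmod (coeff x n) \<le> norm x"
proof (rule power2_le_imp_le)
  show "(cmod (coeff x n))\<^sup>2 \<le> (norm x)\<^sup>2"
    unfolding norm_ell2_sq using sum_le_suminf[OF summable_coeff, of "{n}"] by simp
qed simp

lemma ell2_Cauchy_convergent:
  fixes X :: "nat \<Rightarrow> ell2"
  assumes "Cauchy X"
  shows "\<exists>L. X \<longlonglongrightarrow> L"
proof -
  have C: "Cauchy (\<lambda>i. coeff (X i) n)" for n
  proof (rule metric_CauchyI)
    fix e :: real assume "e > 0"
    then obtain M where "\<forall>i\<ge>M. \<forall>j\<ge>M. dist (X i) (X j) < e" using metric_CauchyD[OF assms] by blast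
    moreover have "dist (coeff (X i) n) (coeff (X j) n) \<le> dist (X i) (X j)" for i j
      using coeff_le_norm[of "X i - X j" n] by (simp add: dist_norm)
    ultimately show "\<exists>M. \<forall>i\<ge>M. \<forall>j\<ge>M. dist (coeff (X i) n) (coeff (X j) n) < e"
      by (meson le_less_trans)
  qed
  define a where "a n = lim (\<lambda>i. coeff (X i) n)" for n
  have a: "(\<lambda>i. coeff (X i) n) \<longlonglongrightarrow> a n" for n
    unfolding a_def using C[of n] by (simp add: Cauchy_convergent_iff convergent_LIMSEQ_iff)
  \<comment> \<open>Bounds on finite partial sums survive the coordinatewise limit in
    \<open>j\<close>. They yield both the square-summability of \<open>a\<close> and convergence in
    norm.\<close>
  have bound: "\<exists>N. \<forall>i\<ge>N. \<forall>K. (\<Sum>n<K. (cmod (coeff (X i) n - a n))\<^sup>2) \<le> e\<^sup>2" if "e > 0" for e :: real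
  proof -
    obtain N where N: "\<And>i j. i \<ge> N \<Longrightarrow> j \<ge> N \<Longrightarrow> dist (X i) (X j) < e"
      using metric_CauchyD[OF assms \<open>e > 0\<close>] by blast
    have "(\<Sum>n<K. (cmod (coeff (X i) n - a n))\<^sup>2) \<le> e\<^sup>2" if i: "i \<ge> N" for i K
    proof (rule LIMSEQ_le_const2)
      show "(\<lambda>j. \<Sum>n<K. (cmod (coeff (X i) n - coeff (X j) n))\<^sup>2)
          \<longlonglongrightarrow> (\<Sum>n<K. (cmod (coeff (X i) n - a n))\<^sup>2)"
        by (intro tendsto_intros a)
      have "(\<Sum>n<K. (cmod (coeff (X i) n - coeff (X j) n))\<^sup>2) \<le> e\<^sup>2" if "j \<ge> N" for j
      proof -
        have "(\<Sum>n<K. (cmod (coeff (X i) n - coeff (X j) n))\<^sup>2) \<le> (norm (X i - X j))\<^sup>2"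
          unfolding norm_ell2_sq using sum_le_suminf[OF summable_coeff[of "X i - X j"], of "{..<K}"] by simp
        also have "\<dots> \<le> e\<^sup>2" using N[OF i that] by (intro power_mono) (auto simp: dist_norm)
        finally show ?thesis .
      qed
      then show "\<exists>M. \<forall>j\<ge>M. (\<Sum>n<K. (cmod (coeff (X i) n - coeff (X j) n))\<^sup>2) \<le> e\<^sup>2" by blast
    qed
    then show ?thesis by blast
  qed
  have diff_summable: "summable (\<lambda>n. (cmod (coeff (X i) n - a n))\<^sup>2)"
    if "\<And>K. (\<Sum>n<K. (cmod (coeff (X i) n - a n))\<^sup>2) \<le> e\<^sup>2" for i and e :: real
    by (rule summableI_nonneg_bounded[OF _ that]) simp
  obtain N1 where N1: "\<And>K. (\<Sum>n<K. (cmod (coeff (X N1) n - a n))\<^sup>2) \<le> 1\<^sup>2"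
    using bound[of 1] by auto
  have "summable (\<lambda>n. (cmod (a n))\<^sup>2)"
    using ell2_add_summable[OF summable_coeff[of "X N1"], of "\<lambda>n. a n - coeff (X N1) n"] diff_summable[OF N1]
    by (simp add: norm_minus_commute[of "a _"])
  then have L: "coeff (Abs_ell2 a) n = a n" for n by (subst Abs_ell2_inverse) simp_all
  let ?L = "Abs_ell2 a"
  have "X \<longlonglongrightarrow> ?L"
  proof (rule metric_LIMSEQ_I)
    fix e :: real assume e: "e > 0"
    obtain N where N: "\<And>i K. i \<ge> N \<Longrightarrow> (\<Sum>n<K. (cmod (coeff (X i) n - a n))\<^sup>2) \<le> (e/2)\<^sup>2"
      using bound[of "e/2"] e by auto
    have "dist (X i) ?L < e" if "i \<ge> N" for i
    proof -
      have "(norm (X i - ?L))\<^sup>2 \<le> (e/2)\<^sup>2"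
        unfolding norm_ell2_sq
      proof (rule suminf_le_const[OF summable_coeff])
        show "(\<Sum>n<K. (cmod (coeff (X i - ?L) n))\<^sup>2) \<le> (e/2)\<^sup>2" for K
          using N[OF that, of K] unfolding coeff_simps L .
      qed
      then have "norm (X i - ?L) \<le> e/2" by (rule power2_le_imp_le) (use e in simp)
      also have "\<dots> < e" using e by simp
      finally show ?thesis unfolding dist_norm .
    qed
    then show "\<exists>N. \<forall>i\<ge>N. dist (X i) ?L < e" by blast
  qed
  then show ?thesis by blast
qed

instance ell2 :: banach
  by standard (use ell2_Cauchy_convergent in \<open>auto simp: convergent_def\<close>)

lemma cscale_cscale [simp]: "cscale a (cscale b x) = cscale (a * b) x"
  by (rule ell2_eqI) simp

lemma cscale_add: "cscale c (x + y) = cscale c x + cscale c y"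
  by (rule ell2_eqI) (simp add: algebra_simps)

lemma norm_cscale: "norm (cscale c x) = cmod c * norm x"
proof -
  have "ip (cscale c x) (cscale c x) = c * cnj c * ip x x"
    using ip_commute[of x "cscale c x"] ip_commute[of x x] by (simp add: ip_cscale_left mult.assoc)
  then have "(norm (cscale c x))\<^sup>2 = (cmod c * norm x)\<^sup>2"
    unfolding ip_self_norm complex_norm_square[symmetric]
    by (metis of_real_eq_iff of_real_mult power_mult_distrib)
  then show ?thesis by simp
qed

lemma bounded_linear_cscale: "bounded_linear (cscale c)"
  by (rule bounded_linear_intro[where K = "cmod c"])
    (auto simp: cscale_add scaleR_eq_cscale norm_cscale mult.commute)

lemma inner_ip: "inner x y = Re (ip x y)"
  by (simp add: inner_ell2_def)

text \<open>Recovers the complex inner product from its real part, so that adjoint relations proved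
  for \<open>inner\<close> pass to \<open>ip\<close> as soon as the operator commutes with
  \<open>cscale\<close>.\<close>

lemma ip_inner: "ip x y = Complex (inner x y) (inner x (cscale \<i> y))"
proof (rule complex_eqI)
  show "Im (ip x y) = Im (Complex (inner x y) (inner x (cscale \<i> y)))"
    using ip_commute[of x "cscale \<i> y"] ip_commute[of x y] by (simp add: inner_ip ip_cscale_left)
qed (simp add: inner_ip)

section \<open>The circle and the Poisson kernel\<close>

notation circle_measure ("\<sigma>")

lemma space_circle_measure [simp]: "space \<sigma> = UNIV"
  and sets_circle_measure [simp, measurable_cong]: "sets \<sigma> = sets borel"
  by (simp_all add: circle_measure_def)

lemma cis_measurable [measurable]: "cis \<in> borel_measurable borel"
  by (intro borel_measurable_continuous_onI continuous_intros)

lemma cnj_measurable [measurable (raw)]: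
  "f \<in> borel_measurable M \<Longrightarrow> (\<lambda>x. cnj (f x)) \<in> borel_measurable M"
  by (rule measurable_compose[OF _ borel_measurable_continuous_onI]) (auto intro: continuous_intros)

lemma uniform_measure_interval:
  "uniform_measure lborel {0..2 * pi} = density lborel (\<lambda>t. ennreal (indicator {0..2 * pi} t / (2 * pi)))"
  unfolding uniform_measure_def
  by (intro arg_cong2[where f = density] ext)
    (auto simp: indicator_def divide_ennreal[symmetric] simp flip: ennreal_1)

lemma emeasure_circle_UNIV: "emeasure \<sigma> UNIV = 1"
  unfolding circle_measure_def
  by (subst emeasure_distr) (auto simp: divide_ennreal)

interpretation circle: finite_measure \<sigma>
  by standard (simp add: emeasure_circle_UNIV)

lemma AE_circle_iff:
  assumes [measurable]: "Measurable.pred borel P"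
  shows "(AE w in \<sigma>. P w) \<longleftrightarrow> (AE t in lborel. t \<in> {0..2 * pi} \<longrightarrow> P (cis t))"
proof -
  have "(AE w in \<sigma>. P w) \<longleftrightarrow> (AE t in uniform_measure lborel {0..2 * pi}. P (cis t))"
    unfolding circle_measure_def by (rule AE_distr_iff) auto
  also have "\<dots> \<longleftrightarrow> (AE t in lborel. t \<in> {0..2 * pi} \<longrightarrow> P (cis t))"
    unfolding uniform_measure_interval by (subst AE_density) (auto simp: indicator_def)
  finally show ?thesis .
qed

lemma AE_circle_norm: "AE w in \<sigma>. cmod w = 1"
  by (subst AE_circle_iff) auto

text \<open>The zeros of the Blaschke product accumulate at 1, the one point of the circle where its
  boundary behaviour is not controlled.\<close>

lemma AE_circle_neq_1: "AE w in \<sigma>. w \<noteq> 1"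
proof (subst AE_circle_iff)
  have "AE t in lborel. t \<noteq> (0::real)" "AE t in lborel. t \<noteq> 2 * pi"
    by (rule AE_lborel_singleton)+
  then show "AE t in lborel. t \<in> {0..2 * pi} \<longrightarrow> cis t \<noteq> 1"
  proof eventually_elim
    case (elim t)
    show ?case
    proof
      assume t: "t \<in> {0..2 * pi}"
      show "cis t \<noteq> 1"
      proof
        assume "cis t = 1"
        then have "cos t = 1" by (simp add: complex_eq_iff)
        then obtain n :: int where n: "t = real_of_int n * 2 * pi" using cos_one_2pi_int by auto
        have "0 < t" "t < 2 * pi" using t elim by auto
        then have "0 < real_of_int n * (2 * pi)" "real_of_int n * (2 * pi) < 1 * (2 * pi)"
          using n by simp_all
        then have "0 < real_of_int n" "real_of_int n < 1"
          by (simp_all add: zero_less_mult_iff mult_less_cancel_right)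
        then show False by simp
      qed
    qed
  qed
qed auto

lemma integral_circle_power: "(\<integral>w. w ^ n \<partial>\<sigma>) = (if n = 0 then 1 else 0)"
proof (cases "n = 0")
  case True
  then show ?thesis by (simp add: measure_def emeasure_circle_UNIV)
next
  case False
  have "(\<integral>w. w ^ n \<partial>\<sigma>) = (\<integral>t. cis t ^ n \<partial>uniform_measure lborel {0..2 * pi})"
    unfolding circle_measure_def by (rule integral_distr) auto
  also have "\<dots> = (\<integral>t. (indicator {0..2 * pi} t / (2 * pi)) *\<^sub>R (cis t ^ n) \<partial>lborel)"
    unfolding uniform_measure_interval by (rule integral_density) auto
  also have "\<dots> = (\<integral>t. (1 / (2 * pi)) *\<^sub>R (indicator {0..2 * pi} t *\<^sub>R (cis t ^ n)) \<partial>lborel)"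
    by (rule Bochner_Integration.integral_cong) auto
  also have "\<dots> = (1 / (2 * pi)) *\<^sub>R (\<integral>t. indicator {0..2 * pi} t *\<^sub>R (cis t ^ n) \<partial>lborel)"
    by (rule Bochner_Integration.integral_scaleR_right)
  also have "(\<integral>t. indicator {0..2 * pi} t *\<^sub>R (cis t ^ n) \<partial>lborel) =
      cis (real n * (2 * pi)) / (\<i> * of_nat n) - cis (real n * 0) / (\<i> * of_nat n)"
  proof (rule integral_FTC_Icc)
    show "((\<lambda>t. cis (real n * t) / (\<i> * of_nat n)) has_vector_derivative cis t ^ n)
        (at t within {0..2 * pi})" for t
    proof -
      have "((\<lambda>t. exp (\<i> * of_real (real n * t)) / (\<i> * of_nat n)) has_vector_derivative
          exp (\<i> * of_real (real n * t))) (at t within {0..2 * pi})"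
      proof -
        have 1: "((\<lambda>z. exp (\<i> * of_nat n * z) / (\<i> * of_nat n)) has_field_derivative
            exp (\<i> * of_nat n * of_real t)) (at (of_real t))"
          using False by (auto intro!: derivative_eq_intros simp: field_simps)
        have 2: "((\<lambda>t. of_real t :: complex) has_vector_derivative 1) (at t within {0..2 * pi})"
          by (auto intro!: derivative_eq_intros simp: has_vector_derivative_def scaleR_conv_of_real)
        have "((\<lambda>z. exp (\<i> * of_nat n * z) / (\<i> * of_nat n)) \<circ> (\<lambda>t. of_real t) has_vector_derivative
            1 * exp (\<i> * of_nat n * of_real t)) (at t within {0..2 * pi})"
          by (rule field_vector_diff_chain_within[OF 2])
            (rule has_field_derivative_at_within[OF 1])
        then show ?thesis by (simp add: o_def mult.assoc)
      qed
      then show ?thesis by (simp add: cis_conv_exp exp_of_nat_mult[symmetric] mult.left_commute)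
    qed
    show "continuous_on {0..2 * pi} (\<lambda>t. cis t ^ n)" by (intro continuous_intros)
  qed simp
  also have "cis (real n * (2 * pi)) = 1"
    using cis_multiple_2pi[of "of_nat n"] by (simp add: mult_ac)
  finally show ?thesis using False by simp
qed

lemma integral_circle_power_cnj:
  "(\<integral>w. w ^ m * cnj (w ^ n) \<partial>\<sigma>) = (if m = n then 1 else 0)"
proof (cases "n \<le> m")
  case True
  have "(\<integral>w. w ^ m * cnj (w ^ n) \<partial>\<sigma>) = (\<integral>w. w ^ (m - n) \<partial>\<sigma>)"
  proof (rule integral_cong_AE)
    show "AE w in \<sigma>. w ^ m * cnj (w ^ n) = w ^ (m - n)"
      using AE_circle_norm
    proof eventually_elim
      case (elim w)
      have "w ^ n * cnj (w ^ n) = of_real ((cmod (w ^ n))\<^sup>2)" by (simp only: complex_norm_square)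
      also have "\<dots> = 1" using elim by (simp add: norm_power)
      finally have "w ^ n * cnj (w ^ n) = 1" .
      then show ?case using True by (metis le_add_diff_inverse2 mult.assoc mult.right_neutral power_add)
    qed
  qed auto
  then show ?thesis using True by (auto simp: integral_circle_power)
next
  case False
  have "(\<integral>w. w ^ m * cnj (w ^ n) \<partial>\<sigma>) = (\<integral>w. cnj (w ^ (n - m)) \<partial>\<sigma>)"
  proof (rule integral_cong_AE)
    show "AE w in \<sigma>. w ^ m * cnj (w ^ n) = cnj (w ^ (n - m))"
      using AE_circle_norm
    proof eventually_elim
      case (elim w)
      have "w ^ m * cnj (w ^ m) = of_real ((cmod (w ^ m))\<^sup>2)" by (simp only: complex_norm_square)
      also have "\<dots> = 1" using elim by (simp add: norm_power)
      finally have *: "w ^ m * cnj (w ^ m) = 1" .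
      have "w ^ n = w ^ m * w ^ (n - m)" using False by (simp flip: power_add)
      then have "w ^ m * cnj (w ^ n) = (w ^ m * cnj (w ^ m)) * cnj (w ^ (n - m))"
        by (simp only: complex_cnj_mult mult.assoc)
      then show ?case by (simp only: * mult_1)
    qed
  qed auto
  also have "\<dots> = cnj (\<integral>w. w ^ (n - m) \<partial>\<sigma>)"
    by (rule Bochner_Integration.integral_cnj)
  finally show ?thesis using False by (auto simp: integral_circle_power)
qed

lemma circle_integrable_bounded:
  fixes f :: "complex \<Rightarrow> 'b::{banach, second_countable_topology}"
  assumes "f \<in> borel_measurable borel" "\<And>w. cmod w = 1 \<Longrightarrow> norm (f w) \<le> C"
  shows "integrable \<sigma> f"
  by (rule circle.integrable_const_bound[where B = C])
    (use AE_circle_norm assms in \<open>auto elim!: eventually_mono simp: measurable_def\<close>)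

lemma integral_circle_series:
  fixes h :: "complex \<Rightarrow> complex" and u :: "nat \<Rightarrow> complex \<Rightarrow> complex"
  assumes [measurable]: "h \<in> borel_measurable borel" "\<And>n. u n \<in> borel_measurable borel"
    and h: "\<And>w. cmod w = 1 \<Longrightarrow> cmod (h w) \<le> C"
    and u: "\<And>n w. cmod w = 1 \<Longrightarrow> cmod (u n w) \<le> c n" and c: "summable c"
  shows "(\<lambda>n. \<integral>w. h w * u n w \<partial>\<sigma>) sums (\<integral>w. h w * (\<Sum>n. u n w) \<partial>\<sigma>)"
proof -
  have C: "0 \<le> C" using order_trans[OF norm_ge_zero h[of 1]] by simp
  have bd: "cmod (h w * u n w) \<le> C * c n" if "cmod w = 1" for n w
    using that C by (simp add: norm_mult mult_mono h u)
  have int: "integrable \<sigma> (\<lambda>w. h w * u n w)" for n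
    by (rule circle_integrable_bounded[OF _ bd]) auto
  have AE_sm: "AE w in \<sigma>. summable (\<lambda>n. norm (h w * u n w))"
    using AE_circle_norm
    by eventually_elim (rule summable_comparison_test'[OF summable_mult[OF c, of C], where N = 0], simp add: bd)
  have "(\<integral>w. norm (h w * u n w) \<partial>\<sigma>) \<le> (\<integral>w. C * c n \<partial>\<sigma>)" for n
    by (rule integral_mono_AE) (use AE_circle_norm int in \<open>auto elim!: eventually_mono intro: bd\<close>)
  then have "(\<integral>w. norm (h w * u n w) \<partial>\<sigma>) \<le> C * c n" for n
    by (simp add: measure_def emeasure_circle_UNIV)
  then have sm: "summable (\<lambda>n. \<integral>w. norm (h w * u n w) \<partial>\<sigma>)"
    by (intro summable_comparison_test'[OF summable_mult[OF c, of C], where N = 0]) simp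
  have "(\<lambda>n. \<integral>w. h w * u n w \<partial>\<sigma>) sums (\<integral>w. (\<Sum>n. h w * u n w) \<partial>\<sigma>)"
    by (rule sums_integral[OF int AE_sm sm])
  also have "(\<integral>w. (\<Sum>n. h w * u n w) \<partial>\<sigma>) = (\<integral>w. h w * (\<Sum>n. u n w) \<partial>\<sigma>)"
  proof (rule integral_cong_AE)
    show "AE w in \<sigma>. (\<Sum>n. h w * u n w) = h w * (\<Sum>n. u n w)"
      using AE_circle_norm
    proof eventually_elim
      case (elim w)
      then have "summable (\<lambda>n. u n w)"
        by (intro summable_comparison_test'[OF c, where N = 0]) (simp add: u)
      then show ?case by (rule suminf_mult)
    qed
  qed auto
  finally show ?thesis .
qed

section \<open>Power series with absolutely summable coefficients\<close>

definition power_series :: "(nat \<Rightarrow> complex) \<Rightarrow> complex \<Rightarrow> complex" where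
  "power_series a w = (\<Sum>n. a n * w ^ n)"

lemma power_series_measurable [measurable]: "power_series a \<in> borel_measurable borel"
  unfolding power_series_def[abs_def] by measurable

text \<open>Such a series converges on the closed disk, so its circle values and disk values belong
  to one function. Dilations of H2 functions are of this kind, and estimates for H2 are first proved
  for them.\<close>

locale wiener =
  fixes a :: "nat \<Rightarrow> complex"
  assumes summable_norm: "summable (\<lambda>n. cmod (a n))"
begin

lemma term_bound: "cmod w \<le> 1 \<Longrightarrow> cmod (a n * w ^ n) \<le> cmod (a n)"
  by (simp add: norm_mult norm_power mult_left_le power_le_one)

lemma summable_term: "cmod w \<le> 1 \<Longrightarrow> summable (\<lambda>n. a n * w ^ n)"
  by (rule summable_comparison_test'[OF summable_norm, where N = 0]) (rule term_bound)

lemma power_series_bound: "cmod w \<le> 1 \<Longrightarrow> cmod (power_series a w) \<le> (\<Sum>n. cmod (a n))"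
  unfolding power_series_def
  by (rule norm_suminf_le[OF _ summable_norm]) (rule term_bound)

lemma integral_mult_power: "(\<integral>w. power_series a w * w ^ k \<partial>\<sigma>) = (if k = 0 then a 0 else 0)"
proof -
  have "(\<lambda>n. \<integral>w. w ^ k * (a n * w ^ n) \<partial>\<sigma>) sums
      (\<integral>w. w ^ k * (\<Sum>n. a n * w ^ n) \<partial>\<sigma>)"
    by (rule integral_circle_series[OF _ _ _ term_bound summable_norm, where C = 1])
      (auto simp: norm_power)
  moreover have "(\<integral>w. w ^ k * (a n * w ^ n) \<partial>\<sigma>) = a n * (\<integral>w. w ^ (n + k) \<partial>\<sigma>)" for n
    by (subst integral_mult_right_zero[symmetric]) (simp add: power_add mult_ac)
  ultimately have "(\<lambda>n. if n = 0 \<and> k = 0 then a 0 else 0) sums (\<integral>w. power_series a w * w ^ k \<partial>\<sigma>)"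
    by (simp add: integral_circle_power power_series_def mult.commute if_distrib cong: if_cong)
  moreover have "(\<lambda>n. if n = 0 \<and> k = 0 then a 0 else 0) sums (if k = 0 then a 0 else 0)"
    using sums_If_finite_set[of "{0}" "\<lambda>n::nat. if k = 0 then a 0 else 0"] by (simp add: if_distrib cong: if_cong conj_cong)
  ultimately show ?thesis by (rule sums_unique2)
qed

lemma integral_mult_cnj_power: "(\<integral>w. power_series a w * cnj (w ^ k) \<partial>\<sigma>) = a k"
proof -
  have "(\<lambda>n. \<integral>w. cnj (w ^ k) * (a n * w ^ n) \<partial>\<sigma>) sums
      (\<integral>w. cnj (w ^ k) * (\<Sum>n. a n * w ^ n) \<partial>\<sigma>)"
    by (rule integral_circle_series[OF _ _ _ term_bound summable_norm, where C = 1])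
      (auto simp: norm_power)
  moreover have "(\<integral>w. cnj (w ^ k) * (a n * w ^ n) \<partial>\<sigma>) = (if n = k then a n else 0)" for n
  proof -
    have "(\<integral>w. cnj (w ^ k) * (a n * w ^ n) \<partial>\<sigma>) = (\<integral>w. a n * (w ^ n * cnj (w ^ k)) \<partial>\<sigma>)"
      by (simp add: mult_ac)
    then show ?thesis by (simp add: integral_circle_power_cnj del: complex_cnj_power)
  qed
  ultimately have "(\<lambda>n. if n = k then a n else 0) sums (\<integral>w. power_series a w * cnj (w ^ k) \<partial>\<sigma>)"
    by (simp add: power_series_def mult.commute)
  moreover have "(\<lambda>n. if n = k then a n else 0) sums a k" by (rule sums_single)
  ultimately show ?thesis by (rule sums_unique2)
qed

end

lemma parseval_wiener:
  assumes "wiener a" "wiener b"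
  shows "(\<lambda>n. a n * cnj (b n)) sums (\<integral>w. power_series a w * cnj (power_series b w) \<partial>\<sigma>)"
proof -
  interpret a: wiener a by fact
  interpret b: wiener b by fact
  have "(\<lambda>n. \<integral>w. power_series a w * cnj (b n * w ^ n) \<partial>\<sigma>) sums
      (\<integral>w. power_series a w * (\<Sum>n. cnj (b n * w ^ n)) \<partial>\<sigma>)"
    by (rule integral_circle_series[OF _ _ a.power_series_bound _ b.summable_norm])
      (auto simp del: complex_cnj_mult intro: b.term_bound simp: complex_mod_cnj)
  moreover have "(\<integral>w. power_series a w * cnj (b n * w ^ n) \<partial>\<sigma>) = a n * cnj (b n)" for n
  proof -
    have "(\<integral>w. power_series a w * cnj (b n * w ^ n) \<partial>\<sigma>) =
        (\<integral>w. cnj (b n) * (power_series a w * cnj (w ^ n)) \<partial>\<sigma>)"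
      by (simp add: mult_ac)
    then show ?thesis using a.integral_mult_cnj_power[of n] by (simp del: complex_cnj_power)
  qed
  moreover have "(\<integral>w. power_series a w * (\<Sum>n. cnj (b n * w ^ n)) \<partial>\<sigma>) =
      (\<integral>w. power_series a w * cnj (power_series b w) \<partial>\<sigma>)"
  proof (rule integral_cong_AE)
    show "AE w in \<sigma>. power_series a w * (\<Sum>n. cnj (b n * w ^ n)) =
        power_series a w * cnj (power_series b w)"
      using AE_circle_norm
    proof eventually_elim
      case (elim w)
      have "(\<lambda>n. b n * w ^ n) sums power_series b w"
        unfolding power_series_def using elim by (intro summable_sums b.summable_term) simp
      then have "(\<lambda>n. cnj (b n * w ^ n)) sums cnj (power_series b w)" by (simp only: sums_cnj)
      then show ?case by (simp only: sums_unique[symmetric])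
    qed
  qed auto
  ultimately show ?thesis by simp
qed

section \<open>The Poisson kernel\<close>

definition poisson_kernel :: "complex \<Rightarrow> complex \<Rightarrow> real" where
  "poisson_kernel z w = (1 - (cmod z)\<^sup>2) / (cmod (1 - z * cnj w))\<^sup>2"

lemma poisson_kernel_measurable [measurable (raw)]:
  assumes [measurable]: "f \<in> borel_measurable M" "g \<in> borel_measurable M"
  shows "(\<lambda>x. poisson_kernel (f x) (g x)) \<in> borel_measurable M"
  unfolding poisson_kernel_def by measurable

lemma poisson_kernel_Re:
  assumes "cmod w = 1" "cmod z < 1"
  shows "poisson_kernel z w = Re (2 / (1 - z * cnj w) - 1)"
proof -
  define u where "u = z * cnj w"
  have u: "cmod u = cmod z" using assms by (simp add: u_def norm_mult)
  have ne: "1 - u \<noteq> 0" using u assms(2) by auto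
  have "2 / (1 - u) - 1 = (1 + u) / (1 - u)" using ne by (simp add: field_simps)
  also have "\<dots> = (1 + u) * cnj (1 - u) / of_real ((cmod (1 - u))\<^sup>2)"
    using complex_div_cnj[of "1 + u" "1 - u"] by simp
  also have "Re \<dots> = (1 - (cmod u)\<^sup>2) / (cmod (1 - u))\<^sup>2"
    by (simp add: cmod_power2) (simp add: power2_eq_square algebra_simps)
  finally show ?thesis unfolding poisson_kernel_def u[symmetric] u_def[symmetric] by simp
qed

lemma poisson_kernel_bounds:
  assumes "cmod w = 1" "cmod z \<le> R" "R < 1"
  shows "0 \<le> poisson_kernel z w" "poisson_kernel z w \<le> 1 / (1 - R)\<^sup>2"
proof -
  have le1: "(cmod z)\<^sup>2 \<le> 1" using assms by (simp add: power_le_one)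
  then show "0 \<le> poisson_kernel z w" by (simp add: poisson_kernel_def)
  have "1 - R \<le> cmod (1 - z * cnj w)"
    using norm_triangle_ineq2[of 1 "z * cnj w"] assms by (simp add: norm_mult)
  then have "(1 - R)\<^sup>2 \<le> (cmod (1 - z * cnj w))\<^sup>2" using assms by (intro power_mono) auto
  moreover have "0 < (1 - R)\<^sup>2" using assms by simp
  ultimately show "poisson_kernel z w \<le> 1 / (1 - R)\<^sup>2"
    unfolding poisson_kernel_def using le1 by (intro frac_le) auto
qed

lemma poisson_kernel_sym:
  assumes "cmod w = 1" "cmod v = 1"
  shows "poisson_kernel (of_real r * v) w = poisson_kernel (of_real r * w) v"
proof -
  have "cmod (1 - of_real r * v * cnj w) = cmod (cnj (1 - of_real r * v * cnj w))"
    by (simp only: complex_mod_cnj)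
  then show ?thesis using assms by (simp add: poisson_kernel_def norm_mult mult_ac)
qed

text \<open>With u = v \<open>cnj\<close> w, both |1 - r u| and |1 - s u| are at most 2 |1 - r s u|,
  and 1 - (r s)^2 <= (1 - r^2) + (1 - s^2). Each summand on the right is paired with the denominator
  of its own radius.\<close>

lemma poisson_kernel_product_le:
  assumes w: "cmod w = 1" and v: "cmod v = 1" and r: "0 \<le> r" "r < 1" "0 \<le> s" "s < 1"
  shows "poisson_kernel (of_real (r * s) * v) w \<le>
    4 * (poisson_kernel (of_real r * v) w + poisson_kernel (of_real s * v) w)"
proof -
  define u where "u = v * cnj w"
  have u: "cmod u = 1" by (simp add: u_def w v norm_mult)
  have nz: "0 < cmod (1 - of_real t * u)" if "0 \<le> t" "t < 1" for t
  proof -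
    have "1 - t \<le> cmod (1 - of_real t * u)"
      using norm_triangle_ineq2[of 1 "of_real t * u"] u that by (simp add: norm_mult)
    then show ?thesis using that by linarith
  qed
  have half: "cmod (1 - of_real t * u) \<le> 2 * cmod (1 - of_real (t * t') * u)"
    if "0 \<le> t" "t < 1" "0 \<le> t'" "t' < 1" for t t'
  proof -
    have "1 - of_real t * u = (1 - of_real (t * t') * u) - of_real (t * (1 - t')) * u"
      by (simp add: algebra_simps)
    then have "cmod (1 - of_real t * u) \<le> cmod (1 - of_real (t * t') * u) + cmod (of_real (t * (1 - t')) * u)"
      by (metis norm_triangle_ineq4)
    also have "cmod (of_real (t * (1 - t')) * u) = t * (1 - t')"
      unfolding norm_mult[of _ u] norm_of_real using that u by simp
    also have "t * (1 - t') \<le> 1 - t * t'" using that by (simp add: algebra_simps)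
    also have "1 - t * t' \<le> cmod (1 - of_real (t * t') * u)"
      using norm_triangle_ineq2[of 1 "of_real (t * t') * u"] u that by (simp add: norm_mult)
    finally show ?thesis by simp
  qed
  have inv: "1 / (cmod (1 - of_real (t * t') * u))\<^sup>2 \<le> 4 / (cmod (1 - of_real t * u))\<^sup>2"
    if "0 \<le> t" "t < 1" "0 \<le> t'" "t' < 1" for t t'
  proof -
    have "(cmod (1 - of_real t * u))\<^sup>2 \<le> (2 * cmod (1 - of_real (t * t') * u))\<^sup>2"
      using half[OF that] by (intro power_mono) auto
    moreover have "0 < cmod (1 - of_real (t * t') * u)"
      using that nz[of "t * t'"] by (simp add: mult_le_one mult_less_le_imp_less mult_strict_mono' le_less_trans[OF mult_left_le])
    ultimately show ?thesis using nz[OF that(1,2)] by (simp add: field_simps power_mult_distrib)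
  qed
  define D where "D = 1 / (cmod (1 - of_real (r * s) * u))\<^sup>2"
  have D: "0 \<le> D" "D \<le> 4 / (cmod (1 - of_real r * u))\<^sup>2" "D \<le> 4 / (cmod (1 - of_real s * u))\<^sup>2"
    using inv[of r s] inv[of s r] r by (auto simp: D_def mult.commute)
  have "poisson_kernel (of_real (r * s) * v) w = (1 - (r * s)\<^sup>2) * D"
    using r v by (simp add: poisson_kernel_def D_def u_def norm_mult mult.assoc)
  also have "\<dots> \<le> ((1 - r\<^sup>2) + (1 - s\<^sup>2)) * D"
  proof (rule mult_right_mono)
    have "0 \<le> (1 - r\<^sup>2) * (1 - s\<^sup>2)" using r by (simp add: power_le_one)
    then show "1 - (r * s)\<^sup>2 \<le> (1 - r\<^sup>2) + (1 - s\<^sup>2)" by (simp add: algebra_simps power_mult_distrib)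
  qed (rule D)
  also have "\<dots> \<le> (1 - r\<^sup>2) * (4 / (cmod (1 - of_real r * u))\<^sup>2) + (1 - s\<^sup>2) * (4 / (cmod (1 - of_real s * u))\<^sup>2)"
    unfolding distrib_right using D r by (intro add_mono mult_left_mono) (auto simp: power_le_one)
  also have "\<dots> = 4 * (poisson_kernel (of_real r * v) w + poisson_kernel (of_real s * v) w)"
    using r v by (simp add: poisson_kernel_def u_def norm_mult mult.assoc) (simp add: mult.commute)
  finally show ?thesis .
qed

text \<open>On the circle the kernel is the sum of z^n \<open>cnj\<close> w^n over n >= 0 plus the
  conjugate terms over n >= 1. The first half returns the power series at z, and the second
  integrates to 0 against nonnegative powers of w.\<close>

lemma (in wiener) poisson_formula:
  assumes z: "cmod z < 1"
  shows "(\<integral>w. of_real (poisson_kernel z w) * power_series a w \<partial>\<sigma>) = power_series a z"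
proof -
  have geo: "summable (\<lambda>n. cmod z ^ n)" using z by (simp add: summable_geometric)
  have 1: "(\<lambda>n. \<integral>w. power_series a w * (z ^ n * cnj (w ^ n)) \<partial>\<sigma>) sums
      (\<integral>w. power_series a w * (\<Sum>n. z ^ n * cnj (w ^ n)) \<partial>\<sigma>)"
    by (rule integral_circle_series[OF _ _ power_series_bound _ geo]) (auto simp: norm_mult norm_power)
  have 2: "(\<lambda>n. \<integral>w. power_series a w * (cnj z ^ Suc n * w ^ Suc n) \<partial>\<sigma>) sums
      (\<integral>w. power_series a w * (\<Sum>n. cnj z ^ Suc n * w ^ Suc n) \<partial>\<sigma>)"
    by (rule integral_circle_series[OF _ _ power_series_bound _ summable_Suc_iff[THEN iffD2, OF geo]])
      (auto simp: norm_mult norm_power)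
  have "(\<integral>w. power_series a w * (z ^ n * cnj (w ^ n)) \<partial>\<sigma>) = a n * z ^ n" for n
  proof -
    have "(\<integral>w. power_series a w * (z ^ n * cnj (w ^ n)) \<partial>\<sigma>) =
        (\<integral>w. z ^ n * (power_series a w * cnj (w ^ n)) \<partial>\<sigma>)" by (simp add: mult_ac)
    then show ?thesis using integral_mult_cnj_power[of n] by (simp del: complex_cnj_power)
  qed
  with 1 have I1: "(\<integral>w. power_series a w * (\<Sum>n. z ^ n * cnj (w ^ n)) \<partial>\<sigma>) = power_series a z"
    by (simp add: power_series_def sums_unique)
  have "(\<integral>w. power_series a w * (cnj z ^ Suc n * w ^ Suc n) \<partial>\<sigma>) = 0" for n
  proof -
    have "(\<integral>w. power_series a w * (cnj z ^ Suc n * w ^ Suc n) \<partial>\<sigma>) =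
        (\<integral>w. cnj z ^ Suc n * (power_series a w * w ^ Suc n) \<partial>\<sigma>)" by (simp only: mult_ac)
    then show ?thesis using integral_mult_power[of "Suc n"] by (simp del: power_Suc)
  qed
  with 2 have I2: "(\<integral>w. power_series a w * (\<Sum>n. cnj z ^ Suc n * w ^ Suc n) \<partial>\<sigma>) = 0"
    using sums_unique2[OF _ sums_zero] by (simp del: power_Suc)
  have sp: "(\<Sum>n. z ^ n * cnj (w ^ n)) = 1 / (1 - z * cnj w)"
    and sq: "(\<Sum>n. cnj z ^ Suc n * w ^ Suc n) = cnj z * w / (1 - cnj z * w)" if "cmod w = 1" for w
  proof -
    have "cmod (z * cnj w) < 1" using that z by (simp add: norm_mult)
    from suminf_geometric[OF this] show "(\<Sum>n. z ^ n * cnj (w ^ n)) = 1 / (1 - z * cnj w)"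
      by (simp add: power_mult_distrib)
    have c: "cmod (cnj z * w) < 1" using that z by (simp add: norm_mult)
    have "(\<Sum>n. (cnj z * w) * (cnj z * w) ^ n) = (cnj z * w) * (1 / (1 - cnj z * w))"
      using suminf_mult[OF summable_geometric[OF c]] suminf_geometric[OF c] by simp
    then show "(\<Sum>n. cnj z ^ Suc n * w ^ Suc n) = cnj z * w / (1 - cnj z * w)"
      by (simp add: power_mult_distrib mult_ac)
  qed
  have P: "of_real (poisson_kernel z w) = (\<Sum>n. z ^ n * cnj (w ^ n)) + (\<Sum>n. cnj z ^ Suc n * w ^ Suc n)"
    if w: "cmod w = 1" for w
  proof -
    define u where "u = z * cnj w"
    have cu: "cmod u < 1" using that z by (simp add: u_def norm_mult)
    then have "u \<noteq> 1" "cnj u \<noteq> 1" by auto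
    then have ne: "1 - u \<noteq> 0" "1 - cnj u \<noteq> 0" by auto
    have "cmod z = cmod u" using w by (simp add: u_def norm_mult)
    then have "of_real (poisson_kernel z w) = (1 - u * cnj u) / ((1 - u) * cnj (1 - u))"
      unfolding poisson_kernel_def u_def[symmetric]
      by (simp only: of_real_divide of_real_diff complex_norm_square of_real_1)
    also have "\<dots> = 1 / (1 - u) + cnj u / (1 - cnj u)"
      using ne by (simp add: field_simps)
    finally show ?thesis unfolding sp[OF w] sq[OF w] by (simp add: u_def)
  qed
  have b1: "cmod (power_series a w * (\<Sum>n. z ^ n * cnj (w ^ n))) \<le> (\<Sum>n. cmod (a n)) * (1 / (1 - cmod z))"
    and b2: "cmod (power_series a w * (\<Sum>n. cnj z ^ Suc n * w ^ Suc n)) \<le> (\<Sum>n. cmod (a n)) * (1 / (1 - cmod z))"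
    if w: "cmod w = 1" for w
  proof -
    have "1 - cmod z \<le> cmod (1 - z * cnj w)" "1 - cmod z \<le> cmod (1 - cnj z * w)"
      using norm_triangle_ineq2[of 1 "z * cnj w"] norm_triangle_ineq2[of 1 "cnj z * w"] w by (simp_all add: norm_mult)
    then have "cmod (1 / (1 - z * cnj w)) \<le> 1 / (1 - cmod z)" "cmod (cnj z * w / (1 - cnj z * w)) \<le> 1 / (1 - cmod z)"
      using z w by (auto simp: norm_divide norm_mult intro!: frac_le)
    then show "cmod (power_series a w * (\<Sum>n. z ^ n * cnj (w ^ n))) \<le> (\<Sum>n. cmod (a n)) * (1 / (1 - cmod z))"
      "cmod (power_series a w * (\<Sum>n. cnj z ^ Suc n * w ^ Suc n)) \<le> (\<Sum>n. cmod (a n)) * (1 / (1 - cmod z))"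
      unfolding sp[OF w] sq[OF w] norm_mult[of "power_series a w"]
      by (intro mult_mono power_series_bound suminf_nonneg summable_norm norm_ge_zero; use w in simp)+
  qed
  have "(\<integral>w. of_real (poisson_kernel z w) * power_series a w \<partial>\<sigma>) =
      (\<integral>w. power_series a w * (\<Sum>n. z ^ n * cnj (w ^ n)) +
         power_series a w * (\<Sum>n. cnj z ^ Suc n * w ^ Suc n) \<partial>\<sigma>)"
  proof (rule integral_cong_AE)
    show "AE w in \<sigma>. of_real (poisson_kernel z w) * power_series a w =
        power_series a w * (\<Sum>n. z ^ n * cnj (w ^ n)) + power_series a w * (\<Sum>n. cnj z ^ Suc n * w ^ Suc n)"
      using AE_circle_norm by eventually_elim (simp only: P distrib_left mult.commute)
  qed auto
  also have "\<dots> = (\<integral>w. power_series a w * (\<Sum>n. z ^ n * cnj (w ^ n)) \<partial>\<sigma>) +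
      (\<integral>w. power_series a w * (\<Sum>n. cnj z ^ Suc n * w ^ Suc n) \<partial>\<sigma>)"
    by (intro Bochner_Integration.integral_add circle_integrable_bounded[OF _ b1] circle_integrable_bounded[OF _ b2]) auto
  finally show ?thesis by (simp only: I1 I2 add_0_right)
qed

section \<open>The Poisson maximal inequality\<close>

interpretation circle_pair: pair_sigma_finite \<sigma> \<sigma>
  by unfold_locales

text \<open>As a function of z on the circle, the second kernel is the real part of the power series
  of 2 / (1 - q z) - 1 with q = s \<open>cnj\<close> w. The Poisson formula evaluates this series at
  r v, where its real part is the kernel of the product radius.\<close>

lemma poisson_semigroup:
  assumes v: "cmod v = 1" and w: "cmod w = 1" and r: "0 \<le> r" "r < 1" "0 \<le> s" "s < 1"
  shows "(\<integral>\<^sup>+ z. ennreal (poisson_kernel (of_real r * v) z) * ennreal (poisson_kernel (of_real s * w) z) \<partial>\<sigma>)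
    = ennreal (poisson_kernel (of_real (r * s) * v) w)"
proof -
  define q where "q = of_real s * cnj w"
  have q: "cmod q = s" using w r by (simp add: q_def norm_mult)
  define c where "c n = (if n = 0 then 1 else 2 * q ^ n)" for n :: nat
  have geo: "summable (\<lambda>n. s ^ n)" using r by simp
  interpret wiener c
  proof
    show "summable (\<lambda>n. cmod (c n))"
      by (rule summable_comparison_test'[OF summable_mult[OF geo, of 2], where N = 0])
        (use r in \<open>auto simp: c_def norm_mult norm_power q\<close>)
  qed
  have c_eq: "power_series c u = 2 / (1 - of_real s * u * cnj w) - 1" if u: "cmod u \<le> 1" for u
  proof -
    have "cmod (q * u) \<le> s" using q u r by (simp add: norm_mult mult_left_le)
    then have "cmod (q * u) < 1" using r by simp
    then have "(\<lambda>n. 2 * (q * u) ^ n) sums (2 * (1 / (1 - q * u)))"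
      by (intro sums_mult geometric_sums)
    then have "(\<lambda>n. 2 * (q * u) ^ n - (if n = 0 then 1 else 0)) sums (2 * (1 / (1 - q * u)) - 1)"
      using sums_single[of 0 "\<lambda>_. 1::complex"] by (intro sums_diff) auto
    moreover have "(\<lambda>n. 2 * (q * u) ^ n - (if n = 0 then 1 else 0)) = (\<lambda>n. c n * u ^ n)"
      by (auto simp: c_def power_mult_distrib fun_eq_iff)
    ultimately show ?thesis by (simp add: power_series_def sums_iff q_def mult_ac)
  qed
  have Re_c: "Re (power_series c u) = poisson_kernel (of_real s * u) w" if "cmod u \<le> 1" for u
  proof (subst poisson_kernel_Re[OF w])
    have "cmod (of_real s * u) \<le> s" using that r by (simp add: norm_mult mult_left_le)
    then show "cmod (of_real s * u) < 1" using r by simp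
  qed (simp add: c_eq[OF that])
  have rv: "cmod (of_real r * v) < 1" using v r by (simp add: norm_mult)
  have bP: "0 \<le> poisson_kernel (of_real r * v) z" "poisson_kernel (of_real r * v) z \<le> 1 / (1 - r)\<^sup>2"
    if "cmod z = 1" for z
    using poisson_kernel_bounds[OF that, of "of_real r * v" r] v r by (auto simp: norm_mult)
  have bS: "0 \<le> poisson_kernel (of_real s * w) z" if "cmod z = 1" for z
    using poisson_kernel_bounds[OF that, of "of_real s * w" s] w r by (auto simp: norm_mult)
  have int: "integrable \<sigma> (\<lambda>z. of_real (poisson_kernel (of_real r * v) z) * power_series c z)"
  proof (rule circle_integrable_bounded)
    show "cmod (of_real (poisson_kernel (of_real r * v) z) * power_series c z) \<le>
        1 / (1 - r)\<^sup>2 * (\<Sum>n. cmod (c n))" if "cmod z = 1" for z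
      unfolding norm_mult norm_of_real using bP[OF that] that
      by (intro mult_mono power_series_bound suminf_nonneg summable_norm) auto
  qed auto
  have eq: "AE z in \<sigma>. Re (of_real (poisson_kernel (of_real r * v) z) * power_series c z) =
      poisson_kernel (of_real r * v) z * poisson_kernel (of_real s * w) z"
    using AE_circle_norm
  proof eventually_elim
    case (elim z)
    then show ?case using Re_c[of z] poisson_kernel_sym[OF elim w, of s] by simp
  qed
  have "Re (\<integral>z. of_real (poisson_kernel (of_real r * v) z) * power_series c z \<partial>\<sigma>) =
      (\<integral>z. Re (of_real (poisson_kernel (of_real r * v) z) * power_series c z) \<partial>\<sigma>)"
    by (rule integral_Re[OF int, symmetric])
  also have "\<dots> = (\<integral>z. poisson_kernel (of_real r * v) z * poisson_kernel (of_real s * w) z \<partial>\<sigma>)"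
    using eq by (intro integral_cong_AE) auto
  finally have I: "(\<integral>z. poisson_kernel (of_real r * v) z * poisson_kernel (of_real s * w) z \<partial>\<sigma>) =
      poisson_kernel (of_real (r * s) * v) w"
    using poisson_formula[OF rv] Re_c[of "of_real r * v"] rv by (simp add: mult_ac)
  have "(\<integral>\<^sup>+ z. ennreal (poisson_kernel (of_real r * v) z) * ennreal (poisson_kernel (of_real s * w) z) \<partial>\<sigma>)
      = (\<integral>\<^sup>+ z. ennreal (poisson_kernel (of_real r * v) z * poisson_kernel (of_real s * w) z) \<partial>\<sigma>)"
    using AE_circle_norm by (intro nn_integral_cong_AE) (auto elim!: eventually_mono simp: ennreal_mult bP bS)
  also have "\<dots> = ennreal (\<integral>z. poisson_kernel (of_real r * v) z * poisson_kernel (of_real s * w) z \<partial>\<sigma>)"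
  proof (rule nn_integral_eq_integral)
    have "integrable \<sigma> (\<lambda>z. Re (of_real (poisson_kernel (of_real r * v) z) * power_series c z))"
      using int by (rule integrable_Re)
    moreover have "integrable \<sigma> (\<lambda>z. Re (of_real (poisson_kernel (of_real r * v) z) * power_series c z))
        = integrable \<sigma> (\<lambda>z. poisson_kernel (of_real r * v) z * poisson_kernel (of_real s * w) z)"
      by (rule integrable_cong_AE[OF _ _ eq]) auto
    ultimately show "integrable \<sigma> (\<lambda>z. poisson_kernel (of_real r * v) z * poisson_kernel (of_real s * w) z)"
      by simp
    show "AE z in \<sigma>. 0 \<le> poisson_kernel (of_real r * v) z * poisson_kernel (of_real s * w) z"
      using AE_circle_norm by eventually_elim (auto simp: bP bS)
  qed
  finally show ?thesis by (simp only: I)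
qed

text \<open>
  The maximal inequality is proved by the \<open>T T\<^sup>*\<close> method: with the radius \<open>R \<theta>\<close> frozen as a
  function of the point, the kernel of \<open>T T\<^sup>*\<close> is \<open>P\<^bsub>R \<theta> R \<theta>'\<^esub>\<close>, which is at most
  \<open>4 (P\<^bsub>R \<theta>\<^esub> + P\<^bsub>R \<theta>'\<^esub>)\<close>, that is, at most the kernel of \<open>4 (T + T\<^sup>*)\<close>.
\<close>

lemma poisson_adjoint_bound:
  fixes g :: "complex \<Rightarrow> ennreal" and R :: "complex \<Rightarrow> real" and G :: real
  assumes [measurable]: "R \<in> borel_measurable borel" "g \<in> borel_measurable borel"
    and R: "\<And>x. 0 \<le> R x" "\<And>x. R x \<le> \<rho>" "\<rho> < 1"
    and G: "\<And>x. cmod x = 1 \<Longrightarrow> g x \<le> ennreal G"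
  defines "h \<equiv> \<lambda>z. \<integral>\<^sup>+ x. ennreal (poisson_kernel (of_real (R x) * x) z) * g x \<partial>\<sigma>"
  shows "(\<integral>\<^sup>+ z. (h z)\<^sup>2 \<partial>\<sigma>) \<le> 64 * (\<integral>\<^sup>+ x. (g x)\<^sup>2 \<partial>\<sigma>)"
proof -
  define K where "K x z = ennreal (poisson_kernel (of_real (R x) * x) z)" for x z
  have K_meas [measurable]: "(\<lambda>p. K (f p) (f' p)) \<in> borel_measurable M"
    if [measurable]: "f \<in> borel_measurable M" "f' \<in> borel_measurable M" for f f' and M :: "'a measure"
    unfolding K_def by measurable
  have h: "h z = (\<integral>\<^sup>+ x. K x z * g x \<partial>\<sigma>)" for z by (simp add: h_def K_def)
  have h_meas [measurable]: "h \<in> borel_measurable borel"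
    unfolding h by measurable
  have R1: "R x < 1" for x using R(2)[of x] R(3) by simp
  define H where "H = (\<integral>\<^sup>+ z. (h z)\<^sup>2 \<partial>\<sigma>)"
  define I where "I = (\<integral>\<^sup>+ z. g z * h z \<partial>\<sigma>)"
  \<comment> \<open>Opening the square and integrating over z first produces the kernel of T T^*,
    which the semigroup identity evaluates.\<close>
  have "H = (\<integral>\<^sup>+ z. (\<integral>\<^sup>+ x. (\<integral>\<^sup>+ y. (K x z * g x) * (K y z * g y) \<partial>\<sigma>) \<partial>\<sigma>) \<partial>\<sigma>)"
    unfolding H_def h power2_eq_square
    by (intro nn_integral_cong) (simp add: nn_integral_cmult nn_integral_multc)
  also have "\<dots> = (\<integral>\<^sup>+ x. (\<integral>\<^sup>+ z. (\<integral>\<^sup>+ y. (K x z * g x) * (K y z * g y) \<partial>\<sigma>) \<partial>\<sigma>) \<partial>\<sigma>)"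
    by (rule circle_pair.Fubini') measurable
  also have "\<dots> = (\<integral>\<^sup>+ x. (\<integral>\<^sup>+ y. (\<integral>\<^sup>+ z. (K x z * g x) * (K y z * g y) \<partial>\<sigma>) \<partial>\<sigma>) \<partial>\<sigma>)"
    by (intro nn_integral_cong circle_pair.Fubini') measurable
  also have "\<dots> \<le> (\<integral>\<^sup>+ x. (\<integral>\<^sup>+ y. 4 * (g y * (K x y * g x)) + 4 * (g x * (K y x * g y)) \<partial>\<sigma>) \<partial>\<sigma>)"
  proof (rule nn_integral_mono_AE)
    show "AE x in \<sigma>. (\<integral>\<^sup>+ y. (\<integral>\<^sup>+ z. (K x z * g x) * (K y z * g y) \<partial>\<sigma>) \<partial>\<sigma>)
        \<le> (\<integral>\<^sup>+ y. 4 * (g y * (K x y * g x)) + 4 * (g x * (K y x * g y)) \<partial>\<sigma>)"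
      using AE_circle_norm
    proof eventually_elim
      case (elim x)
      show ?case
      proof (rule nn_integral_mono_AE)
        show "AE y in \<sigma>. (\<integral>\<^sup>+ z. (K x z * g x) * (K y z * g y) \<partial>\<sigma>)
          \<le> 4 * (g y * (K x y * g x)) + 4 * (g x * (K y x * g y))"
          using AE_circle_norm
        proof eventually_elim
          case (elim y)
          note xy = \<open>cmod x = 1\<close> \<open>cmod y = 1\<close>
          have "(\<integral>\<^sup>+ z. K x z * K y z \<partial>\<sigma>) = ennreal (poisson_kernel (of_real (R x * R y) * x) y)"
            unfolding K_def by (rule poisson_semigroup) (use xy R R1 in auto)
          also have "\<dots> \<le> ennreal (4 * (poisson_kernel (of_real (R x) * x) y + poisson_kernel (of_real (R y) * x) y))"
            by (intro ennreal_leI poisson_kernel_product_le) (use xy R R1 in auto)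
          also have "poisson_kernel (of_real (R y) * x) y = poisson_kernel (of_real (R y) * y) x"
            by (rule poisson_kernel_sym) (use xy in auto)
          also have "ennreal (4 * (poisson_kernel (of_real (R x) * x) y + poisson_kernel (of_real (R y) * y) x)) =
              4 * (K x y + K y x)"
          proof -
            have "0 \<le> poisson_kernel (of_real (R x) * x) y" "0 \<le> poisson_kernel (of_real (R y) * y) x"
              using poisson_kernel_bounds(1)[of y "of_real (R x) * x" \<rho>] poisson_kernel_bounds(1)[of x "of_real (R y) * y" \<rho>]
                R xy by (auto simp: norm_mult)
            then show ?thesis by (simp add: K_def ennreal_mult)
          qed
          finally have le: "(\<integral>\<^sup>+ z. K x z * K y z \<partial>\<sigma>) \<le> 4 * (K x y + K y x)" .
          have "(\<integral>\<^sup>+ z. (K x z * g x) * (K y z * g y) \<partial>\<sigma>) =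
              (\<integral>\<^sup>+ z. (g x * g y) * (K x z * K y z) \<partial>\<sigma>)"
            by (simp add: mult_ac)
          also have "\<dots> = (g x * g y) * (\<integral>\<^sup>+ z. K x z * K y z \<partial>\<sigma>)"
            by (rule nn_integral_cmult) measurable
          also have "\<dots> \<le> (g x * g y) * (4 * (K x y + K y x))"
            by (rule mult_left_mono[OF le]) simp
          also have "\<dots> = 4 * (g y * (K x y * g x)) + 4 * (g x * (K y x * g y))"
            by (simp add: algebra_simps)
          finally show ?case .
        qed
      qed
    qed
  qed
  also have "\<dots> = (\<integral>\<^sup>+ x. (\<integral>\<^sup>+ y. 4 * (g y * (K x y * g x)) \<partial>\<sigma>) \<partial>\<sigma>) +
      (\<integral>\<^sup>+ x. (\<integral>\<^sup>+ y. 4 * (g x * (K y x * g y)) \<partial>\<sigma>) \<partial>\<sigma>)"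
    by (simp add: nn_integral_add)
  also have "\<dots> = 4 * I + 4 * I"
  proof (rule arg_cong2[where f = "(+)"])
    have "(\<integral>\<^sup>+ x. (\<integral>\<^sup>+ y. 4 * (g y * (K x y * g x)) \<partial>\<sigma>) \<partial>\<sigma>) =
        (\<integral>\<^sup>+ y. (\<integral>\<^sup>+ x. 4 * (g y * (K x y * g x)) \<partial>\<sigma>) \<partial>\<sigma>)"
      by (rule circle_pair.Fubini'[symmetric]) measurable
    then show "(\<integral>\<^sup>+ x. (\<integral>\<^sup>+ y. 4 * (g y * (K x y * g x)) \<partial>\<sigma>) \<partial>\<sigma>) = 4 * I"
      by (simp add: I_def h nn_integral_cmult)
    show "(\<integral>\<^sup>+ x. (\<integral>\<^sup>+ y. 4 * (g x * (K y x * g y)) \<partial>\<sigma>) \<partial>\<sigma>) = 4 * I"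
      by (simp add: I_def h nn_integral_cmult)
  qed
  finally have HI: "H \<le> 8 * I" by (simp flip: distrib_right)
  \<comment> \<open>With \<open>H \<le> 8 * I\<close> this bounds H^2 by 64 times \<open>H\<close>
    times the integral of g^2; one factor \<open>H\<close> is then cancelled.\<close>
  have CS: "I\<^sup>2 \<le> (\<integral>\<^sup>+ x. (g x)\<^sup>2 \<partial>\<sigma>) * H"
    unfolding I_def H_def by (rule Cauchy_Schwarz_nn_integral) measurable
  \<comment> \<open>Cancelling \<open>H\<close> requires finiteness, which comes from the crude
    bounds of the kernel by \<open>1 / (1 - \<rho>)\<^sup>2\<close> and of \<open>g\<close> by
    \<open>G\<close>.\<close>
  have "H < \<infinity>"
  proof -
    have "h z \<le> ennreal (1 / (1 - \<rho>)\<^sup>2) * ennreal G" if "cmod z = 1" for z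
    proof -
      have "h z \<le> (\<integral>\<^sup>+ x. ennreal (1 / (1 - \<rho>)\<^sup>2) * ennreal G \<partial>\<sigma>)"
        unfolding h
      proof (rule nn_integral_mono_AE)
        show "AE x in \<sigma>. K x z * g x \<le> ennreal (1 / (1 - \<rho>)\<^sup>2) * ennreal G"
          using AE_circle_norm
        proof eventually_elim
          case (elim x)
          show ?case unfolding K_def
            using poisson_kernel_bounds(2)[of z "of_real (R x) * x" \<rho>] R elim that G[OF elim]
            by (intro mult_mono ennreal_leI) (auto simp: norm_mult)
        qed
      qed
      then show ?thesis by (simp add: emeasure_circle_UNIV)
    qed
    then have "AE z in \<sigma>. (h z)\<^sup>2 \<le> (ennreal (1 / (1 - \<rho>)\<^sup>2) * ennreal G)\<^sup>2"
      using AE_circle_norm by (auto elim!: eventually_mono intro: power_mono)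
    then have "H \<le> (\<integral>\<^sup>+ z. (ennreal (1 / (1 - \<rho>)\<^sup>2) * ennreal G)\<^sup>2 \<partial>\<sigma>)"
      unfolding H_def by (rule nn_integral_mono_AE)
    also have "\<dots> < \<infinity>" by (simp add: emeasure_circle_UNIV ennreal_mult_less_top power2_eq_square)
    finally show ?thesis .
  qed
  show ?thesis
  proof (cases "H = 0")
    case False
    have "H * H \<le> (8 * I) * (8 * I)" using HI by (intro mult_mono) auto
    also have "\<dots> = 64 * I\<^sup>2" by (simp add: power2_eq_square mult_ac)
    also have "\<dots> \<le> 64 * ((\<integral>\<^sup>+ x. (g x)\<^sup>2 \<partial>\<sigma>) * H)" using CS by (intro mult_left_mono) auto
    finally have "H * H \<le> H * (64 * (\<integral>\<^sup>+ x. (g x)\<^sup>2 \<partial>\<sigma>))" by (simp add: mult_ac)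
    then have "H \<le> 64 * (\<integral>\<^sup>+ x. (g x)\<^sup>2 \<partial>\<sigma>)"
      using False \<open>H < \<infinity>\<close> by (subst (asm) ennreal_mult_le_mult_iff) auto
    then show ?thesis by (simp add: H_def)
  qed (simp add: H_def)
qed

text \<open>Duality: the values at radius \<open>R\<close> are bounded by Poisson integrals of |F|,
  so \<open>I\<close> is at most the pairing of \<open>F\<close> with the adjoint integral
  \<open>h\<close> of \<open>A\<close>. Cauchy-Schwarz and \<open>poisson_adjoint_bound\<close> give
  I^2 <= 64 I ||F||^2. The constant is independent of \<open>R\<close> and \<open>\<rho>\<close>,
  which is what allows a supremum over radii.\<close>

lemma (in wiener) maximal_inequality:
  assumes [measurable]: "R \<in> borel_measurable borel"
    and R: "\<And>x. 0 \<le> R x" "\<And>x. R x \<le> \<rho>" "\<rho> < 1"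
  shows "(\<integral>\<^sup>+ x. (ennreal (cmod (power_series a (of_real (R x) * x))))\<^sup>2 \<partial>\<sigma>)
    \<le> 64 * (\<integral>\<^sup>+ x. (ennreal (cmod (power_series a x)))\<^sup>2 \<partial>\<sigma>)"
proof -
  define A where "A x = ennreal (cmod (power_series a (of_real (R x) * x)))" for x
  define F where "F x = ennreal (cmod (power_series a x))" for x
  define K where "K x z = ennreal (poisson_kernel (of_real (R x) * x) z)" for x z
  define h where "h z = (\<integral>\<^sup>+ x. K x z * A x \<partial>\<sigma>)" for z
  define I where "I = (\<integral>\<^sup>+ x. (A x)\<^sup>2 \<partial>\<sigma>)"
  define C where "C = (\<Sum>n. cmod (a n))"
  have K_meas [measurable]: "(\<lambda>p. K (f p) (f' p)) \<in> borel_measurable M"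
    if [measurable]: "f \<in> borel_measurable M" "f' \<in> borel_measurable M" for f f' and M :: "'a measure"
    unfolding K_def by measurable
  have [measurable]: "A \<in> borel_measurable borel" "F \<in> borel_measurable borel"
    unfolding A_def[abs_def] F_def[abs_def] by measurable
  have h_meas [measurable]: "h \<in> borel_measurable borel"
    unfolding h_def[abs_def] by measurable
  have Rx: "cmod (of_real (R x) * x) \<le> \<rho>" if "cmod x = 1" for x using R that by (simp add: norm_mult)
  have A_le: "A x \<le> ennreal C" if "cmod x = 1" for x
    unfolding A_def C_def using Rx[OF that] R(3) by (intro ennreal_leI power_series_bound) simp
  have A_poisson: "A x \<le> (\<integral>\<^sup>+ z. K x z * F z \<partial>\<sigma>)" if x: "cmod x = 1" for x
  proof -
    let ?P = "\<lambda>z. poisson_kernel (of_real (R x) * x) z"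
    have P: "0 \<le> ?P z" "?P z \<le> 1 / (1 - \<rho>)\<^sup>2" if "cmod z = 1" for z
      using poisson_kernel_bounds[OF that Rx[OF x] R(3)] by auto
    have bd: "cmod (of_real (?P z) * power_series a z) \<le> 1 / (1 - \<rho>)\<^sup>2 * C" if "cmod z = 1" for z
      unfolding norm_mult norm_of_real C_def using P[OF that] that
      by (intro mult_mono power_series_bound suminf_nonneg summable_norm) auto
    have int: "integrable \<sigma> (\<lambda>z. of_real (?P z) * power_series a z)"
      by (rule circle_integrable_bounded[OF _ bd]) auto
    have "A x = ennreal (cmod (\<integral>z. of_real (?P z) * power_series a z \<partial>\<sigma>))"
      unfolding A_def using Rx[OF x] R(3) by (subst poisson_formula) auto
    also have "\<dots> \<le> (\<integral>\<^sup>+ z. ennreal (cmod (of_real (?P z) * power_series a z)) \<partial>\<sigma>)"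
      by (rule integral_norm_bound_ennreal[OF int])
    also have "\<dots> = (\<integral>\<^sup>+ z. K x z * F z \<partial>\<sigma>)"
      using AE_circle_norm
      by (intro nn_integral_cong_AE) (auto elim!: eventually_mono simp: K_def F_def norm_mult P ennreal_mult)
    finally show ?thesis .
  qed
  have "I \<le> (\<integral>\<^sup>+ x. (\<integral>\<^sup>+ z. K x z * F z \<partial>\<sigma>) * A x \<partial>\<sigma>)"
    unfolding I_def power2_eq_square using AE_circle_norm
    by (intro nn_integral_mono_AE) (auto elim!: eventually_mono intro: mult_right_mono A_poisson)
  also have "\<dots> = (\<integral>\<^sup>+ x. (\<integral>\<^sup>+ z. F z * (K x z * A x) \<partial>\<sigma>) \<partial>\<sigma>)"
  proof (rule nn_integral_cong)
    fix x
    have "(\<integral>\<^sup>+ z. K x z * F z \<partial>\<sigma>) * A x = (\<integral>\<^sup>+ z. (K x z * F z) * A x \<partial>\<sigma>)"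
      by (rule nn_integral_multc[symmetric]) measurable
    then show "(\<integral>\<^sup>+ z. K x z * F z \<partial>\<sigma>) * A x = (\<integral>\<^sup>+ z. F z * (K x z * A x) \<partial>\<sigma>)"
      by (simp add: mult_ac)
  qed
  also have "\<dots> = (\<integral>\<^sup>+ z. (\<integral>\<^sup>+ x. F z * (K x z * A x) \<partial>\<sigma>) \<partial>\<sigma>)"
    by (rule circle_pair.Fubini'[symmetric]) measurable
  also have "\<dots> = (\<integral>\<^sup>+ z. F z * h z \<partial>\<sigma>)"
    by (simp add: h_def nn_integral_cmult)
  finally have IF: "I \<le> (\<integral>\<^sup>+ z. F z * h z \<partial>\<sigma>)" .
  have "I\<^sup>2 \<le> (\<integral>\<^sup>+ z. F z * h z \<partial>\<sigma>)\<^sup>2" using IF by (intro power_mono) auto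
  also have "\<dots> \<le> (\<integral>\<^sup>+ z. (F z)\<^sup>2 \<partial>\<sigma>) * (\<integral>\<^sup>+ z. (h z)\<^sup>2 \<partial>\<sigma>)"
    by (rule Cauchy_Schwarz_nn_integral) measurable
  also have "(\<integral>\<^sup>+ z. (h z)\<^sup>2 \<partial>\<sigma>) \<le> 64 * I"
    unfolding h_def I_def K_def by (rule poisson_adjoint_bound[OF _ _ R A_le]) measurable
  finally have le: "I\<^sup>2 \<le> (\<integral>\<^sup>+ z. (F z)\<^sup>2 \<partial>\<sigma>) * (64 * I)" by (simp add: mult_left_mono)
  have "I \<le> (\<integral>\<^sup>+ x. (ennreal C)\<^sup>2 \<partial>\<sigma>)"
    unfolding I_def using AE_circle_norm
    by (intro nn_integral_mono_AE) (auto elim!: eventually_mono intro: power_mono A_le)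
  then have fin: "I < \<infinity>" by (rule le_less_trans) (simp add: emeasure_circle_UNIV ennreal_mult_less_top power2_eq_square)
  have "I \<le> 64 * (\<integral>\<^sup>+ z. (F z)\<^sup>2 \<partial>\<sigma>)"
  proof (cases "I = 0")
    case False
    have "I * I \<le> I * (64 * (\<integral>\<^sup>+ z. (F z)\<^sup>2 \<partial>\<sigma>))" using le by (simp add: mult_ac power2_eq_square)
    then show ?thesis using False fin by (subst (asm) ennreal_mult_le_mult_iff) auto
  qed simp
  then show ?thesis by (simp add: I_def A_def F_def)
qed

section \<open>Radial limits\<close>

definition ell2_fun :: "ell2 \<Rightarrow> complex \<Rightarrow> complex" where
  "ell2_fun x z = (if cmod z < 1 then power_series (coeff x) z else 0)"

lemma dilated_summable:
  assumes "cmod z < 1" shows "summable (\<lambda>n. cmod (coeff x n) * cmod z ^ n)"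
proof (rule summable_comparison_test'[where N = 0])
  show "summable (\<lambda>n. norm x * cmod z ^ n)" using assms by (intro summable_mult) simp
qed (simp add: coeff_le_norm mult_right_mono)

lemma ell2_fun_sums:
  assumes "cmod z < 1" shows "(\<lambda>n. coeff x n * z ^ n) sums ell2_fun x z"
proof -
  have "summable (\<lambda>n. coeff x n * z ^ n)"
    using dilated_summable[OF assms, of x] by (intro summable_norm_cancel[of "\<lambda>n. coeff x n * z ^ n"]) (simp add: norm_mult norm_power)
  then show ?thesis using assms by (simp add: ell2_fun_def power_series_def summable_sums)
qed

lemma ell2_fun_outside: "1 \<le> cmod z \<Longrightarrow> ell2_fun x z = 0"
  by (simp add: ell2_fun_def)

lemma ell2_fun_measurable [measurable]: "ell2_fun x \<in> borel_measurable borel"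
  unfolding ell2_fun_def[abs_def] by measurable

lemma ell2_fun_disk_holomorphic: "ell2_fun x \<in> disk_holomorphic"
proof -
  have "ell2_fun x holomorphic_on ball 0 1"
    by (rule power_series_holomorphic[where a = "coeff x"]) (simp add: ell2_fun_sums)
  then show ?thesis by (simp add: disk_holomorphic_def ell2_fun_def)
qed

lemma ell2_fun_continuous: "continuous_on (ball 0 1) (ell2_fun x)"
  using ell2_fun_disk_holomorphic[of x] by (auto simp: disk_holomorphic_def intro: holomorphic_on_imp_continuous_on)

lemma ell2_fun_taylor: "(deriv ^^ n) (ell2_fun x) 0 / fact n = coeff x n"
proof -
  have "eventually (\<lambda>u. u \<in> ball 0 1) (nhds (0::complex))" by (intro eventually_nhds_in_open) auto
  then have "ell2_fun x has_fps_expansion Abs_fps (coeff x)"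
    by (intro has_fps_expansionI) (auto elim!: eventually_mono simp: ell2_fun_sums)
  from fps_nth_fps_expansion[OF this] show ?thesis by simp
qed

lemma ell2_fun_eq_iff: "ell2_fun x = ell2_fun y \<longleftrightarrow> x = y"
  by (metis ell2_eqI ell2_fun_taylor)

lemma ell2_fun_add: "ell2_fun (x + y) = (\<lambda>z. ell2_fun x z + ell2_fun y z)"
proof
  fix z
  show "ell2_fun (x + y) z = ell2_fun x z + ell2_fun y z"
  proof (cases "cmod z < 1")
    case True
    from sums_add[OF ell2_fun_sums[OF True, of x] ell2_fun_sums[OF True, of y]]
    show ?thesis using ell2_fun_sums[OF True, of "x + y"] by (simp add: algebra_simps sums_unique2)
  qed (simp add: ell2_fun_def)
qed

lemma ell2_fun_cscale: "ell2_fun (cscale c x) = (\<lambda>z. c * ell2_fun x z)"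
proof
  fix z
  show "ell2_fun (cscale c x) z = c * ell2_fun x z"
  proof (cases "cmod z < 1")
    case True
    from sums_mult[OF ell2_fun_sums[OF True, of x], of c]
    show ?thesis using ell2_fun_sums[OF True, of "cscale c x"] by (simp add: mult.assoc sums_unique2)
  qed (simp add: ell2_fun_def)
qed

lemma ell2_fun_0: "ell2_fun 0 = (\<lambda>z. 0)"
  by (auto simp: ell2_fun_def power_series_def fun_eq_iff)

lemma ell2_fun_diff: "ell2_fun (x - y) = (\<lambda>z. ell2_fun x z - ell2_fun y z)"
proof -
  have eq: "x - y = x + cscale (-1) y" by (rule ell2_eqI) simp
  show ?thesis unfolding eq by (simp add: ell2_fun_add ell2_fun_cscale)
qed

lemma wiener_dilated:
  assumes "0 \<le> r" "r < 1" shows "wiener (\<lambda>n. coeff x n * of_real r ^ n)"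
  by standard (use dilated_summable[of "of_real r" x] assms in \<open>simp add: norm_mult norm_power\<close>)

lemma power_series_dilated:
  assumes "0 \<le> r" "r < 1" "cmod w \<le> 1"
  shows "power_series (\<lambda>n. coeff x n * of_real r ^ n) w = ell2_fun x (of_real r * w)"
proof -
  have "cmod (of_real r * w) \<le> r" using assms by (simp add: norm_mult mult_left_le)
  then show ?thesis using assms by (simp add: ell2_fun_def power_series_def power_mult_distrib mult_ac)
qed

lemma parseval_dilated:
  assumes "0 \<le> r" "r < 1"
  shows "(\<lambda>n. coeff x n * cnj (coeff y n) * of_real (r\<^sup>2) ^ n) sums
    (\<integral>w. ell2_fun x (of_real r * w) * cnj (ell2_fun y (of_real r * w)) \<partial>\<sigma>)"
proof -
  have "(\<lambda>n. (coeff x n * of_real r ^ n) * cnj (coeff y n * of_real r ^ n)) sums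
    (\<integral>w. power_series (\<lambda>n. coeff x n * of_real r ^ n) w * cnj (power_series (\<lambda>n. coeff y n * of_real r ^ n) w) \<partial>\<sigma>)"
    by (intro parseval_wiener wiener_dilated assms)
  moreover have "(\<integral>w. power_series (\<lambda>n. coeff x n * of_real r ^ n) w * cnj (power_series (\<lambda>n. coeff y n * of_real r ^ n) w) \<partial>\<sigma>)
    = (\<integral>w. ell2_fun x (of_real r * w) * cnj (ell2_fun y (of_real r * w)) \<partial>\<sigma>)"
  proof (rule integral_cong_AE)
    show "AE w in \<sigma>. power_series (\<lambda>n. coeff x n * of_real r ^ n) w * cnj (power_series (\<lambda>n. coeff y n * of_real r ^ n) w)
      = ell2_fun x (of_real r * w) * cnj (ell2_fun y (of_real r * w))"
      using AE_circle_norm by eventually_elim (simp add: power_series_dilated assms)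
  qed auto
  moreover have "(\<lambda>n. (coeff x n * of_real r ^ n) * cnj (coeff y n * of_real r ^ n)) =
      (\<lambda>n. coeff x n * cnj (coeff y n) * of_real (r\<^sup>2) ^ n)"
    by (simp add: power2_eq_square power_mult_distrib mult_ac)
  ultimately show ?thesis by (simp only:)
qed

lemma integral_norm_sq_dilated:
  assumes "0 \<le> r" "r < 1"
  shows "(\<lambda>n. (cmod (coeff x n))\<^sup>2 * (r\<^sup>2) ^ n) sums (\<integral>w. (cmod (ell2_fun x (of_real r * w)))\<^sup>2 \<partial>\<sigma>)"
proof -
  have "(\<integral>w. ell2_fun x (of_real r * w) * cnj (ell2_fun x (of_real r * w)) \<partial>\<sigma>) =
      of_real (\<integral>w. (cmod (ell2_fun x (of_real r * w)))\<^sup>2 \<partial>\<sigma>)"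
    unfolding complex_norm_square[symmetric] by (rule integral_complex_of_real)
  with parseval_dilated[OF assms, of x x] show ?thesis
    unfolding complex_norm_square[symmetric] of_real_power[symmetric] of_real_mult[symmetric] sums_of_real_iff
    by (simp only: sums_of_real_iff)
qed

lemma integrable_norm_sq_dilated:
  assumes "0 \<le> r" "r < 1"
  shows "integrable \<sigma> (\<lambda>w. (cmod (ell2_fun x (of_real r * w)))\<^sup>2)"
proof -
  interpret wiener "\<lambda>n. coeff x n * of_real r ^ n" by (rule wiener_dilated[OF assms])
  show ?thesis
  proof (rule circle_integrable_bounded)
    show "norm ((cmod (ell2_fun x (of_real r * w)))\<^sup>2) \<le> (\<Sum>n. cmod (coeff x n * of_real r ^ n))\<^sup>2"
      if "cmod w = 1" for w
      using power_series_bound[of w] that power_series_dilated[OF assms, of w x]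
      by (simp add: power_mono)
  qed auto
qed

lemma norm_sq_dilated_le:
  assumes "0 \<le> r" "r < 1"
  shows "(\<integral>w. (cmod (ell2_fun x (of_real r * w)))\<^sup>2 \<partial>\<sigma>) \<le> (norm x)\<^sup>2"
proof (rule sums_le[OF _ integral_norm_sq_dilated[OF assms]])
  show "(\<lambda>n. (cmod (coeff x n))\<^sup>2) sums (norm x)\<^sup>2"
    unfolding norm_ell2_sq by (rule summable_sums[OF summable_coeff])
  have "(r\<^sup>2) ^ n \<le> 1" for n using assms by (simp add: power_le_one)
  then show "(cmod (coeff x n))\<^sup>2 * (r\<^sup>2) ^ n \<le> (cmod (coeff x n))\<^sup>2" for n
    by (simp add: mult_left_le)
qed

text \<open>An enumeration of the rational radii: suprema over it are countable, hence measurable,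
  and by continuity they control all radii.\<close>

definition rad :: "nat \<Rightarrow> real" where
  "rad = from_nat_into ({0<..<1} \<inter> \<rat>)"

lemma range_rad: "range rad = {0<..<1} \<inter> \<rat>"
proof -
  have "1/2 \<in> {0<..<1} \<inter> (\<rat> :: real set)" by simp
  then have "{0<..<1} \<inter> (\<rat> :: real set) \<noteq> {}" by blast
  then show ?thesis unfolding rad_def
    by (intro range_from_nat_into) (auto intro: countable_subset[OF Int_lower2 countable_rat])
qed

lemma rad_bounds: "0 < rad i" "rad i < 1"
  using range_rad by auto

lemma rad_dense:
  assumes "0 \<le> a" "a < b" "b \<le> 1" obtains i where "a < rad i" "rad i < b"
proof -
  obtain q where q: "q \<in> \<rat>" "a < q" "q < b" using Rats_dense_in_real[OF assms(2)] by blast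
  then have "q \<in> range rad" unfolding range_rad using assms by auto
  then show ?thesis using q that by auto
qed

text \<open>The square of the radial maximal function, so that its integral is directly comparable
  with the squared norm.\<close>

definition maximal_fun :: "ell2 \<Rightarrow> complex \<Rightarrow> ennreal" where
  "maximal_fun x w = (SUP i. (ennreal (cmod (ell2_fun x (of_real (rad i) * w))))\<^sup>2)"

lemma maximal_fun_measurable [measurable]: "maximal_fun x \<in> borel_measurable borel"
  unfolding maximal_fun_def[abs_def] by measurable

lemma maximal_fun_selection:
  "\<exists>R. R \<in> borel_measurable borel \<and> (\<forall>w. R w \<in> rad ` {..k}) \<and>
     (\<forall>w. \<forall>i\<le>k. cmod (ell2_fun x (of_real (rad i) * w)) \<le> cmod (ell2_fun x (of_real (R w) * w)))"
proof (induction k)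
  case 0
  show ?case by (rule exI[of _ "\<lambda>_. rad 0"]) auto
next
  case (Suc k)
  then obtain R where R [measurable]: "R \<in> borel_measurable borel" and R2: "\<And>w. R w \<in> rad ` {..k}"
    and R3: "\<And>w i. i \<le> k \<Longrightarrow> cmod (ell2_fun x (of_real (rad i) * w)) \<le> cmod (ell2_fun x (of_real (R w) * w))"
    by blast
  define R' where "R' w = (if cmod (ell2_fun x (of_real (R w) * w)) \<le> cmod (ell2_fun x (of_real (rad (Suc k)) * w))
    then rad (Suc k) else R w)" for w
  have "R' \<in> borel_measurable borel" unfolding R'_def[abs_def] by measurable
  moreover have "R' w \<in> rad ` {..Suc k}" for w
    using R2[of w] by (auto simp: R'_def atMost_Suc)
  moreover have "cmod (ell2_fun x (of_real (rad i) * w)) \<le> cmod (ell2_fun x (of_real (R' w) * w))"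
    if "i \<le> Suc k" for i w
    using that R3[of i w] by (auto simp: R'_def le_Suc_eq)
  ultimately show ?case by blast
qed

lemma maximal_fun_finite_bound:
  "(\<integral>\<^sup>+ w. (SUP i\<in>{..k}. (ennreal (cmod (ell2_fun x (of_real (rad i) * w))))\<^sup>2) \<partial>\<sigma>) \<le> ennreal (64 * (norm x)\<^sup>2)"
proof -
  obtain R where R [measurable]: "R \<in> borel_measurable borel" and R2: "\<And>w. R w \<in> rad ` {..k}"
    and R3: "\<And>w i. i \<le> k \<Longrightarrow> cmod (ell2_fun x (of_real (rad i) * w)) \<le> cmod (ell2_fun x (of_real (R w) * w))"
    using maximal_fun_selection by blast
  define m where "m = Max (rad ` {..k})"
  have "m \<in> rad ` {..k}" unfolding m_def by (intro Max_in) auto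
  then have m: "0 < m" "m < 1" using rad_bounds by auto
  have Rm: "0 < R w" "R w \<le> m" for w
  proof -
    show "R w \<le> m" unfolding m_def using R2[of w] by (intro Max_ge) auto
    show "0 < R w" using R2[of w] rad_bounds by auto
  qed
  \<comment> \<open>The radius is split as s times \<open>R w / s\<close>. Dilation by
    \<open>s\<close> makes the coefficients absolutely summable, and the remaining radius is still
    at most m / s = s < 1.\<close>
  define s where "s = sqrt m"
  have s: "0 < s" "s < 1" "s * s = m" using m by (auto simp: s_def)
  define a where "a n = coeff x n * of_real s ^ n" for n
  interpret wiener a unfolding a_def[abs_def] by (rule wiener_dilated) (use s in auto)
  have a_eq: "power_series a w = ell2_fun x (of_real s * w)" if "cmod w \<le> 1" for w
    unfolding a_def[abs_def] by (rule power_series_dilated) (use s that in auto)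
  have R's: "0 \<le> R w / s" "R w / s \<le> s" for w
    using Rm[of w] s by (auto simp: field_simps)
  have "(\<integral>\<^sup>+ w. (SUP i\<in>{..k}. (ennreal (cmod (ell2_fun x (of_real (rad i) * w))))\<^sup>2) \<partial>\<sigma>)
      \<le> (\<integral>\<^sup>+ w. (ennreal (cmod (power_series a (of_real (R w / s) * w))))\<^sup>2 \<partial>\<sigma>)"
  proof (rule nn_integral_mono_AE)
    show "AE w in \<sigma>. (SUP i\<in>{..k}. (ennreal (cmod (ell2_fun x (of_real (rad i) * w))))\<^sup>2)
        \<le> (ennreal (cmod (power_series a (of_real (R w / s) * w))))\<^sup>2"
      using AE_circle_norm
    proof eventually_elim
      case (elim w)
      have "cmod (of_real t * w) \<le> 1" if "0 \<le> t" "t \<le> s" for t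
        using that elim s by (simp add: norm_mult)
      from this[OF R's] have "cmod (of_real (R w / s) * w) \<le> 1" .
      moreover have "of_real s * (of_real (R w / s) * w) = of_real (R w) * w" using s by simp
      ultimately have "power_series a (of_real (R w / s) * w) = ell2_fun x (of_real (R w) * w)"
        using a_eq by metis
      then show ?case by (auto intro!: SUP_least power_mono ennreal_leI R3)
    qed
  qed
  also have "\<dots> \<le> 64 * (\<integral>\<^sup>+ w. (ennreal (cmod (power_series a w)))\<^sup>2 \<partial>\<sigma>)"
    by (rule maximal_inequality[OF _ R's]) (use s in auto)
  also have "(\<integral>\<^sup>+ w. (ennreal (cmod (power_series a w)))\<^sup>2 \<partial>\<sigma>) =
      (\<integral>\<^sup>+ w. ennreal ((cmod (ell2_fun x (of_real s * w)))\<^sup>2) \<partial>\<sigma>)"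
    using AE_circle_norm by (intro nn_integral_cong_AE) (auto elim!: eventually_mono simp: a_eq ennreal_power)
  also have "\<dots> = ennreal (\<integral>w. (cmod (ell2_fun x (of_real s * w)))\<^sup>2 \<partial>\<sigma>)"
    by (intro nn_integral_eq_integral integrable_norm_sq_dilated) (use s in auto)
  also have "64 * \<dots> \<le> 64 * ennreal ((norm x)\<^sup>2)"
    by (intro mult_left_mono ennreal_leI norm_sq_dilated_le) (use s in auto)
  also have "\<dots> = ennreal (64 * (norm x)\<^sup>2)" by (simp add: ennreal_mult)
  finally show ?thesis .
qed

lemma maximal_fun_bound: "(\<integral>\<^sup>+ w. maximal_fun x w \<partial>\<sigma>) \<le> ennreal (64 * (norm x)\<^sup>2)"
proof -
  define u where "u i w = (ennreal (cmod (ell2_fun x (of_real (rad i) * w))))\<^sup>2" for i w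
  have [measurable]: "u i \<in> borel_measurable borel" for i unfolding u_def[abs_def] by measurable
  have "maximal_fun x w = (SUP k. SUP i\<in>{..k}. u i w)" for w
    unfolding maximal_fun_def u_def[symmetric]
    by (intro antisym SUP_least) (auto intro: SUP_upper2 SUP_upper)
  then have "(\<integral>\<^sup>+ w. maximal_fun x w \<partial>\<sigma>) = (\<integral>\<^sup>+ w. (SUP k. SUP i\<in>{..k}. u i w) \<partial>\<sigma>)"
    by simp
  also have "\<dots> = (SUP k. \<integral>\<^sup>+ w. (SUP i\<in>{..k}. u i w) \<partial>\<sigma>)"
    by (rule nn_integral_monotone_convergence_SUP) (auto intro!: incseq_SucI le_funI SUP_subset_mono)
  also have "\<dots> \<le> ennreal (64 * (norm x)\<^sup>2)"
    unfolding u_def by (intro SUP_least maximal_fun_finite_bound)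
  finally show ?thesis .
qed

lemma radial_continuous:
  assumes "cmod w \<le> 1" shows "continuous_on {0<..<1} (\<lambda>r. ell2_fun x (of_real r * w))"
proof (rule continuous_on_compose2[OF ell2_fun_continuous])
  show "(\<lambda>r. of_real r * w) ` {0<..<1} \<subseteq> ball 0 1"
  proof safe
    fix r :: real assume "r \<in> {0<..<1}"
    then have "r * cmod w < 1" using assms by (smt (verit) greaterThanLessThan_iff mult_left_le)
    then show "of_real r * w \<in> ball 0 1" using \<open>r \<in> _\<close> by (simp add: norm_mult)
  qed
qed (intro continuous_intros)

text \<open>A continuous function exceeding \<open>m\<close> at one radius exceeds it at a rational
  radius slightly to the left.\<close>

lemma radial_bound_extend:
  fixes \<phi> :: "real \<Rightarrow> real"
  assumes c: "continuous_on {0<..<1} \<phi>" and "\<And>i. a < rad i \<Longrightarrow> \<phi> (rad i) \<le> m"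
    and r: "0 \<le> a" "a < r" "r < 1"
  shows "\<phi> r \<le> m"
proof (rule ccontr)
  assume "\<not> \<phi> r \<le> m"
  then have "0 < \<phi> r - m" by simp
  moreover have "r \<in> {0<..<1}" using r by simp
  ultimately obtain d where d: "d > 0"
    "\<And>t. t \<in> {0<..<1} \<Longrightarrow> dist t r < d \<Longrightarrow> dist (\<phi> t) (\<phi> r) < \<phi> r - m"
    using c unfolding continuous_on_iff by blast
  have "max a (r - d) < r" "0 \<le> max a (r - d)" using d r by auto
  then obtain i where i: "max a (r - d) < rad i" "rad i < r" using rad_dense[of "max a (r - d)" r] r by auto
  then have "dist (\<phi> (rad i)) (\<phi> r) < \<phi> r - m" using d(2)[of "rad i"] rad_bounds[of i] by (auto simp: dist_real_def)
  moreover have "\<phi> (rad i) \<le> m" using assms(2) i by auto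
  ultimately show False by (simp add: dist_real_def)
qed

lemma maximal_fun_upper:
  assumes w: "cmod w = 1" and r: "0 < r" "r < 1"
  shows "(ennreal (cmod (ell2_fun x (of_real r * w))))\<^sup>2 \<le> maximal_fun x w"
proof (cases "maximal_fun x w = \<infinity>")
  case False
  define M where "M = enn2real (maximal_fun x w)"
  have M: "maximal_fun x w = ennreal M" using False by (simp add: M_def less_top)
  have M0: "0 \<le> M" by (simp add: M_def)
  have "(cmod (ell2_fun x (of_real r * w)))\<^sup>2 \<le> M"
  proof (rule radial_bound_extend[where a = 0 and \<phi> = "\<lambda>r. (cmod (ell2_fun x (of_real r * w)))\<^sup>2"])
    show "continuous_on {0<..<1} (\<lambda>r. (cmod (ell2_fun x (of_real r * w)))\<^sup>2)"
      by (intro continuous_intros radial_continuous) (simp add: w)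
    fix i
    have "(ennreal (cmod (ell2_fun x (of_real (rad i) * w))))\<^sup>2 \<le> ennreal M"
      unfolding M[symmetric] maximal_fun_def by (rule SUP_upper) simp
    then show "(cmod (ell2_fun x (of_real (rad i) * w)))\<^sup>2 \<le> M"
      using M0 by (simp add: ennreal_power)
  qed (use r in auto)
  then show ?thesis by (simp add: M ennreal_power ennreal_leI)
qed simp

lift_definition tail :: "nat \<Rightarrow> ell2 \<Rightarrow> ell2" is "\<lambda>N x n. if n < N then 0 else x n"
  by (rule summable_comparison_test'[where N = 0 and g = "\<lambda>n. (cmod (_ n))\<^sup>2"]) auto

lemma coeff_tail [simp]: "coeff (tail N x) n = (if n < N then 0 else coeff x n)"
  by transfer simp

lemma norm_tail: "(\<lambda>N. norm (tail N x)) \<longlonglongrightarrow> 0"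
proof -
  have eq: "(norm (tail N x))\<^sup>2 = (norm x)\<^sup>2 - (\<Sum>n<N. (cmod (coeff x n))\<^sup>2)" for N
  proof -
    have "(norm (tail N x))\<^sup>2 = (\<Sum>n. (cmod (coeff (tail N x) (n + N)))\<^sup>2) + (\<Sum>n<N. (cmod (coeff (tail N x) n))\<^sup>2)"
      unfolding norm_ell2_sq by (rule suminf_split_initial_segment[OF summable_coeff])
    moreover have "(norm x)\<^sup>2 = (\<Sum>n. (cmod (coeff x (n + N)))\<^sup>2) + (\<Sum>n<N. (cmod (coeff x n))\<^sup>2)"
      unfolding norm_ell2_sq by (rule suminf_split_initial_segment[OF summable_coeff])
    ultimately show ?thesis by simp
  qed
  have "(\<lambda>N. (norm x)\<^sup>2 - (\<Sum>n<N. (cmod (coeff x n))\<^sup>2)) \<longlonglongrightarrow> (norm x)\<^sup>2 - (norm x)\<^sup>2"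
    unfolding norm_ell2_sq by (intro tendsto_intros summable_LIMSEQ summable_coeff)
  then have "(\<lambda>N. sqrt ((norm (tail N x))\<^sup>2)) \<longlonglongrightarrow> sqrt 0"
    unfolding eq by (intro tendsto_intros) simp
  then show ?thesis by simp
qed

lemma ell2_fun_tail:
  assumes "cmod z < 1" shows "ell2_fun x z = (\<Sum>n<N. coeff x n * z ^ n) + ell2_fun (tail N x) z"
proof -
  have "(\<lambda>n. (if n \<in> {..<N} then coeff x n * z ^ n else 0) + coeff (tail N x) n * z ^ n) sums
      ((\<Sum>n<N. coeff x n * z ^ n) + ell2_fun (tail N x) z)"
    by (intro sums_add ell2_fun_sums assms sums_If_finite_set) auto
  moreover have "(\<lambda>n. (if n \<in> {..<N} then coeff x n * z ^ n else 0) + coeff (tail N x) n * z ^ n) = (\<lambda>n. coeff x n * z ^ n)"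
    by auto
  ultimately show ?thesis using ell2_fun_sums[OF assms, of x] by (simp add: sums_unique2)
qed

text \<open>The maximal inequality bounds the integral of the infimum by 64 times the squared norm
  of every tail, and these norms tend to 0.\<close>

lemma AE_maximal_tail: "AE w in \<sigma>. (INF N. maximal_fun (tail N x) w) = 0"
proof -
  have "(\<integral>\<^sup>+ w. (INF N. maximal_fun (tail N x) w) \<partial>\<sigma>) \<le> 0"
  proof (rule LIMSEQ_le_const)
    have "(\<lambda>N. ennreal (64 * (norm (tail N x))\<^sup>2)) \<longlonglongrightarrow> ennreal (64 * 0\<^sup>2)"
      by (intro tendsto_intros tendsto_ennrealI norm_tail)
    then show "(\<lambda>N. ennreal (64 * (norm (tail N x))\<^sup>2)) \<longlonglongrightarrow> 0" by simp
    have "(\<integral>\<^sup>+ w. (INF N. maximal_fun (tail N x) w) \<partial>\<sigma>) \<le> ennreal (64 * (norm (tail N x))\<^sup>2)" for N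
      by (rule order_trans[OF nn_integral_mono maximal_fun_bound]) (rule INF_lower, simp)
    then show "\<exists>M. \<forall>N\<ge>M. (\<integral>\<^sup>+ w. (INF N. maximal_fun (tail N x) w) \<partial>\<sigma>) \<le> ennreal (64 * (norm (tail N x))\<^sup>2)"
      by blast
  qed
  then have "(\<integral>\<^sup>+ w. (INF N. maximal_fun (tail N x) w) \<partial>\<sigma>) = 0" by simp
  then show ?thesis by (subst (asm) nn_integral_0_iff_AE) auto
qed

text \<open>Fatou's theorem at a single point: the function is a polynomial, which has a radial
  limit, plus a tail that is small uniformly in r because its maximal function is. The Cauchy
  criterion follows.\<close>

lemma radial_limit_exists:
  assumes w: "cmod w = 1" and inf: "(INF N. maximal_fun (tail N x) w) = 0"
  shows "\<exists>l. ((\<lambda>r. ell2_fun x (of_real r * w)) \<longlongrightarrow> l) (at_left 1)"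
proof -
  define f where "f r = ell2_fun x (of_real r * w)" for r :: real
  have "cauchy_filter (filtermap f (at_left 1))"
    unfolding cauchy_filter_metric_filtermap
  proof (intro allI impI)
    fix e :: real assume e: "e > 0"
    have "(INF N. maximal_fun (tail N x) w) < ennreal ((e/4)\<^sup>2)" using inf e by simp
    then obtain N where N: "maximal_fun (tail N x) w < ennreal ((e/4)\<^sup>2)" by (auto simp: INF_less_iff)
    define p where "p r = (\<Sum>n<N. coeff x n * (of_real r * w) ^ n)" for r :: real
    have "(p \<longlongrightarrow> p 1) (at_left 1)" unfolding p_def by (intro tendsto_intros)
    then have ev: "eventually (\<lambda>r. dist (p r) (p 1) < e/4) (at_left 1)" using e by (intro tendstoD) auto
    have ev1: "eventually (\<lambda>r. r \<in> {0<..<1::real}) (at_left 1)" by (rule eventually_at_left_real) simp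
    have close: "dist (f r) (p r) < e/4" if "r \<in> {0<..<1}" for r
    proof -
      have "cmod (of_real r * w) < 1" using that w by (simp add: norm_mult)
      then have "f r - p r = ell2_fun (tail N x) (of_real r * w)"
        unfolding f_def p_def by (subst ell2_fun_tail[where N = N]) auto
      moreover have "(ennreal (cmod (ell2_fun (tail N x) (of_real r * w))))\<^sup>2 < ennreal ((e/4)\<^sup>2)"
        using maximal_fun_upper[OF w, of r "tail N x"] that N by (auto intro: le_less_trans)
      then have "(cmod (ell2_fun (tail N x) (of_real r * w)))\<^sup>2 < (e/4)\<^sup>2"
        by (simp add: ennreal_power ennreal_less_iff)
      then have "cmod (ell2_fun (tail N x) (of_real r * w)) < e/4" by (rule power_less_imp_less_base) (use e in simp)
      ultimately show ?thesis by (simp add: dist_norm)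
    qed
    show "\<exists>P. eventually P (at_left 1) \<and> (\<forall>r s. P r \<and> P s \<longrightarrow> dist (f r) (f s) < e)"
    proof (intro exI conjI allI impI)
      show "eventually (\<lambda>r. r \<in> {0<..<1} \<and> dist (p r) (p 1) < e/4) (at_left 1)"
        using ev ev1 by eventually_elim simp
      fix r s assume rs: "(r \<in> {0<..<1} \<and> dist (p r) (p 1) < e/4) \<and> (s \<in> {0<..<1} \<and> dist (p s) (p 1) < e/4)"
      have "dist (f r) (f s) \<le> dist (f r) (p r) + dist (p r) (p 1) + (dist (p s) (p 1) + dist (f s) (p s))"
        using dist_triangle[of "f r" "f s" "p 1"] dist_triangle[of "f r" "p 1" "p r"] dist_triangle[of "f s" "p 1" "p s"]
        by (simp add: dist_commute[of "p 1"])
      then show "dist (f r) (f s) < e" using rs close[of r] close[of s] by linarith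
    qed
  qed
  moreover have "filtermap f (at_left (1::real)) \<noteq> bot" by (simp add: filtermap_bot_iff)
  ultimately obtain l where "filtermap f (at_left 1) \<le> nhds l"
    using complete_UNIV[where 'a = complex] unfolding complete_uniform by auto
  then show ?thesis by (auto simp: filterlim_def f_def[abs_def])
qed

lemma AE_boundary:
  "AE w in \<sigma>. ((\<lambda>r. ell2_fun x (of_real r * w)) \<longlongrightarrow> boundary (ell2_fun x) w) (at_left 1)"
  using AE_circle_norm AE_maximal_tail[of x]
proof eventually_elim
  case (elim w)
  obtain l where l: "((\<lambda>r. ell2_fun x (of_real r * w)) \<longlongrightarrow> l) (at_left 1)"
    using radial_limit_exists[OF elim] by blast
  then have "boundary (ell2_fun x) w = l" unfolding boundary_def by (intro tendsto_Lim) simp_all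
  then show ?case using l by simp
qed

section \<open>The Hardy space as a sequence space\<close>

text \<open>A fixed sequence approaching 1 from the left, which turns radial limits into sequential
  ones for measurability and dominated convergence.\<close>

definition radius :: "nat \<Rightarrow> real" where
  "radius j = 1 - 1 / real (j + 2)"

lemma radius_bounds: "0 < radius j" "radius j < 1"
  by (auto simp: radius_def field_simps)

lemma radius_at_left: "filterlim radius (at_left 1) sequentially"
proof -
  have "radius \<longlonglongrightarrow> 1 - 0"
    unfolding radius_def[abs_def]
    by (intro tendsto_diff tendsto_const LIMSEQ_ignore_initial_segment[OF lim_inverse_n', of 2])
  then have "radius \<longlonglongrightarrow> 1" by simp
  then show ?thesis
    unfolding filterlim_at using radius_bounds by (auto simp: less_imp_neq)
qed

text \<open>The Cauchy criterion with countable quantifiers only, so that the set of points with a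
  radial limit is visibly Borel. Continuity along the radius passes from rational radii to all
  radii.\<close>

lemma radial_limit_iff:
  "(\<exists>l. ((\<lambda>r. ell2_fun x (of_real r * w)) \<longlongrightarrow> l) (at_left 1)) \<longleftrightarrow>
   (\<forall>k. \<exists>m. \<forall>i j. 1 - 1 / real (Suc m) < rad i \<longrightarrow> 1 - 1 / real (Suc m) < rad j \<longrightarrow>
     dist (ell2_fun x (of_real (rad i) * w)) (ell2_fun x (of_real (rad j) * w)) \<le> 1 / real (Suc k))"
  (is "?L \<longleftrightarrow> ?R")
proof
  define f where "f r = ell2_fun x (of_real r * w)" for r :: real
  assume ?L
  then obtain l where l: "(f \<longlongrightarrow> l) (at_left 1)" by (auto simp: f_def[abs_def])
  have "\<exists>m. \<forall>i j. 1 - 1 / real (Suc m) < rad i \<longrightarrow> 1 - 1 / real (Suc m) < rad j \<longrightarrow>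
     dist (f (rad i)) (f (rad j)) \<le> 1 / real (Suc k)" for k
  proof -
    have "eventually (\<lambda>r. dist (f r) l < 1 / (2 * real (Suc k))) (at_left 1)"
      by (rule tendstoD[OF l]) simp
    then obtain b where b: "b < 1" "\<And>r. b < r \<Longrightarrow> r < 1 \<Longrightarrow> dist (f r) l < 1 / (2 * real (Suc k))"
      unfolding eventually_at_left_field by blast
    obtain m where "inverse (real (Suc m)) < 1 - b" using reals_Archimedean[of "1 - b"] b by auto
    then have m: "b < 1 - 1 / real (Suc m)" by (simp add: inverse_eq_divide)
    have "dist (f (rad i)) (f (rad j)) \<le> 1 / real (Suc k)"
      if "1 - 1 / real (Suc m) < rad i" "1 - 1 / real (Suc m) < rad j" for i j
    proof -
      have "dist (f (rad i)) l < 1 / (2 * real (Suc k))" "dist (f (rad j)) l < 1 / (2 * real (Suc k))"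
        by (intro b(2) rad_bounds; use that m in linarith)+
      then have "dist (f (rad i)) (f (rad j)) < 2 * (1 / (2 * real (Suc k)))"
        using dist_triangle2[of "f (rad i)" "f (rad j)" l] by linarith
      also have "2 * (1 / (2 * real (Suc k))) = 1 / real (Suc k)" by (simp del: of_nat_Suc)
      finally show ?thesis by simp
    qed
    then show ?thesis by blast
  qed
  then show ?R by (simp add: f_def)
next
  define f where "f r = ell2_fun x (of_real r * w)" for r :: real
  assume ?R
  then have R: "\<exists>m. \<forall>i j. 1 - 1 / real (Suc m) < rad i \<longrightarrow> 1 - 1 / real (Suc m) < rad j \<longrightarrow>
     dist (f (rad i)) (f (rad j)) \<le> 1 / real (Suc k)" for k by (simp add: f_def)
  show ?L
  proof (cases "cmod w \<le> 1")
    \<comment> \<open>Outside the closed disk the radial values are eventually 0, by the convention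
      that functions vanish off the disk.\<close>
    case False
    have "eventually (\<lambda>r. r \<in> {1 / cmod w <..<1::real}) (at_left 1)"
    proof (rule eventually_at_left_real)
      have "1 < cmod w" using False by simp
      then show "1 / cmod w < 1" by (subst divide_less_eq_1_pos) auto
    qed
    then have "eventually (\<lambda>r. 0 = ell2_fun x (of_real r * w)) (at_left 1)"
    proof eventually_elim
      case (elim r)
      have "0 < cmod w" using False by linarith
      then have "1 < r * cmod w" using elim by (simp add: pos_divide_less_eq)
      also have "\<dots> \<le> \<bar>r\<bar> * cmod w" by (intro mult_right_mono) auto
      finally have "1 \<le> cmod (of_real r * w)" by (simp add: norm_mult)
      then show ?case by (simp add: ell2_fun_outside)
    qed
    then have "((\<lambda>r. ell2_fun x (of_real r * w)) \<longlongrightarrow> 0) (at_left 1)"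
      by (rule Lim_transform_eventually[OF tendsto_const])
    then show ?thesis by blast
  next
    case True
    have cont: "continuous_on {0<..<1} f" unfolding f_def by (rule radial_continuous[OF True])
    have "cauchy_filter (filtermap f (at_left 1))"
      unfolding cauchy_filter_metric_filtermap
    proof (intro allI impI)
      fix e :: real assume "e > 0"
      then obtain k where k: "inverse (real (Suc k)) < e" using reals_Archimedean by blast
      obtain m where m: "\<And>i j. 1 - 1 / real (Suc m) < rad i \<Longrightarrow> 1 - 1 / real (Suc m) < rad j \<Longrightarrow>
         dist (f (rad i)) (f (rad j)) \<le> 1 / real (Suc k)" using R[of k] by blast
      define c where "c = 1 - 1 / real (Suc m)"
      have c: "0 \<le> c" "c < 1" by (auto simp: c_def field_simps)
      have 1: "dist (f r) (f (rad j)) \<le> 1 / real (Suc k)" if "c < r" "r < 1" "c < rad j" for r j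
        by (rule radial_bound_extend[where a = c and \<phi> = "\<lambda>r. dist (f r) (f (rad j))"])
          (use that c m in \<open>auto intro!: continuous_intros cont simp: c_def\<close>)
      have 2: "dist (f r) (f s) \<le> 1 / real (Suc k)" if "c < r" "r < 1" "c < s" "s < 1" for r s
        by (rule radial_bound_extend[where a = c and \<phi> = "\<lambda>s. dist (f r) (f s)"])
          (use that c 1 in \<open>auto intro!: continuous_intros cont\<close>)
      show "\<exists>P. eventually P (at_left 1) \<and> (\<forall>r s. P r \<and> P s \<longrightarrow> dist (f r) (f s) < e)"
      proof (intro exI conjI allI impI)
        show "eventually (\<lambda>r. r \<in> {c<..<1}) (at_left 1)" using c by (intro eventually_at_left_real) auto
        fix r s assume "r \<in> {c<..<1} \<and> s \<in> {c<..<1}"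
        then have "dist (f r) (f s) \<le> 1 / real (Suc k)" by (intro 2) auto
        also have "\<dots> < e" using k by (simp add: inverse_eq_divide)
        finally show "dist (f r) (f s) < e" .
      qed
    qed
    moreover have "filtermap f (at_left (1::real)) \<noteq> bot" by (simp add: filtermap_bot_iff)
    ultimately obtain l where "filtermap f (at_left 1) \<le> nhds l"
      using complete_UNIV[where 'a = complex] unfolding complete_uniform by auto
    then show ?thesis by (auto simp: filterlim_def f_def[abs_def])
  qed
qed

lemma boundary_measurable [measurable]: "boundary (ell2_fun x) \<in> borel_measurable borel"
proof -
  define E where "E = {w. \<exists>l. ((\<lambda>r. ell2_fun x (of_real r * w)) \<longlongrightarrow> l) (at_left 1)}"
  have "E = {w \<in> space borel. \<forall>k. \<exists>m. \<forall>i j. 1 - 1 / real (Suc m) < rad i \<longrightarrow> 1 - 1 / real (Suc m) < rad j \<longrightarrow>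
     dist (ell2_fun x (of_real (rad i) * w)) (ell2_fun x (of_real (rad j) * w)) \<le> 1 / real (Suc k)}"
    unfolding E_def radial_limit_iff by simp
  also have "\<dots> \<in> sets borel" by measurable
  finally have [measurable]: "E \<in> sets borel" .
  \<comment> \<open>Where no radial limit exists, \<open>Lim\<close> is a definite description of an
    unsatisfiable predicate, hence the same value at all such points.\<close>
  have "boundary (ell2_fun x) w = (if w \<in> E then lim (\<lambda>j. ell2_fun x (of_real (radius j) * w)) else (THE l. False))" for w
  proof (cases "w \<in> E")
    case True
    then obtain l where l: "((\<lambda>r. ell2_fun x (of_real r * w)) \<longlongrightarrow> l) (at_left 1)" by (auto simp: E_def)
    then have "boundary (ell2_fun x) w = l" unfolding boundary_def by (intro tendsto_Lim) simp_all
    moreover have "(\<lambda>j. ell2_fun x (of_real (radius j) * w)) \<longlonglongrightarrow> l"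
      using filterlim_compose[OF l radius_at_left] .
    ultimately show ?thesis using True by (simp add: limI)
  next
    case False
    then show ?thesis by (simp add: boundary_def t2_space_class.Lim_def E_def)
  qed
  then have "boundary (ell2_fun x) = (\<lambda>w. if w \<in> E then lim (\<lambda>j. ell2_fun x (of_real (radius j) * w)) else (THE l. False))"
    by blast
  also have "\<dots> \<in> borel_measurable borel" by measurable
  finally show ?thesis .
qed

lemma maximal_fun_finite: "AE w in \<sigma>. maximal_fun x w \<noteq> \<infinity>"
proof (rule nn_integral_PInf_AE)
  show "(\<integral>\<^sup>+ w. maximal_fun x w \<partial>\<sigma>) \<noteq> \<infinity>"
    using maximal_fun_bound[of x] by (auto simp: top_unique)
qed auto

text \<open>A real integrable majorant. \<open>enn2real\<close> sends infinite values to 0, but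
  these occur only on a null set.\<close>

definition maximal_real :: "ell2 \<Rightarrow> complex \<Rightarrow> real" where
  "maximal_real x w = enn2real (maximal_fun x w)"

lemma maximal_real_integrable: "integrable \<sigma> (maximal_real x)"
proof (rule integrableI_nonneg)
  have "(\<integral>\<^sup>+ w. ennreal (maximal_real x w) \<partial>\<sigma>) = (\<integral>\<^sup>+ w. maximal_fun x w \<partial>\<sigma>)"
    using maximal_fun_finite[of x]
    by (intro nn_integral_cong_AE) (auto elim!: eventually_mono simp: maximal_real_def less_top)
  also have "\<dots> < \<infinity>" using maximal_fun_bound[of x] by (auto intro: le_less_trans)
  finally show "(\<integral>\<^sup>+ w. ennreal (maximal_real x w) \<partial>\<sigma>) < \<infinity>" .
qed (auto simp: maximal_real_def[abs_def])

lemma AE_maximal_real: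
  "AE w in \<sigma>. \<forall>r\<in>{0<..<1}. (cmod (ell2_fun x (of_real r * w)))\<^sup>2 \<le> maximal_real x w"
  using AE_circle_norm maximal_fun_finite[of x]
proof eventually_elim
  case (elim w)
  show ?case
  proof
    fix r :: real assume r: "r \<in> {0<..<1}"
    have "(ennreal (cmod (ell2_fun x (of_real r * w))))\<^sup>2 \<le> ennreal (maximal_real x w)"
      using maximal_fun_upper[OF elim(1), of r x] r elim(2) by (simp add: maximal_real_def less_top)
    then show "(cmod (ell2_fun x (of_real r * w)))\<^sup>2 \<le> maximal_real x w"
      by (simp add: ennreal_power maximal_real_def)
  qed
qed

lemma AE_boundary_le: "AE w in \<sigma>. (cmod (boundary (ell2_fun x) w))\<^sup>2 \<le> maximal_real x w"
  using AE_boundary[of x] AE_maximal_real[of x]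
proof eventually_elim
  case (elim w)
  have ev: "eventually (\<lambda>r. r \<in> {0<..<1::real}) (at_left 1)" by (rule eventually_at_left_real) simp
  show ?case
    by (rule tendsto_upperbound[OF tendsto_power[OF tendsto_norm[OF elim(1)], of 2]])
      (use elim(2) in \<open>auto intro: eventually_mono[OF ev]\<close>)
qed

lemma AM_GM_norm: "cmod (a * b) \<le> (cmod a)\<^sup>2 + (cmod b)\<^sup>2"
  using sum_squares_bound[of "cmod a" "cmod b"] mult_nonneg_nonneg[OF norm_ge_zero[of a] norm_ge_zero[of b]]
  unfolding norm_mult by linarith

lemma boundary_prod_integrable:
  assumes [measurable]: "\<phi> \<in> borel_measurable borel" and \<phi>: "AE w in \<sigma>. cmod (\<phi> w) \<le> 1"
  shows "integrable \<sigma> (\<lambda>w. \<phi> w * boundary (ell2_fun x) w * cnj (boundary (ell2_fun y) w))"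
proof (rule Bochner_Integration.integrable_bound)
  show "integrable \<sigma> (\<lambda>w. maximal_real x w + maximal_real y w)"
    by (intro Bochner_Integration.integrable_add maximal_real_integrable)
  show "AE w in \<sigma>. norm (\<phi> w * boundary (ell2_fun x) w * cnj (boundary (ell2_fun y) w))
      \<le> norm (maximal_real x w + maximal_real y w)"
    using \<phi> AE_boundary_le[of x] AE_boundary_le[of y]
  proof eventually_elim
    case (elim w)
    have "norm (\<phi> w * boundary (ell2_fun x) w * cnj (boundary (ell2_fun y) w)) =
        cmod (\<phi> w) * cmod (boundary (ell2_fun x) w * boundary (ell2_fun y) w)"
      by (simp add: norm_mult)
    also have "\<dots> \<le> 1 * cmod (boundary (ell2_fun x) w * boundary (ell2_fun y) w)"
      using elim(1) by (intro mult_right_mono) auto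
    also have "\<dots> \<le> (cmod (boundary (ell2_fun x) w))\<^sup>2 + (cmod (boundary (ell2_fun y) w))\<^sup>2"
      using AM_GM_norm by simp
    also have "\<dots> \<le> norm (maximal_real x w + maximal_real y w)" using elim by simp
    finally show ?case .
  qed
qed auto

lemma abel_continuity:
  fixes p :: "nat \<Rightarrow> complex"
  assumes p: "summable (\<lambda>n. cmod (p n))"
  shows "continuous_on {0..1} (\<lambda>t::real. \<Sum>n. p n * of_real t ^ n)"
proof (rule uniform_limit_theorem)
  show "uniform_limit {0..1} (\<lambda>N (t::real). \<Sum>n<N. p n * of_real t ^ n) (\<lambda>t. \<Sum>n. p n * of_real t ^ n) sequentially"
    by (rule Weierstrass_m_test[OF _ p]) (simp add: norm_mult norm_power mult_left_le power_le_one)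
  show "\<forall>\<^sub>F N in sequentially. continuous_on {0..1} (\<lambda>t::real. \<Sum>n<N. p n * of_real t ^ n)"
    by (intro always_eventually allI continuous_intros)
qed simp

text \<open>Parseval's identity holds on each circle of radius \<open>radius j\<close>. The
  integrals converge to the boundary pairing by dominated convergence, with the maximal functions as
  majorant, and the coefficient sums converge by Abel's theorem.\<close>

lemma H2_inner_ell2: "H2_inner (ell2_fun x) (ell2_fun y) = ip x y"
proof -
  define s where "s j w = ell2_fun x (of_real (radius j) * w) * cnj (ell2_fun y (of_real (radius j) * w))" for j w
  have lim1: "(\<lambda>j. \<integral>w. s j w \<partial>\<sigma>) \<longlonglongrightarrow> H2_inner (ell2_fun x) (ell2_fun y)"
    unfolding H2_inner_def L2_inner_def
  proof (rule integral_dominated_convergence)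
    show "integrable \<sigma> (\<lambda>w. maximal_real x w + maximal_real y w)"
      by (intro Bochner_Integration.integrable_add maximal_real_integrable)
    show "AE w in \<sigma>. (\<lambda>j. s j w) \<longlonglongrightarrow> boundary (ell2_fun x) w * cnj (boundary (ell2_fun y) w)"
      using AE_boundary[of x] AE_boundary[of y]
    proof eventually_elim
      case (elim w)
      show ?case unfolding s_def
        by (intro tendsto_intros filterlim_compose[OF elim(1) radius_at_left] filterlim_compose[OF elim(2) radius_at_left])
    qed
    show "AE w in \<sigma>. norm (s j w) \<le> maximal_real x w + maximal_real y w" for j
      using AE_maximal_real[of x] AE_maximal_real[of y]
    proof eventually_elim
      case (elim w)
      have "norm (s j w) \<le> (cmod (ell2_fun x (of_real (radius j) * w)))\<^sup>2 + (cmod (ell2_fun y (of_real (radius j) * w)))\<^sup>2"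
        using AM_GM_norm[of "ell2_fun x (of_real (radius j) * w)" "cnj (ell2_fun y (of_real (radius j) * w))"] by (simp add: s_def)
      also have "\<dots> \<le> maximal_real x w + maximal_real y w"
        using elim radius_bounds[of j] by (intro add_mono) auto
      finally show ?case .
    qed
  qed (auto simp: s_def)
  define p where "p n = coeff x n * cnj (coeff y n)" for n
  have p: "summable (\<lambda>n. cmod (p n))" unfolding p_def by (rule summable_coeff_prod)
  have "(\<integral>w. s j w \<partial>\<sigma>) = (\<Sum>n. p n * of_real ((radius j)\<^sup>2) ^ n)" for j
    using parseval_dilated[of "radius j" x y] radius_bounds[of j] unfolding s_def p_def by (simp add: sums_iff)
  moreover have "(\<lambda>j. \<Sum>n. p n * of_real ((radius j)\<^sup>2) ^ n) \<longlonglongrightarrow> (\<Sum>n. p n * of_real 1 ^ n)"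
  proof (rule continuous_on_tendsto_compose[OF abel_continuity[OF p]])
    have "radius \<longlonglongrightarrow> 1"
      using filterlim_mono[OF radius_at_left at_within_le_nhds order_refl] by simp
    from tendsto_power[OF this, of 2] show "(\<lambda>j. (radius j)\<^sup>2) \<longlonglongrightarrow> 1" by simp
    show "\<forall>\<^sub>F j in sequentially. (radius j)\<^sup>2 \<in> {0..1}"
      using radius_bounds by (intro always_eventually) (simp add: power_le_one less_imp_le)
  qed simp
  ultimately have "(\<lambda>j. \<integral>w. s j w \<partial>\<sigma>) \<longlonglongrightarrow> (\<Sum>n. p n)" by simp
  then show ?thesis using LIMSEQ_unique[OF lim1] by (simp add: ip_def p_def)
qed

lemma H2_norm_ell2: "H2_norm (ell2_fun x) = norm x"
  by (simp add: H2_norm_def H2_inner_ell2 norm_ell2_def inner_ip)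

lemma ell2_fun_H2: "ell2_fun x \<in> H2"
proof -
  have "bdd_above ((\<lambda>r. \<integral>w. (cmod (ell2_fun x (of_real r * w)))\<^sup>2 \<partial>\<sigma>) ` {0<..<1})"
    by (rule bdd_aboveI2[where M = "(norm x)\<^sup>2"]) (auto intro: norm_sq_dilated_le)
  then show ?thesis using ell2_fun_disk_holomorphic by (simp add: H2_def)
qed

lemma holomorphic_coeff_bound:
  assumes f: "f \<in> disk_holomorphic" and r: "0 < r" "r < 1"
    and M: "(\<integral>w. (cmod (f (of_real r * w)))\<^sup>2 \<partial>\<sigma>) \<le> M"
  shows "(\<Sum>n<N. (cmod ((deriv ^^ n) f 0 / fact n))\<^sup>2 * (r\<^sup>2) ^ n) \<le> M"
proof -
  define a where "a n = (deriv ^^ n) f 0 / fact n" for n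
  have sums: "(\<lambda>n. a n * z ^ n) sums f z" if "cmod z < 1" for z
    using holomorphic_power_series[of f 0 1 z] f that by (simp add: disk_holomorphic_def a_def)
  have f_eq: "f = (\<lambda>z. if cmod z < 1 then power_series a z else 0)"
    using sums f by (auto simp: fun_eq_iff disk_holomorphic_def power_series_def sums_iff)
  have [measurable]: "f \<in> borel_measurable borel" by (subst f_eq) measurable
  \<comment> \<open>An intermediate radius: convergence at \<open>s\<close> forces absolute
    convergence at the smaller radius \<open>r\<close>.\<close>
  define s where "s = (1 + r) / 2"
  have s: "0 < s" "s < 1" "r < s" using r by (auto simp: s_def)
  have "summable (\<lambda>n. a n * of_real s ^ n)" using sums[of "of_real s"] s by (simp add: sums_iff)
  then have "summable (\<lambda>n. cmod (a n * of_real r ^ n))"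
    by (rule powser_insidea) (use s r in auto)
  then have w: "wiener (\<lambda>n. a n * of_real r ^ n)" by unfold_locales
  have "(\<lambda>n. complex_of_real ((cmod (a n * of_real r ^ n))\<^sup>2)) sums
      (\<integral>w. complex_of_real ((cmod (power_series (\<lambda>n. a n * of_real r ^ n) w))\<^sup>2) \<partial>\<sigma>)"
    using parseval_wiener[OF w w] unfolding complex_norm_square .
  then have "(\<lambda>n. (cmod (a n * of_real r ^ n))\<^sup>2) sums
      (\<integral>w. (cmod (power_series (\<lambda>n. a n * of_real r ^ n) w))\<^sup>2 \<partial>\<sigma>)"
    unfolding integral_complex_of_real sums_of_real_iff .
  also have "(\<integral>w. (cmod (power_series (\<lambda>n. a n * of_real r ^ n) w))\<^sup>2 \<partial>\<sigma>) =
      (\<integral>w. (cmod (f (of_real r * w)))\<^sup>2 \<partial>\<sigma>)"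
  proof (rule integral_cong_AE)
    show "AE w in \<sigma>. (cmod (power_series (\<lambda>n. a n * of_real r ^ n) w))\<^sup>2 = (cmod (f (of_real r * w)))\<^sup>2"
      using AE_circle_norm
    proof eventually_elim
      case (elim w)
      have "f (of_real r * w) = power_series (\<lambda>n. a n * of_real r ^ n) w"
        using sums[of "of_real r * w"] elim r
        by (simp add: norm_mult power_series_def power_mult_distrib mult.assoc sums_iff)
      then show ?case by simp
    qed
  qed auto
  also have "(\<lambda>n. (cmod (a n * of_real r ^ n))\<^sup>2) = (\<lambda>n. (cmod (a n))\<^sup>2 * (r\<^sup>2) ^ n)"
    using r by (simp add: norm_mult norm_power power_mult_distrib mult.commute flip: power_mult)
  finally have S: "(\<lambda>n. (cmod (a n))\<^sup>2 * (r\<^sup>2) ^ n) sums (\<integral>w. (cmod (f (of_real r * w)))\<^sup>2 \<partial>\<sigma>)" .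
  have "(\<Sum>n<N. (cmod (a n))\<^sup>2 * (r\<^sup>2) ^ n) \<le> (\<Sum>n. (cmod (a n))\<^sup>2 * (r\<^sup>2) ^ n)"
    using S by (intro sum_le_suminf) (auto simp: sums_iff)
  then show ?thesis using S M by (simp add: sums_iff a_def)
qed

text \<open>The bound on circle means bounds each finite sum of weighted squared coefficients;
  letting the radius tend to 1 removes the weights. From here on, H2 is the image of
  \<open>ell2_fun\<close>.\<close>

lemma H2_imp_ell2:
  assumes "f \<in> H2" obtains x where "f = ell2_fun x"
proof -
  have f: "f \<in> disk_holomorphic"
    and bdd: "bdd_above ((\<lambda>r. \<integral>w. (cmod (f (of_real r * w)))\<^sup>2 \<partial>\<sigma>) ` {0<..<1})"
    using assms by (auto simp: H2_def)
  then obtain M where "\<forall>y\<in>(\<lambda>r. \<integral>w. (cmod (f (of_real r * w)))\<^sup>2 \<partial>\<sigma>) ` {0<..<1}. y \<le> M"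
    unfolding bdd_above_def by blast
  then have M: "(\<integral>w. (cmod (f (of_real r * w)))\<^sup>2 \<partial>\<sigma>) \<le> M" if "r \<in> {0<..<1}" for r
    using that by blast
  define a where "a n = (deriv ^^ n) f 0 / fact n" for n
  have "(\<Sum>n<N. (cmod (a n))\<^sup>2) \<le> M" for N
  proof (rule LIMSEQ_le_const2)
    have "radius \<longlonglongrightarrow> 1"
      using filterlim_mono[OF radius_at_left at_within_le_nhds order_refl] by simp
    then have "(\<lambda>j. \<Sum>n<N. (cmod (a n))\<^sup>2 * ((radius j)\<^sup>2) ^ n) \<longlonglongrightarrow> (\<Sum>n<N. (cmod (a n))\<^sup>2 * (1\<^sup>2) ^ n)"
      by (intro tendsto_intros)
    then show "(\<lambda>j. \<Sum>n<N. (cmod (a n))\<^sup>2 * ((radius j)\<^sup>2) ^ n) \<longlonglongrightarrow> (\<Sum>n<N. (cmod (a n))\<^sup>2)" by simp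
    show "\<exists>J. \<forall>j\<ge>J. (\<Sum>n<N. (cmod (a n))\<^sup>2 * ((radius j)\<^sup>2) ^ n) \<le> M"
      unfolding a_def using holomorphic_coeff_bound[OF f _ _ M] radius_bounds by auto
  qed
  then have "summable (\<lambda>n. (cmod (a n))\<^sup>2)" by (intro summableI_nonneg_bounded) auto
  then have c: "coeff (Abs_ell2 a) = a" by (simp add: Abs_ell2_inverse)
  have "f = ell2_fun (Abs_ell2 a)"
  proof
    fix z
    show "f z = ell2_fun (Abs_ell2 a) z"
    proof (cases "cmod z < 1")
      case True
      then have "(\<lambda>n. a n * z ^ n) sums f z"
        using holomorphic_power_series[of f 0 1 z] f by (simp add: disk_holomorphic_def a_def)
      then show ?thesis using ell2_fun_sums[OF True, of "Abs_ell2 a"] by (simp add: c sums_unique2)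
    qed (use f in \<open>simp add: disk_holomorphic_def ell2_fun_def\<close>)
  qed
  then show ?thesis by (rule that)
qed

section \<open>Toeplitz operators and de Branges--Rovnyak spaces\<close>

lemma norm_boundary:
  shows "integrable \<sigma> (\<lambda>w. (cmod (boundary (ell2_fun x) w))\<^sup>2)"
    and "(\<integral>w. (cmod (boundary (ell2_fun x) w))\<^sup>2 \<partial>\<sigma>) = (norm x)\<^sup>2"
proof -
  show "integrable \<sigma> (\<lambda>w. (cmod (boundary (ell2_fun x) w))\<^sup>2)"
    by (rule Bochner_Integration.integrable_bound[OF maximal_real_integrable[of x]])
      (use AE_boundary_le[of x] in \<open>auto elim!: eventually_mono\<close>)
  have "complex_of_real (\<integral>w. (cmod (boundary (ell2_fun x) w))\<^sup>2 \<partial>\<sigma>) = ip x x"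
    unfolding H2_inner_ell2[symmetric] H2_inner_def L2_inner_def complex_norm_square[symmetric]
    by (rule integral_complex_of_real[symmetric])
  then show "(\<integral>w. (cmod (boundary (ell2_fun x) w))\<^sup>2 \<partial>\<sigma>) = (norm x)\<^sup>2"
    unfolding ip_self_norm of_real_eq_iff .
qed

text \<open>The hypothesis says little about individual coefficients, but it passes to radial
  limits, whose L2 norm is the norm of \<open>ell2\<close>.\<close>

lemma norm_le_pointwise:
  assumes "\<And>z. cmod (ell2_fun y z) \<le> cmod (ell2_fun x z)"
  shows "norm y \<le> norm x"
proof (rule power2_le_imp_le)
  show "(norm y)\<^sup>2 \<le> (norm x)\<^sup>2"
    unfolding norm_boundary(2)[symmetric]
  proof (rule integral_mono_AE[OF norm_boundary(1) norm_boundary(1)])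
    show "AE w in \<sigma>. (cmod (boundary (ell2_fun y) w))\<^sup>2 \<le> (cmod (boundary (ell2_fun x) w))\<^sup>2"
      using AE_boundary[of x] AE_boundary[of y]
    proof eventually_elim
      case (elim w)
      have "cmod (boundary (ell2_fun y) w) \<le> cmod (boundary (ell2_fun x) w)"
        by (rule tendsto_le[OF _ tendsto_norm[OF elim(1)] tendsto_norm[OF elim(2)]])
          (auto intro: always_eventually assms)
      then show ?case by (intro power_mono) auto
    qed
  qed
qed simp

lemma ip_diff_left: "ip (x - y) z = ip x z - ip y z"
  using ip_add_left[of "x - y" y z] by simp

lemma ell2_eq_ip:
  assumes "\<And>k. ip x k = ip y k" shows "x = y"
proof -
  have "ip (x - y) (x - y) = 0" using assms by (simp add: ip_diff_left)
  then show ?thesis by (simp add: ip_self_norm)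
qed

text \<open>Resolves the definite description in \<open>P_plus\<close>: two candidates have the same
  inner product with every element of H2, so they coincide.\<close>

lemma toeplitz_eqI:
  assumes \<phi> [measurable]: "\<phi> \<in> borel_measurable borel" and bd: "AE w in \<sigma>. cmod (\<phi> w) \<le> 1"
    and y: "\<And>k. L2_inner (\<lambda>w. \<phi> w * boundary (ell2_fun x) w) (boundary (ell2_fun k)) = ip y k"
  shows "toeplitz \<phi> (ell2_fun x) = ell2_fun y"
proof -
  have *: "L2_inner (\<lambda>w. \<phi> w * boundary (ell2_fun x) w - boundary (ell2_fun v) w) (boundary (ell2_fun k)) = ip y k - ip v k" for v k
  proof -
    have "L2_inner (\<lambda>w. \<phi> w * boundary (ell2_fun x) w - boundary (ell2_fun v) w) (boundary (ell2_fun k)) =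
        L2_inner (\<lambda>w. \<phi> w * boundary (ell2_fun x) w) (boundary (ell2_fun k)) - L2_inner (boundary (ell2_fun v)) (boundary (ell2_fun k))"
      unfolding L2_inner_def left_diff_distrib
      using boundary_prod_integrable[OF \<phi> bd, of x k] boundary_prod_integrable[of "\<lambda>_. 1" v k]
      by (intro Bochner_Integration.integral_diff) auto
    then show ?thesis using H2_inner_ell2[of v k] by (simp add: y H2_inner_def)
  qed
  show ?thesis unfolding toeplitz_def P_plus_def
  proof (rule the_equality)
    show "ell2_fun y \<in> H2 \<and> (\<forall>k\<in>H2. L2_inner (\<lambda>w. \<phi> w * boundary (ell2_fun x) w - boundary (ell2_fun y) w) (boundary k) = 0)"
      using * by (auto simp: ell2_fun_H2 elim!: H2_imp_ell2)
    fix h assume h: "h \<in> H2 \<and> (\<forall>k\<in>H2. L2_inner (\<lambda>w. \<phi> w * boundary (ell2_fun x) w - boundary h w) (boundary k) = 0)"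
    then obtain v where v: "h = ell2_fun v" using H2_imp_ell2 by blast
    have "ip v k = ip y k" for k using h *[of v k] ell2_fun_H2[of k] by (simp add: v)
    then have "v = y" by (rule ell2_eq_ip)
    then show "h = ell2_fun y" by (simp add: v)
  qed
qed

text \<open>Polarisation over the complex scalars: reality of the form at x + y and at x + i y
  forces symmetry. It bridges \<open>H2_positive\<close>, which speaks only of the quadratic form,
  and \<open>root_unique\<close>, which assumes symmetry.\<close>

lemma self_adjoint_of_real_form:
  assumes add: "\<And>x y. T (x + y) = T x + T y" and sc: "\<And>c x. T (cscale c x) = cscale c (T x)"
    and re: "\<And>x. ip (T x) x \<in> \<real>"
  shows "inner (T x) y = inner x (T y)"
proof -
  have ip_add_right: "ip a (b + c) = ip a b + ip a c" for a b c
    by (subst (1 2 3) ip_commute) (simp add: ip_add_left)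
  have ip_cscale_right: "ip a (cscale c b) = cnj c * ip a b" for a b c
    by (subst (1 2) ip_commute) (simp add: ip_cscale_left)
  have Im: "Im (ip (T x) y) + Im (ip (T y) x) = 0" for x y
  proof -
    have "Im (ip (T (x + y)) (x + y)) = 0" "Im (ip (T x) x) = 0" "Im (ip (T y) y) = 0"
      using re complex_is_Real_iff by blast+
    then show ?thesis by (simp add: add ip_add_left ip_add_right)
  qed
  from Im[of x "cscale \<i> y"] have "Re (ip (T x) y) = Re (ip (T y) x)"
    by (simp add: sc ip_cscale_left ip_cscale_right)
  also have "\<dots> = Re (ip x (T y))" by (subst ip_commute) simp
  finally show ?thesis by (simp add: inner_ip)
qed

section \<open>Multiplication by a Schur function, its adjoint and its defect operator\<close>

locale schur =
  fixes b :: "complex \<Rightarrow> complex"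
  assumes holomorphic: "b \<in> disk_holomorphic" and bound: "\<And>z. cmod (b z) \<le> 1"
begin

lemma mult_exists: "\<exists>!y. ell2_fun y = (\<lambda>z. b z * ell2_fun x z)"
proof -
  have le: "cmod (b z * ell2_fun x z) \<le> cmod (ell2_fun x z)" for z
    using bound[of z] by (simp add: norm_mult mult_left_le_one_le)
  have "(\<lambda>z. b z * ell2_fun x z) \<in> disk_holomorphic"
    using holomorphic ell2_fun_disk_holomorphic[of x] by (auto simp: disk_holomorphic_def intro!: holomorphic_intros)
  moreover have "bdd_above ((\<lambda>r. \<integral>w. (cmod (b (of_real r * w) * ell2_fun x (of_real r * w)))\<^sup>2 \<partial>\<sigma>) ` {0<..<1})"
  proof (rule bdd_aboveI2[where M = "(norm x)\<^sup>2"])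
    fix r :: real assume r: "r \<in> {0<..<1}"
    have "(\<integral>w. (cmod (b (of_real r * w) * ell2_fun x (of_real r * w)))\<^sup>2 \<partial>\<sigma>) \<le>
        (\<integral>w. (cmod (ell2_fun x (of_real r * w)))\<^sup>2 \<partial>\<sigma>)"
      by (rule integral_mono') (use r le in \<open>auto intro!: integrable_norm_sq_dilated power_mono\<close>)
    also have "\<dots> \<le> (norm x)\<^sup>2" using r by (intro norm_sq_dilated_le) auto
    finally show "(\<integral>w. (cmod (b (of_real r * w) * ell2_fun x (of_real r * w)))\<^sup>2 \<partial>\<sigma>) \<le> (norm x)\<^sup>2" .
  qed
  ultimately have "(\<lambda>z. b z * ell2_fun x z) \<in> H2" by (simp add: H2_def)
  then obtain y where "(\<lambda>z. b z * ell2_fun x z) = ell2_fun y" using H2_imp_ell2 by blast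
  then show ?thesis by (metis ell2_fun_eq_iff)
qed

definition mult_op :: "ell2 \<Rightarrow> ell2" where
  "mult_op x = (THE y. ell2_fun y = (\<lambda>z. b z * ell2_fun x z))"

lemma ell2_fun_mult: "ell2_fun (mult_op x) = (\<lambda>z. b z * ell2_fun x z)"
  unfolding mult_op_def by (rule theI'[OF mult_exists])

lemma mult_add: "mult_op (x + y) = mult_op x + mult_op y"
  by (subst ell2_fun_eq_iff[symmetric]) (simp add: ell2_fun_mult ell2_fun_add distrib_left)

lemma mult_cscale: "mult_op (cscale c x) = cscale c (mult_op x)"
  by (subst ell2_fun_eq_iff[symmetric]) (simp add: ell2_fun_mult ell2_fun_cscale mult_ac)

lemma norm_mult_le: "norm (mult_op x) \<le> norm x"
  by (rule norm_le_pointwise)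
    (use bound in \<open>auto simp: ell2_fun_mult norm_mult intro: mult_left_le_one_le\<close>)

lemma mult_linear: "linear mult_op"
  by (rule linearI) (simp_all add: mult_add scaleR_eq_cscale mult_cscale)

text \<open>The symbol is its own product with the constant 1, hence in H2, so Fatou's theorem and
  measurability of boundary values apply to it.\<close>

lemma symbol_ell2: obtains \<beta> where "b = ell2_fun \<beta>"
proof -
  have "summable (\<lambda>n. (cmod (if n = 0 then 1 else 0))\<^sup>2)" by (rule summable_finite[of "{0}"]) auto
  then have "coeff (Abs_ell2 (\<lambda>n. if n = 0 then 1 else 0)) = (\<lambda>n. if n = 0 then 1 else 0)"
    by (intro Abs_ell2_inverse) simp
  then have "ell2_fun (Abs_ell2 (\<lambda>n. if n = 0 then 1 else 0)) z = 1" if "cmod z < 1" for z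
    using that sums_unique[OF sums_single[of 0 "\<lambda>_. 1::complex"]]
    by (simp add: ell2_fun_def power_series_def if_distrib[of "\<lambda>u. u * _"] power_0_left cong: if_cong)
  then have "ell2_fun (mult_op (Abs_ell2 (\<lambda>n. if n = 0 then 1 else 0))) z = b z" for z
    using holomorphic by (cases "cmod z < 1") (auto simp: ell2_fun_mult ell2_fun_outside disk_holomorphic_def)
  then have "b = ell2_fun (mult_op (Abs_ell2 (\<lambda>n. if n = 0 then 1 else 0)))"
    by (simp add: fun_eq_iff)
  then show ?thesis by (rule that)
qed

lemma AE_boundary_symbol: "AE w in \<sigma>. ((\<lambda>r. b (of_real r * w)) \<longlongrightarrow> boundary b w) (at_left 1)"
  by (rule symbol_ell2) (use AE_boundary in blast)

lemma boundary_symbol_measurable [measurable]: "boundary b \<in> borel_measurable borel"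
  by (rule symbol_ell2) (use boundary_measurable in blast)

lemma boundary_symbol_bound: "AE w in \<sigma>. cmod (boundary b w) \<le> 1"
  using AE_boundary_symbol
proof eventually_elim
  case (elim w)
  show ?case by (rule tendsto_upperbound[OF tendsto_norm[OF elim]]) (auto intro: always_eventually bound)
qed

lemma boundary_mult: "AE w in \<sigma>. boundary (ell2_fun (mult_op x)) w = boundary b w * boundary (ell2_fun x) w"
  using AE_boundary_symbol AE_boundary[of x] AE_boundary[of "mult_op x"]
proof eventually_elim
  case (elim w)
  have "((\<lambda>r. ell2_fun (mult_op x) (of_real r * w)) \<longlongrightarrow> boundary b w * boundary (ell2_fun x) w) (at_left 1)"
    unfolding ell2_fun_mult by (rule tendsto_mult[OF elim(1,2)])
  from tendsto_unique[OF _ elim(3) this] show ?case by simp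
qed

text \<open>Riesz representation, as the case \<open>S = id\<close> of
  \<open>functional_representation\<close>.\<close>

lemma adjoint_exists: "\<exists>!u. \<forall>g. inner u g = inner x (mult_op g)"
proof -
  have "linear (\<lambda>g. inner x (mult_op g))"
    by (rule linearI) (simp_all add: linear_add[OF mult_linear] linear_scale[OF mult_linear] inner_add_right)
  moreover have "\<bar>inner x (mult_op g)\<bar> \<le> norm x * norm (id g)" for g
    using Cauchy_Schwarz_ineq2[of x "mult_op g"] mult_left_mono[OF norm_mult_le[of g] norm_ge_zero[of x]] by simp
  ultimately obtain u where "\<And>g. inner x (mult_op g) = inner u (id g)"
    using functional_representation[OF linear_id] by blast
  then have "\<forall>g. inner u g = inner x (mult_op g)" by simp
  moreover have "v = u" if "\<forall>g. inner v g = inner x (mult_op g)" "\<forall>g. inner u g = inner x (mult_op g)" for u v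
  proof -
    have "inner (v - u) (v - u) = 0" using that by (simp add: inner_diff_left)
    then show ?thesis by simp
  qed
  ultimately show ?thesis by blast
qed

definition adjoint :: "ell2 \<Rightarrow> ell2" where
  "adjoint x = (THE u. \<forall>g. inner u g = inner x (mult_op g))"

lemma inner_adjoint: "inner (adjoint x) g = inner x (mult_op g)"
  using theI'[OF adjoint_exists[of x]] by (simp add: adjoint_def)

lemma ip_adjoint: "ip (adjoint x) g = ip x (mult_op g)"
  by (simp add: ip_inner inner_adjoint mult_cscale)

lemma adjoint_eqI: "(\<And>g. ip u g = ip x (mult_op g)) \<Longrightarrow> adjoint x = u"
  by (rule ell2_eq_ip) (simp add: ip_adjoint)

lemma adjoint_add: "adjoint (x + y) = adjoint x + adjoint y"
  by (rule adjoint_eqI) (simp add: ip_add_left ip_adjoint)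

lemma adjoint_cscale: "adjoint (cscale c x) = cscale c (adjoint x)"
  by (rule adjoint_eqI) (simp add: ip_cscale_left ip_adjoint)

lemma toeplitz_symbol: "toeplitz (boundary b) (ell2_fun x) = ell2_fun (mult_op x)"
proof (rule toeplitz_eqI[OF boundary_symbol_measurable boundary_symbol_bound])
  fix k
  show "L2_inner (\<lambda>w. boundary b w * boundary (ell2_fun x) w) (boundary (ell2_fun k)) = ip (mult_op x) k"
    unfolding H2_inner_ell2[symmetric] H2_inner_def L2_inner_def
    by (rule integral_cong_AE) (use boundary_mult[of x] in \<open>auto elim!: eventually_mono\<close>)
qed

lemma toeplitz_cnj_symbol: "toeplitz (\<lambda>w. cnj (boundary b w)) (ell2_fun x) = ell2_fun (adjoint x)"
proof (rule toeplitz_eqI)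
  fix k
  show "L2_inner (\<lambda>w. cnj (boundary b w) * boundary (ell2_fun x) w) (boundary (ell2_fun k)) = ip (adjoint x) k"
    unfolding ip_adjoint unfolding H2_inner_ell2[symmetric] H2_inner_def L2_inner_def
    by (rule integral_cong_AE) (use boundary_mult[of k] in \<open>auto elim!: eventually_mono\<close>)
qed (use boundary_symbol_bound in auto)

text \<open>Hyponormality of multiplication: the adjoint is the projection of \<open>cnj\<close> b
  times x, which has the same boundary modulus as b x. Instead of the projection, the proof pairs k
  = \<open>adjoint x\<close> with itself and uses |u v| <= (|u|^2 + |v|^2) / 2, which leaves ||k||^2
  <= (||b x||^2 + ||k||^2) / 2.\<close>

lemma norm_adjoint_le_mult: "norm (adjoint x) \<le> norm (mult_op x)"
proof (rule power2_le_imp_le)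
  let ?k = "adjoint x"
  let ?u = "\<lambda>w. cnj (boundary b w) * boundary (ell2_fun x) w * cnj (boundary (ell2_fun ?k) w)"
  have "ip ?k ?k = (\<integral>w. ?u w \<partial>\<sigma>)"
    unfolding ip_adjoint unfolding H2_inner_ell2[symmetric] H2_inner_def L2_inner_def
    by (rule integral_cong_AE) (use boundary_mult[of ?k] in \<open>auto elim!: eventually_mono\<close>)
  then have "(norm ?k)\<^sup>2 = cmod (\<integral>w. ?u w \<partial>\<sigma>)"
    by (metis abs_of_nonneg ip_self_norm norm_of_real zero_le_power2)
  also have "\<dots> \<le> (\<integral>w. cmod (?u w) \<partial>\<sigma>)" by (rule integral_norm_bound)
  also have "\<dots> \<le> (\<integral>w. ((cmod (boundary (ell2_fun (mult_op x)) w))\<^sup>2 + (cmod (boundary (ell2_fun ?k) w))\<^sup>2) / 2 \<partial>\<sigma>)"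
  proof (rule integral_mono_AE)
    show "integrable \<sigma> (\<lambda>w. cmod (?u w))"
      using boundary_prod_integrable[of "\<lambda>w. cnj (boundary b w)" x ?k] boundary_symbol_bound by simp
    show "integrable \<sigma> (\<lambda>w. ((cmod (boundary (ell2_fun (mult_op x)) w))\<^sup>2 + (cmod (boundary (ell2_fun ?k) w))\<^sup>2) / 2)"
      by (intro integrable_divide_zero Bochner_Integration.integrable_add norm_boundary(1))
    show "AE w in \<sigma>. cmod (?u w) \<le> ((cmod (boundary (ell2_fun (mult_op x)) w))\<^sup>2 + (cmod (boundary (ell2_fun ?k) w))\<^sup>2) / 2"
      using boundary_mult[of x]
    proof eventually_elim
      case (elim w)
      show ?case unfolding elim
        using sum_squares_bound[of "cmod (boundary b w * boundary (ell2_fun x) w)" "cmod (boundary (ell2_fun ?k) w)"]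
        by (simp add: norm_mult)
    qed
  qed
  also have "\<dots> = ((norm (mult_op x))\<^sup>2 + (norm ?k)\<^sup>2) / 2"
    by (simp add: norm_boundary)
  finally show "(norm ?k)\<^sup>2 \<le> (norm (mult_op x))\<^sup>2" by simp
qed simp

text \<open>The composite of the Toeplitz operators with symbols b and \<open>cnj\<close> b; I minus
  it is the operator whose square root defines H(b).\<close>

definition gram :: "ell2 \<Rightarrow> ell2" where
  "gram x = mult_op (adjoint x)"

sublocale gram: contraction gram
proof (rule contraction.intro)
  show "linear gram"
    by (rule linearI) (simp_all add: gram_def adjoint_add mult_add scaleR_eq_cscale adjoint_cscale mult_cscale)
  show "norm (gram x) \<le> norm x" for x
    using norm_mult_le[of "adjoint x"] norm_adjoint_le_mult[of x] norm_mult_le[of x] by (simp add: gram_def)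
  show "inner (gram x) y = inner x (gram y)" for x y
    unfolding gram_def using inner_adjoint[of x "adjoint y"] inner_adjoint[of y "adjoint x"]
    by (simp add: inner_commute)
qed

definition root :: "ell2 \<Rightarrow> ell2" where
  "root = root_op gram"

lemma root_cscale: "root (cscale c x) = cscale c (root x)"
  unfolding root_def
  by (rule gram.root_commute[OF bounded_linear_cscale, symmetric])
    (simp add: gram_def adjoint_cscale mult_cscale)

lemma root_add: "root (x + y) = root x + root y"
  unfolding root_def by (rule linear_add[OF bounded_linear.linear[OF gram.root_bounded_linear]])

lemma root_root: "root (root x) = x - gram x"
  unfolding root_def by (rule gram.root_square)

lemma root_inner: "inner (root x) y = inner x (root y)"
  unfolding root_def by (rule gram.root_self_adj)

lemma root_ip: "ip (root x) y = ip x (root y)"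
  by (simp add: ip_inner root_inner root_cscale)

lemma defect_operator:
  "ell2_fun x z - toeplitz (boundary b) (toeplitz (\<lambda>w. cnj (boundary b w)) (ell2_fun x)) z = ell2_fun (root (root x)) z"
  by (simp add: toeplitz_symbol toeplitz_cnj_symbol root_root ell2_fun_diff gram_def)

text \<open>A competitor \<open>T\<close> on functions is transported to an operator
  \<open>t\<close> on \<open>ell2\<close>, where boundedness, positivity and the square identity are
  exactly what \<open>root_unique\<close> asks for.\<close>

lemma sqrt_unique:
  assumes bl: "H2_bounded_linear T" and pos: "H2_positive T"
    and sq: "\<And>x. T (T (ell2_fun x)) = ell2_fun (root (root x))"
  shows "T (ell2_fun x) = ell2_fun (root x)"
proof -
  define t where "t x = (THE y. ell2_fun y = T (ell2_fun x))" for x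
  have t: "T (ell2_fun x) = ell2_fun (t x)" for x
  proof -
    have "T (ell2_fun x) \<in> H2" using bl ell2_fun_H2[of x] by (simp add: H2_bounded_linear_def)
    then obtain y where y: "T (ell2_fun x) = ell2_fun y" using H2_imp_ell2 by blast
    then have "t x = y" unfolding t_def by (simp add: ell2_fun_eq_iff)
    then show ?thesis using y by simp
  qed
  have add: "t (x + y) = t x + t y" for x y
  proof -
    have "T (\<lambda>z. ell2_fun x z + ell2_fun y z) = (\<lambda>z. T (ell2_fun x) z + T (ell2_fun y) z)"
      using bl ell2_fun_H2 by (simp add: H2_bounded_linear_def)
    then show ?thesis by (simp add: t ell2_fun_eq_iff flip: ell2_fun_add)
  qed
  have sc: "t (cscale c x) = cscale c (t x)" for c x
  proof -
    have "T (\<lambda>z. c * ell2_fun x z) = (\<lambda>z. c * T (ell2_fun x) z)"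
      using bl ell2_fun_H2 by (simp add: H2_bounded_linear_def)
    then show ?thesis by (simp add: t ell2_fun_eq_iff flip: ell2_fun_cscale)
  qed
  obtain C where C: "\<forall>f\<in>H2. H2_norm (T f) \<le> C * H2_norm f"
    using bl unfolding H2_bounded_linear_def by blast
  have "bounded_linear t"
  proof (rule bounded_linear_intro[where K = C])
    show "norm (t x) \<le> norm x * C" for x
      using bspec[OF C ell2_fun_H2[of x]] by (simp add: t H2_norm_ell2 mult.commute)
  qed (simp_all add: add sc scaleR_eq_cscale)
  moreover have re: "ip (t x) x \<in> \<real>" "0 \<le> Re (ip (t x) x)" for x
    using pos ell2_fun_H2[of x] by (auto simp: H2_positive_def t H2_inner_ell2 dest!: bspec[where x = "ell2_fun x"])
  moreover have "t (t x) = x - gram x" for x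
    using sq[of x] by (simp add: t ell2_fun_eq_iff root_root)
  ultimately have "t = root_op gram"
    by (intro gram.root_unique self_adjoint_of_real_form add sc) (auto simp: inner_ip)
  then show ?thesis by (simp add: t root_def)
qed

lemma defect_sqrt_root: "defect_sqrt b (ell2_fun x) = ell2_fun (root x)"
proof -
  \<comment> \<open>The restricted abstraction provides the membership in
    \<open>extensional H2\<close> that pins down the description in \<open>H2_sqrt\<close>.\<close>
  define T0 where "T0 = (\<lambda>f\<in>H2. ell2_fun (root (THE x. ell2_fun x = f)))"
  have T0: "T0 (ell2_fun x) = ell2_fun (root x)" for x
    by (simp add: T0_def ell2_fun_H2 ell2_fun_eq_iff)
  define A where "A = (\<lambda>f z. f z - toeplitz (boundary b) (toeplitz (\<lambda>w. cnj (boundary b w)) f) z)"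
  have A: "A (ell2_fun x) = ell2_fun (root (root x))" for x
    unfolding A_def using defect_operator by blast
  have "H2_sqrt A = T0"
    unfolding H2_sqrt_def
  proof (rule the_equality)
    show "T0 \<in> extensional H2 \<and> H2_bounded_linear T0 \<and> H2_positive T0 \<and> (\<forall>f\<in>H2. T0 (T0 f) = A f)"
    proof (intro conjI)
      show "T0 \<in> extensional H2" by (simp add: T0_def)
      obtain K where K: "\<And>x. norm (root x) \<le> norm x * K"
        using bounded_linear.bounded[OF gram.root_bounded_linear] by (auto simp: root_def)
      have "H2_norm (T0 f) \<le> K * H2_norm f" if f: "f \<in> H2" for f
        by (rule H2_imp_ell2[OF f]) (simp add: T0 H2_norm_ell2 K mult.commute[of K])
      moreover have "T0 f \<in> H2" if f: "f \<in> H2" for f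
        by (rule H2_imp_ell2[OF f]) (simp add: T0 ell2_fun_H2)
      moreover have "T0 (\<lambda>z. f z + g z) = (\<lambda>z. T0 f z + T0 g z)" if f: "f \<in> H2" and g: "g \<in> H2" for f g
        by (rule H2_imp_ell2[OF f], rule H2_imp_ell2[OF g]) (simp add: T0 root_add flip: ell2_fun_add)
      moreover have "T0 (\<lambda>z. c * f z) = (\<lambda>z. c * T0 f z)" if f: "f \<in> H2" for f c
        by (rule H2_imp_ell2[OF f]) (simp add: T0 root_cscale flip: ell2_fun_cscale)
      ultimately show "H2_bounded_linear T0" unfolding H2_bounded_linear_def by blast
      have "H2_inner (T0 f) f \<in> \<real> \<and> 0 \<le> Re (H2_inner (T0 f) f)" if f: "f \<in> H2" for f
      proof (rule H2_imp_ell2[OF f])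
        fix x assume x: "f = ell2_fun x"
        have "ip (root x) x = cnj (ip (root x) x)" using ip_commute[of x "root x"] root_ip[of x x] by simp
        then have "ip (root x) x \<in> \<real>" by (metis Reals_cnj_iff)
        moreover have "0 \<le> Re (ip (root x) x)" using gram.root_pos[of x] by (simp add: root_def inner_ip)
        ultimately show ?thesis by (simp add: x T0 H2_inner_ell2)
      qed
      then show "H2_positive T0" by (simp add: H2_positive_def)
      show "\<forall>f\<in>H2. T0 (T0 f) = A f"
        by (metis A H2_imp_ell2 T0)
    qed
    fix T assume T: "T \<in> extensional H2 \<and> H2_bounded_linear T \<and> H2_positive T \<and> (\<forall>f\<in>H2. T (T f) = A f)"
    have "T (ell2_fun x) = T0 (ell2_fun x)" for x
      unfolding T0 by (rule sqrt_unique) (use T A ell2_fun_H2 in auto)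
    then have "T f = T0 f" if "f \<in> H2" for f using that by (metis H2_imp_ell2)
    then show "T = T0" using T by (intro extensionalityI[of T H2 T0]) (auto simp: T0_def)
  qed
  then show ?thesis unfolding defect_sqrt_def A_def[symmetric] by (simp add: T0)
qed

lemma norm_root: "(norm (root x))\<^sup>2 = (norm x)\<^sup>2 - (norm (adjoint x))\<^sup>2"
proof -
  have "(norm (root x))\<^sup>2 = inner (root (root x)) x"
    unfolding power2_norm_eq_inner by (simp add: root_inner)
  also have "\<dots> = (norm x)\<^sup>2 - inner (adjoint x) (adjoint x)"
    by (simp add: root_root inner_diff_left inner_diff_right gram_def inner_adjoint power2_norm_eq_inner inner_commute)
  finally show ?thesis by (simp add: power2_norm_eq_inner)
qed

end

text \<open>A Pythagorean mate \<open>a\<close> of \<open>b\<close>. It measures the defect of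
  \<open>b\<close> on the circle, and its lack of zeros makes the defect root injective.\<close>

locale schur_pair = b: schur b + a: schur a for a b +
  assumes pair: "AE w in \<sigma>. (cmod (boundary a w))\<^sup>2 + (cmod (boundary b w))\<^sup>2 = 1"
    and a_nonzero: "\<And>z. cmod z < 1 \<Longrightarrow> a z \<noteq> 0"
begin

lemma norm_pair: "(norm (a.mult_op x))\<^sup>2 + (norm (b.mult_op x))\<^sup>2 = (norm x)\<^sup>2"
proof -
  have "(norm (a.mult_op x))\<^sup>2 + (norm (b.mult_op x))\<^sup>2 =
      (\<integral>w. (cmod (boundary (ell2_fun (a.mult_op x)) w))\<^sup>2 + (cmod (boundary (ell2_fun (b.mult_op x)) w))\<^sup>2 \<partial>\<sigma>)"
    by (subst Bochner_Integration.integral_add) (simp_all add: norm_boundary)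
  also have "\<dots> = (\<integral>w. (cmod (boundary (ell2_fun x) w))\<^sup>2 \<partial>\<sigma>)"
  proof (rule integral_cong_AE)
    show "AE w in \<sigma>. (cmod (boundary (ell2_fun (a.mult_op x)) w))\<^sup>2 + (cmod (boundary (ell2_fun (b.mult_op x)) w))\<^sup>2
        = (cmod (boundary (ell2_fun x) w))\<^sup>2"
      using a.boundary_mult[of x] b.boundary_mult[of x] pair
    proof eventually_elim
      case (elim w)
      show ?case unfolding elim(1,2) norm_mult power_mult_distrib using elim(3)
        by (metis distrib_right mult_1)
    qed
  qed auto
  finally show ?thesis by (simp add: norm_boundary)
qed

text \<open>Hyponormality again: ||a x||^2 = ||x||^2 - ||b x||^2 is at most ||x||^2 minus the
  squared norm of \<open>b.adjoint x\<close>, which is ||root x||^2.\<close>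

lemma norm_a_le_root: "norm (a.mult_op x) \<le> norm (b.root x)"
proof (rule power2_le_imp_le)
  have "(norm (b.adjoint x))\<^sup>2 \<le> (norm (b.mult_op x))\<^sup>2"
    by (intro power_mono b.norm_adjoint_le_mult) simp
  then show "(norm (a.mult_op x))\<^sup>2 \<le> (norm (b.root x))\<^sup>2"
    using norm_pair[of x] b.norm_root[of x] by linarith
qed simp

lemma root_injective:
  assumes "b.root x = b.root y" shows "x = y"
proof -
  have "b.root (x - y) = 0"
    using assms b.root_add[of "x - y" y] by simp
  then have "a.mult_op (x - y) = 0" using norm_a_le_root[of "x - y"] by simp
  then have "a z * ell2_fun (x - y) z = 0" for z
    using a.ell2_fun_mult[of "x - y"] by (metis ell2_fun_0)
  then have "ell2_fun (x - y) z = 0" for z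
    using a_nonzero[of z] by (cases "cmod z < 1") (auto simp: ell2_fun_outside)
  then have "ell2_fun (x - y) = ell2_fun 0" by (simp add: ell2_fun_0 fun_eq_iff)
  then show ?thesis by (simp add: ell2_fun_eq_iff)
qed

lemma Hb_iff: "f \<in> Hb b \<longleftrightarrow> (\<exists>u. f = ell2_fun (b.root u))"
proof
  assume "f \<in> Hb b"
  then obtain g where g: "g \<in> H2" "f = defect_sqrt b g" by (auto simp: Hb_def)
  obtain u where "g = ell2_fun u" using H2_imp_ell2[OF g(1)] by blast
  then show "\<exists>u. f = ell2_fun (b.root u)" using g by (auto simp: b.defect_sqrt_root)
next
  assume "\<exists>u. f = ell2_fun (b.root u)"
  then obtain u where "f = defect_sqrt b (ell2_fun u)" by (auto simp: b.defect_sqrt_root)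
  then show "f \<in> Hb b" unfolding Hb_def using ell2_fun_H2 by blast
qed

text \<open>The root is injective, so the orthogonality condition in \<open>Hb_lift\<close> holds
  for all of H2 and the lift is simply the inverse of the root.\<close>

lemma Hb_norm_root: "Hb_norm b (ell2_fun (b.root u)) = norm u"
proof -
  have "H2_kernel (defect_sqrt b) \<subseteq> {\<lambda>_. 0}"
  proof
    fix f assume "f \<in> H2_kernel (defect_sqrt b)"
    then have f: "f \<in> H2" "defect_sqrt b f = (\<lambda>_. 0)" by (auto simp: H2_kernel_def)
    obtain x where x: "f = ell2_fun x" using H2_imp_ell2[OF f(1)] by blast
    have "b.root 0 = 0" using b.root_add[of 0 0] by simp
    moreover have "ell2_fun (b.root x) = ell2_fun 0" using f by (simp add: x b.defect_sqrt_root ell2_fun_0)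
    ultimately have "x = 0" using root_injective[of x 0] by (simp add: ell2_fun_eq_iff)
    then show "f \<in> {\<lambda>_. 0}" by (simp add: x ell2_fun_0)
  qed
  moreover have "H2_inner (ell2_fun x) (\<lambda>_. 0) = 0" for x
    using H2_inner_ell2[of x 0] by (simp add: ell2_fun_0 ip_def)
  ultimately have ortho: "ell2_fun x \<in> H2_ortho (H2_kernel (defect_sqrt b))" for x
    using ell2_fun_H2 by (auto simp: H2_ortho_def)
  have "Hb_lift b (ell2_fun (b.root u)) = ell2_fun u"
    unfolding Hb_lift_def
  proof (rule the_equality)
    show "ell2_fun u \<in> H2_ortho (H2_kernel (defect_sqrt b)) \<and> defect_sqrt b (ell2_fun u) = ell2_fun (b.root u)"
      using ortho b.defect_sqrt_root by simp
    fix f assume f: "f \<in> H2_ortho (H2_kernel (defect_sqrt b)) \<and> defect_sqrt b f = ell2_fun (b.root u)"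
    then have "f \<in> H2" by (simp add: H2_ortho_def)
    then obtain x where x: "f = ell2_fun x" using H2_imp_ell2 by blast
    with f have "b.root x = b.root u" by (simp add: b.defect_sqrt_root ell2_fun_eq_iff)
    then show "f = ell2_fun u" using root_injective x by blast
  qed
  then show ?thesis by (simp add: Hb_norm_def Hb_inner_def H2_inner_ell2 norm_ell2_def inner_ip)
qed

text \<open>Writing h = root u moves the root onto k = b g. Expanding 0 <= ||g - adjoint k||^2 gives
  2 ||k||^2 <= ||g||^2 + ||adjoint k||^2, and then ||root k||^2 = ||k||^2 - ||adjoint k||^2 is at
  most ||g||^2 - ||k||^2 = ||a g||^2.\<close>

lemma Hb_norm_lower_bound:
  assumes "ell2_fun h \<in> Hb b"
  shows "inner h (b.mult_op g) \<le> Hb_norm b (ell2_fun h) * norm (a.mult_op g)"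
proof -
  obtain u where u: "h = b.root u" using assms by (auto simp: Hb_iff ell2_fun_eq_iff)
  let ?k = "b.mult_op g"
  have "inner h ?k = inner u (b.root ?k)" by (simp add: u b.root_inner)
  also have "\<dots> \<le> norm u * norm (b.root ?k)" by (rule norm_cauchy_schwarz)
  also have "\<dots> \<le> norm u * norm (a.mult_op g)"
  proof (rule mult_left_mono[OF power2_le_imp_le])
    have "0 \<le> (norm (g - b.adjoint ?k))\<^sup>2" by simp
    also have "\<dots> = (norm g)\<^sup>2 - 2 * inner (b.adjoint ?k) g + (norm (b.adjoint ?k))\<^sup>2"
      unfolding power2_norm_eq_inner by (simp add: inner_diff inner_commute)
    also have "inner (b.adjoint ?k) g = (norm ?k)\<^sup>2"
      by (simp add: b.inner_adjoint power2_norm_eq_inner)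
    finally show "(norm (b.root ?k))\<^sup>2 \<le> (norm (a.mult_op g))\<^sup>2"
      using norm_pair[of g] b.norm_root[of ?k] by linarith
  qed simp_all
  finally show ?thesis using Hb_norm_root[of u] by (simp add: u)
qed

text \<open>The range of the adjoint of multiplication by \<open>a\<close> lies in H(b). By
  \<open>norm_a_le_root\<close> the functional of \<open>h\<close> is bounded by ||h'|| ||root g||,
  so it is represented by some u composed with the root, and symmetry of the root gives h = root
  u.\<close>

lemma Hb_member:
  assumes "\<And>g. inner h g = inner h' (a.mult_op g)"
  shows "ell2_fun h \<in> Hb b"
proof -
  have lin: "linear b.root"
    by (rule linearI) (simp_all add: b.root_add scaleR_eq_cscale b.root_cscale)
  have "linear (\<lambda>g. inner h g)" by (rule linearI) (simp_all add: inner_add_right)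
  moreover have "\<bar>inner h g\<bar> \<le> norm h' * norm (b.root g)" for g
    using Cauchy_Schwarz_ineq2[of h' "a.mult_op g"] mult_left_mono[OF norm_a_le_root[of g] norm_ge_zero[of h']]
    by (simp add: assms)
  ultimately obtain u where u: "\<And>g. inner h g = inner u (b.root g)"
    using functional_representation[OF lin] by blast
  have "inner (h - b.root u) (h - b.root u) = 0"
    by (simp add: inner_diff_left u b.root_inner)
  then have "h = b.root u" by simp
  then show ?thesis by (auto simp: Hb_iff)
qed

end

section \<open>Logarithmic means\<close>

lemma Re_of_real_mult: "Re (of_real a * z) = a * Re z"
  by simp

lemma coeff_Abs_ell2: "summable (\<lambda>n. (cmod (x n))\<^sup>2) \<Longrightarrow> coeff (Abs_ell2 x) = x"
  by (simp add: Abs_ell2_inverse)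

lemma geometric_ell2:
  assumes r: "0 \<le> r" "r < 1" and x: "\<And>n. cmod (x n) \<le> C * r ^ n"
  shows "summable (\<lambda>n. (cmod (x n))\<^sup>2)"
proof (rule summable_comparison_test'[where N = 0])
  have "r\<^sup>2 < 1" using r by (simp add: abs_square_less_1)
  then show "summable (\<lambda>n. C\<^sup>2 * (r\<^sup>2) ^ n)" using r by (intro summable_mult summable_geometric) simp
  show "norm ((cmod (x n))\<^sup>2) \<le> C\<^sup>2 * (r\<^sup>2) ^ n" for n
    using power_mono[OF x[of n], of 2] by (simp add: power_mult_distrib mult.commute flip: power_mult)
qed

text \<open>The Szego kernel at a point of the real radius, where all zeros and all sample points
  lie.\<close>

definition kern :: "real \<Rightarrow> ell2" where
  "kern t = Abs_ell2 (\<lambda>n. of_real t ^ n)"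

lemma coeff_kern: "0 \<le> t \<Longrightarrow> t < 1 \<Longrightarrow> coeff (kern t) n = of_real t ^ n"
  unfolding kern_def by (subst coeff_Abs_ell2, rule geometric_ell2[of t _ 1]) (auto simp: norm_power)

lemma ip_kern: "0 \<le> t \<Longrightarrow> t < 1 \<Longrightarrow> ip x (kern t) = ell2_fun x (of_real t)"
  using ip_sums[of x "kern t"] ell2_fun_sums[of "of_real t" x] by (simp add: coeff_kern sums_unique2)

lemma ell2_fun_kern:
  assumes "0 \<le> t" "t < 1" "cmod z < 1" shows "ell2_fun (kern t) z = 1 / (1 - of_real t * z)"
proof -
  have "cmod (of_real t * z) < 1" using assms by (simp add: norm_mult le_less_trans[OF mult_left_le_one_le])
  then have "(\<lambda>n. coeff (kern t) n * z ^ n) sums (1 / (1 - of_real t * z))"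
    using geometric_sums by (simp add: coeff_kern assms flip: power_mult_distrib)
  then show ?thesis using ell2_fun_sums[OF assms(3)] sums_unique2 by blast
qed

lemma norm_kern: assumes "0 \<le> t" "t < 1" shows "(norm (kern t))\<^sup>2 = 1 / (1 - t\<^sup>2)"
proof -
  have "t\<^sup>2 < 1" using assms by (simp add: abs_square_less_1)
  then have "(\<lambda>n. (t\<^sup>2) ^ n) sums (1 / (1 - t\<^sup>2))" using assms by (intro geometric_sums) simp
  moreover have "(\<lambda>n. (cmod (coeff (kern t) n))\<^sup>2) = (\<lambda>n. (t\<^sup>2) ^ n)"
    using assms by (simp add: coeff_kern norm_power mult.commute flip: power_mult)
  ultimately show ?thesis by (simp add: norm_ell2_sq sums_iff)
qed

lift_definition dilate :: "real \<Rightarrow> ell2 \<Rightarrow> ell2" is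
  "\<lambda>t x n. if 0 \<le> t \<and> t \<le> 1 then of_real t ^ n * x n else 0"
proof -
  fix t :: real and x :: "nat \<Rightarrow> complex" assume x: "summable (\<lambda>n. (cmod (x n))\<^sup>2)"
  show "summable (\<lambda>n. (cmod (if 0 \<le> t \<and> t \<le> 1 then of_real t ^ n * x n else 0))\<^sup>2)"
    by (rule summable_comparison_test'[OF x, where N = 0])
      (auto simp: norm_mult norm_power power_le_one mult_left_le_one_le intro!: power_mono)
qed

lemma coeff_dilate: "0 \<le> t \<Longrightarrow> t \<le> 1 \<Longrightarrow> coeff (dilate t x) n = of_real t ^ n * coeff x n"
  by transfer simp

lemma ell2_fun_dilate:
  assumes "0 \<le> t" "t \<le> 1" "cmod z < 1" shows "ell2_fun (dilate t x) z = ell2_fun x (of_real t * z)"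
proof -
  have "cmod (of_real t * z) < 1"
    using assms by (simp add: norm_mult le_less_trans[OF mult_left_le_one_le])
  from ell2_fun_sums[OF this, of x] have "(\<lambda>n. coeff (dilate t x) n * z ^ n) sums ell2_fun x (of_real t * z)"
    by (simp add: coeff_dilate assms power_mult_distrib mult_ac)
  then show ?thesis using ell2_fun_sums[OF assms(3)] sums_unique2 by blast
qed

text \<open>The k-th Taylor coefficient occurs in the partial sums s_n with n >= k; this collects
  their weights, r^(n+1) / (n+1) each.\<close>

definition log_tail :: "nat \<Rightarrow> real \<Rightarrow> real" where
  "log_tail k r = (\<Sum>n. r ^ (n + k + 1) / real (n + k + 1))"

context
  fixes r :: real
  assumes r: "0 < r" "r < 1"
begin

lemma log_tail_summable: "summable (\<lambda>n. r ^ (n + k + 1) / real (n + k + 1))"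
proof (rule summable_comparison_test'[where N = 0])
  show "summable (\<lambda>n. r ^ (k + 1) * r ^ n)" using r by (intro summable_mult summable_geometric) simp
  show "norm (r ^ (n + k + 1) / real (n + k + 1)) \<le> r ^ (k + 1) * r ^ n" for n
    using r by (simp add: power_add mult_ac divide_le_eq mult_left_le)
qed

lemma log_tail_Suc: "log_tail k r = r ^ (k + 1) / real (k + 1) + log_tail (Suc k) r"
  unfolding log_tail_def using suminf_split_head[OF log_tail_summable[of k]] by (simp add: add_ac)

lemma log_tail_nonneg: "0 \<le> log_tail k r"
  unfolding log_tail_def by (rule suminf_nonneg[OF log_tail_summable]) (use r in simp)

lemma log_tail_le: "log_tail k r \<le> r / (1 - r) * r ^ k"
proof -
  have s: "summable (\<lambda>n. r ^ n)" using r by (intro summable_geometric) simp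
  have "log_tail k r \<le> (\<Sum>n. r ^ (k + 1) * r ^ n)"
    unfolding log_tail_def
  proof (rule suminf_le[OF _ log_tail_summable summable_mult[OF s]])
    show "r ^ (n + k + 1) / real (n + k + 1) \<le> r ^ (k + 1) * r ^ n" for n
      using r by (simp add: power_add mult_ac divide_le_eq mult_left_le)
  qed
  also have "\<dots> = r / (1 - r) * r ^ k"
    using r by (simp add: suminf_mult[OF s] suminf_geometric)
  finally show ?thesis .
qed

lemma log_tail_tendsto: "(\<lambda>k. log_tail k r) \<longlonglongrightarrow> 0"
proof (rule tendsto_sandwich[OF _ _ tendsto_const])
  show "\<forall>\<^sub>F k in sequentially. 0 \<le> log_tail k r" by (simp add: log_tail_nonneg)
  show "\<forall>\<^sub>F k in sequentially. log_tail k r \<le> r / (1 - r) * r ^ k"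
    by (intro always_eventually allI log_tail_le)
  have "(\<lambda>k. r / (1 - r) * r ^ k) \<longlonglongrightarrow> r / (1 - r) * 0"
    by (intro tendsto_mult tendsto_const LIMSEQ_realpow_zero) (use r in auto)
  then show "(\<lambda>k. r / (1 - r) * r ^ k) \<longlonglongrightarrow> 0" by simp
qed

lemma log_tail_bound: "log_tail k r \<le> r / (1 - r)"
proof -
  have "r / (1 - r) * r ^ k \<le> r / (1 - r) * 1" using r by (intro mult_left_mono) (auto simp: power_le_one)
  then show ?thesis using log_tail_le[of k] by simp
qed

text \<open>The weight of the n-th partial sum is \<open>log_tail n r - log_tail (Suc n) r\<close>.
  In Abel's summation the boundary term vanishes because \<open>log_tail\<close> tends to 0 and the
  partial sums converge.\<close>

lemma summation_by_parts:
  fixes u :: "nat \<Rightarrow> 'a::banach"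
  assumes u: "summable (\<lambda>n. norm (u n))"
  shows "(\<lambda>n. (r ^ (n + 1) / real (n + 1)) *\<^sub>R (\<Sum>k\<le>n. u k)) sums (\<Sum>n. log_tail n r *\<^sub>R u n)"
proof -
  have id: "(\<Sum>n<N. (r ^ (n + 1) / real (n + 1)) *\<^sub>R (\<Sum>k\<le>n. u k)) =
      (\<Sum>n<N. log_tail n r *\<^sub>R u n) - log_tail N r *\<^sub>R (\<Sum>k<N. u k)" for N
  proof (induction N)
    case (Suc N)
    have q: "r ^ (N + 1) / real (N + 1) = log_tail N r - log_tail (Suc N) r"
      using log_tail_Suc[of N] by simp
    have "(\<Sum>k\<le>N. u k) = (\<Sum>k<N. u k) + u N" by (simp flip: lessThan_Suc_atMost)
    then show ?case unfolding sum.lessThan_Suc Suc q by (simp add: algebra_simps)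
  qed simp
  have "summable (\<lambda>n. norm (log_tail n r *\<^sub>R u n))"
  proof (rule summable_comparison_test'[where N = 0])
    show "summable (\<lambda>n. r / (1 - r) * norm (u n))" by (rule summable_mult[OF u])
    show "norm (norm (log_tail n r *\<^sub>R u n)) \<le> r / (1 - r) * norm (u n)" for n
      using mult_right_mono[OF log_tail_bound[of n] norm_ge_zero[of "u n"]] log_tail_nonneg[of n] by simp
  qed
  then have 1: "(\<lambda>N. \<Sum>n<N. log_tail n r *\<^sub>R u n) \<longlonglongrightarrow> (\<Sum>n. log_tail n r *\<^sub>R u n)"
    by (rule summable_LIMSEQ[OF summable_norm_cancel])
  have 2: "(\<lambda>N. log_tail N r *\<^sub>R (\<Sum>k<N. u k)) \<longlonglongrightarrow> 0 *\<^sub>R suminf u"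
    by (rule tendsto_scaleR[OF log_tail_tendsto summable_LIMSEQ[OF summable_norm_cancel[OF u]]])
  show ?thesis unfolding sums_def id using tendsto_diff[OF 1 2] by simp
qed

end

text \<open>The logarithmic mean as a coefficient multiplier. The guard on r makes the result
  square-summable for every argument, as a total operation on \<open>ell2\<close> must be.\<close>

lift_definition log_mean_op :: "real \<Rightarrow> ell2 \<Rightarrow> ell2" is
  "\<lambda>r x n. if 0 < r \<and> r < 1 then of_real (log_tail n r / ln (1 / (1 - r))) * x n else 0"
proof -
  fix r :: real and x :: "nat \<Rightarrow> complex" assume x: "summable (\<lambda>n. (cmod (x n))\<^sup>2)"
  show "summable (\<lambda>n. (cmod (if 0 < r \<and> r < 1 then of_real (log_tail n r / ln (1 / (1 - r))) * x n else 0))\<^sup>2)"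
  proof (cases "0 < r \<and> r < 1")
    case True
    define C where "C = r / (1 - r) / \<bar>ln (1 / (1 - r))\<bar>"
    show ?thesis
    proof (rule summable_comparison_test'[where N = 0])
      show "summable (\<lambda>n. C\<^sup>2 * (cmod (x n))\<^sup>2)" by (rule summable_mult[OF x])
      show "norm ((cmod (if 0 < r \<and> r < 1 then of_real (log_tail n r / ln (1 / (1 - r))) * x n else 0))\<^sup>2) \<le> C\<^sup>2 * (cmod (x n))\<^sup>2" for n
      proof -
        have "\<bar>log_tail n r / ln (1 / (1 - r))\<bar> \<le> C"
          unfolding C_def abs_divide using True log_tail_bound[of r n] log_tail_nonneg[of r n]
          by (intro divide_right_mono) auto
        then have "\<bar>log_tail n r / ln (1 / (1 - r))\<bar>\<^sup>2 * (cmod (x n))\<^sup>2 \<le> C\<^sup>2 * (cmod (x n))\<^sup>2"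
          by (intro mult_right_mono power_mono) auto
        then show ?thesis using True by (simp add: norm_mult power_mult_distrib norm_divide power_divide)
      qed
    qed
  qed auto
qed

lemma coeff_log_mean_op:
  "0 < r \<Longrightarrow> r < 1 \<Longrightarrow> coeff (log_mean_op r x) n = of_real (log_tail n r / ln (1 / (1 - r))) * coeff x n"
  by transfer simp

lemma log_mean_ell2:
  assumes r: "0 < r" "r < 1"
  shows "log_mean r (ell2_fun x) = ell2_fun (log_mean_op r x)"
proof
  fix z
  show "log_mean r (ell2_fun x) z = ell2_fun (log_mean_op r x) z"
  proof (cases "cmod z < 1")
    case True
    define u where "u n = coeff x n * z ^ n" for n
    have u: "summable (\<lambda>n. norm (u n))"
      using dilated_summable[OF True, of x] by (simp add: u_def norm_mult norm_power)
    define L where "L = ln (1 / (1 - r))"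
    have "(\<lambda>n. (r ^ (n + 1) / real (n + 1)) *\<^sub>R (\<Sum>k\<le>n. u k)) sums (\<Sum>n. log_tail n r *\<^sub>R u n)"
      by (rule summation_by_parts[OF r u])
    \<comment> \<open>The series in \<open>log_mean\<close> has weights r^n / (n+1), with the
      missing power of r in its prefactor; \<open>log_tail\<close> carries r^(n+1).\<close>
    then have "(\<lambda>n. of_real (1 / r) * ((r ^ (n + 1) / real (n + 1)) *\<^sub>R (\<Sum>k\<le>n. u k))) sums (of_real (1 / r) * (\<Sum>n. log_tail n r *\<^sub>R u n))"
      by (rule sums_mult)
    moreover have "of_real (1 / r) * ((r ^ (n + 1) / real (n + 1)) *\<^sub>R (\<Sum>k\<le>n. u k)) =
        taylor_sum n (ell2_fun x) z / of_nat (n + 1) * complex_of_real r ^ n" for n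
      unfolding taylor_sum_def ell2_fun_taylor u_def using r by (simp add: scaleR_conv_of_real)
    ultimately have S: "(\<Sum>n. taylor_sum n (ell2_fun x) z / of_nat (n + 1) * complex_of_real r ^ n) = of_real (1 / r) * (\<Sum>n. log_tail n r *\<^sub>R u n)"
      by (simp add: sums_iff)
    have sm: "summable (\<lambda>n. log_tail n r *\<^sub>R u n)"
    proof (rule summable_norm_cancel, rule summable_comparison_test'[where N = 0])
      show "summable (\<lambda>n. r / (1 - r) * norm (u n))" by (rule summable_mult[OF u])
      show "norm (norm (log_tail n r *\<^sub>R u n)) \<le> r / (1 - r) * norm (u n)" for n
        using mult_right_mono[OF log_tail_bound[OF r, of n] norm_ge_zero[of "u n"]] log_tail_nonneg[OF r, of n] by simp
    qed
    have "(\<lambda>n. of_real (1 / L) * (log_tail n r *\<^sub>R u n)) sums (of_real (1 / L) * (\<Sum>n. log_tail n r *\<^sub>R u n))"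
      by (rule sums_mult[OF summable_sums[OF sm]])
    moreover have "(\<lambda>n. of_real (1 / L) * (log_tail n r *\<^sub>R u n)) = (\<lambda>n. coeff (log_mean_op r x) n * z ^ n)"
      by (simp add: coeff_log_mean_op[OF r] u_def L_def scaleR_conv_of_real fun_eq_iff)
    ultimately have "ell2_fun (log_mean_op r x) z = of_real (1 / L) * (\<Sum>n. log_tail n r *\<^sub>R u n)"
      using ell2_fun_sums[OF True, of "log_mean_op r x"] sums_unique2 by metis
    then show ?thesis unfolding log_mean_def S L_def[symmetric] using True r by simp
  qed (simp add: log_mean_def ell2_fun_def)
qed

text \<open>By \<open>log_tail_le\<close> the multiplier decays like r^n. This is the decay required
  by \<open>half_coanalytic_range\<close>, and thereby puts the means in H(b).\<close>

lemma log_mean_op_geometric: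
  assumes r: "0 < r" "r < 1"
  obtains C where "\<And>n. cmod (coeff (log_mean_op r x) n) \<le> C * r ^ n"
proof -
  have "cmod (coeff (log_mean_op r x) n) \<le> (r / (1 - r) / \<bar>ln (1 / (1 - r))\<bar> * norm x) * r ^ n" for n
  proof -
    have "cmod (coeff (log_mean_op r x) n) = log_tail n r / \<bar>ln (1 / (1 - r))\<bar> * cmod (coeff x n)"
      using log_tail_nonneg[OF r, of n] by (simp add: coeff_log_mean_op[OF r] norm_mult norm_divide)
    also have "\<dots> \<le> (r / (1 - r) * r ^ n) / \<bar>ln (1 / (1 - r))\<bar> * norm x"
      using r log_tail_nonneg[OF r, of n]
      by (intro mult_mono divide_right_mono log_tail_le[OF r] coeff_le_norm divide_nonneg_nonneg mult_nonneg_nonneg) auto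
    finally show ?thesis by (simp add: mult_ac)
  qed
  then show ?thesis by (rule that)
qed

text \<open>Replaces the integral over dilations by an antiderivative, the power series with terms
  P_n r^(n+1) / (n+1), where P_n are the partial sums of the coefficient products. Its derivative,
  the series of P_n t^n, is the Cauchy product of the pairing with 1 / (1 - t). A separate
  \<open>F\<close> is used because the two-sided derivative at 0 involves negative arguments, where
  \<open>log_mean_op\<close> is 0 by convention.\<close>

lemma log_mean_pairing:
  fixes f G :: ell2
  obtains F where "F 0 = 0"
    "\<And>t. 0 \<le> t \<Longrightarrow> t < 1 \<Longrightarrow> (F has_real_derivative inner f (dilate t G) / (1 - t)) (at t)"
    "\<And>r. 0 < r \<Longrightarrow> r < 1 \<Longrightarrow> F r = ln (1 / (1 - r)) * inner (log_mean_op r f) G"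
proof -
  define M where "M r = ln (1 / (1 - r)) * inner (log_mean_op r f) G" for r
  define D where "D t = inner f (dilate t G)" for t
  define p where "p k = Re (coeff f k * cnj (coeff G k))" for k
  have p: "summable (\<lambda>k. norm (p k))"
    by (rule summable_comparison_test'[OF summable_coeff_prod[of f G], where N = 0])
      (auto simp: p_def abs_Re_le_cmod simp del: complex_cnj_mult times_complex.sel)
  define P where "P n = (\<Sum>k\<le>n. p k)" for n
  have P_bd: "\<bar>P n\<bar> \<le> (\<Sum>k. norm (p k))" for n
  proof -
    have "\<bar>P n\<bar> \<le> (\<Sum>k\<le>n. norm (p k))" unfolding P_def by (simp add: sum_abs)
    also have "\<dots> \<le> (\<Sum>k. norm (p k))" by (rule sum_le_suminf[OF p]) auto
    finally show ?thesis .
  qed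
  have M: "M r = (\<Sum>n. P n / real (Suc n) * r ^ Suc n)" if r: "0 < r" "r < 1" for r
  proof -
    have "(\<lambda>n. Re (coeff (log_mean_op r f) n * cnj (coeff G n))) sums inner (log_mean_op r f) G"
      unfolding inner_ip by (rule sums_Re[OF ip_sums])
    then have "(\<lambda>n. ln (1 / (1 - r)) * Re (coeff (log_mean_op r f) n * cnj (coeff G n))) sums M r"
      unfolding M_def by (rule sums_mult)
    moreover have "ln (1 / (1 - r)) * Re (coeff (log_mean_op r f) n * cnj (coeff G n)) = log_tail n r *\<^sub>R p n" for n
    proof -
      have "ln (1 / (1 - r)) \<noteq> 0" using r by (simp add: ln_div)
      moreover have "Re (coeff (log_mean_op r f) n * cnj (coeff G n)) = log_tail n r / ln (1 / (1 - r)) * p n"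
        unfolding coeff_log_mean_op[OF r] p_def mult.assoc by (rule Re_of_real_mult) 
      ultimately show ?thesis by simp
    qed
    ultimately have "M r = (\<Sum>n. log_tail n r *\<^sub>R p n)" by (simp add: sums_iff)
    also have "\<dots> = (\<Sum>n. (r ^ (n + 1) / real (n + 1)) *\<^sub>R (\<Sum>k\<le>n. p k))"
      using summation_by_parts[OF r p] by (simp add: sums_iff)
    finally show ?thesis by (simp add: P_def mult.commute)
  qed
  have der: "((\<lambda>x. \<Sum>n. P n / real (Suc n) * x ^ Suc n) has_real_derivative D t / (1 - t)) (at t)"
    if t: "0 \<le> t" "t < 1" for t
  proof -
    have "((\<lambda>x. \<Sum>n. P n / real (Suc n) * x ^ Suc n) has_real_derivative (\<Sum>n. P n / real (Suc n) * real (Suc n) * t ^ n)) (at t)"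
    proof (rule DERIV_power_series'[where R = 1])
      fix x :: real assume x: "x \<in> {-1<..<1}"
      show "summable (\<lambda>n. P n / real (Suc n) * real (Suc n) * x ^ n)"
      proof (rule summable_comparison_test'[where N = 0])
        show "summable (\<lambda>n. (\<Sum>k. norm (p k)) * \<bar>x\<bar> ^ n)"
          using x by (intro summable_mult summable_geometric) auto
        show "norm (P n / real (Suc n) * real (Suc n) * x ^ n) \<le> (\<Sum>k. norm (p k)) * \<bar>x\<bar> ^ n" for n
          using P_bd[of n] by (simp add: abs_mult power_abs mult_right_mono del: of_nat_Suc)
      qed
    qed (use t in auto)
    moreover have "(\<Sum>n. P n / real (Suc n) * real (Suc n) * t ^ n) = D t / (1 - t)"
    proof -
      have pt: "summable (\<lambda>k. norm (p k * t ^ k))"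
        by (rule summable_comparison_test'[OF p, where N = 0])
          (use t in \<open>simp add: abs_mult mult_left_le power_le_one\<close>)
      have geo: "summable (\<lambda>k. norm (t ^ k))" using t by simp
      have "(\<lambda>k. \<Sum>i\<le>k. (p i * t ^ i) * t ^ (k - i)) sums ((\<Sum>k. p k * t ^ k) * (\<Sum>k. t ^ k))"
        by (rule Cauchy_product_sums[OF pt geo])
      moreover have "(\<Sum>i\<le>k. (p i * t ^ i) * t ^ (k - i)) = P k / real (Suc k) * real (Suc k) * t ^ k" for k
      proof -
        have "P k / real (Suc k) * real (Suc k) * t ^ k = P k * t ^ k" by (simp del: of_nat_Suc)
        then show ?thesis unfolding P_def by (simp add: sum_distrib_right mult.assoc flip: power_add)
      qed
      moreover have "(\<Sum>k. p k * t ^ k) = D t"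
      proof -
        have "(\<lambda>k. Re (coeff f k * cnj (coeff (dilate t G) k))) sums D t"
          unfolding D_def inner_ip by (rule sums_Re[OF ip_sums])
        moreover have "Re (coeff f k * cnj (coeff (dilate t G) k)) = p k * t ^ k" for k
        proof -
          have eq: "coeff f k * cnj (coeff (dilate t G) k) = of_real (t ^ k) * (coeff f k * cnj (coeff G k))"
            using t by (simp add: coeff_dilate mult_ac)
          show ?thesis unfolding p_def eq Re_of_real_mult by (rule mult.commute)
        qed
        ultimately show ?thesis by (simp add: sums_iff)
      qed
      ultimately show ?thesis using t by (simp add: sums_iff suminf_geometric)
    qed
    ultimately show ?thesis by simp
  qed
  show ?thesis
    by (rule that[of "\<lambda>x. \<Sum>n. P n / real (Suc n) * x ^ Suc n"]) (use der M in \<open>simp_all add: D_def M_def\<close>)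
qed

text \<open>\<open>F\<close> is nondecreasing and starts at 0, so only its growth on
  [1 - 2 e, 1 - e] counts: the mean value theorem gives length e times a slope of at least d / (2
  e), which is d / 2.\<close>

lemma log_mean_pairing_lower_bound:
  fixes f G :: ell2
  assumes pos: "\<And>t. 0 \<le> t \<Longrightarrow> t < 1 \<Longrightarrow> 0 \<le> inner f (dilate t G)"
    and e: "0 < e" "2 * e < 1" and d: "\<And>t. 1 - 2 * e \<le> t \<Longrightarrow> t \<le> 1 - e \<Longrightarrow> d \<le> inner f (dilate t G)"
    and "0 \<le> d" and r: "1 - e \<le> r" "r < 1"
  shows "d / 2 \<le> ln (1 / (1 - r)) * inner (log_mean_op r f) G"
proof -
  obtain F where F0: "F 0 = 0"
    and der: "\<And>t. 0 \<le> t \<Longrightarrow> t < 1 \<Longrightarrow> (F has_real_derivative inner f (dilate t G) / (1 - t)) (at t)"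
    and F: "\<And>r. 0 < r \<Longrightarrow> r < 1 \<Longrightarrow> F r = ln (1 / (1 - r)) * inner (log_mean_op r f) G"
    using log_mean_pairing[of f G] by blast
  have mono: "F s \<le> F s'" if "0 \<le> s" "s \<le> s'" "s' < 1" for s s'
  proof (rule DERIV_nonneg_imp_nondecreasing[OF that(2)])
    fix x assume "s \<le> x" "x \<le> s'"
    then have x: "0 \<le> x" "x < 1" using that by auto
    then have "0 \<le> inner f (dilate x G) / (1 - x)" using pos[OF x] by simp
    then show "\<exists>y. (F has_real_derivative y) (at x) \<and> 0 \<le> y" using der[OF x] by blast
  qed
  obtain z where z: "1 - 2 * e < z" "z < 1 - e"
    "F (1 - e) - F (1 - 2 * e) = (1 - e - (1 - 2 * e)) * (inner f (dilate z G) / (1 - z))"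
    using MVT2[of "1 - 2 * e" "1 - e" F "\<lambda>t. inner f (dilate t G) / (1 - t)"] der e by auto
  have "d / (2 * e) \<le> inner f (dilate z G) / (1 - z)"
    using d[of z] z e \<open>0 \<le> d\<close> by (intro frac_le) auto
  then have "e * (d / (2 * e)) \<le> e * (inner f (dilate z G) / (1 - z))" using e by (intro mult_left_mono) auto
  then have "d / 2 \<le> F (1 - e) - F (1 - 2 * e)" using z(3) e by simp
  also have "\<dots> \<le> F r" using mono[of 0 "1 - 2 * e"] mono[of "1 - e" r] F0 e r by auto
  finally show ?thesis using F[of r] e r by simp
qed

section \<open>The mate (1 - z) / 2 and the range of its adjoint\<close>

definition half_symbol :: "complex \<Rightarrow> complex" where
  "half_symbol z = (if cmod z < 1 then (1 - z) / 2 else 0)"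

interpretation half: schur half_symbol
proof
  have "half_symbol holomorphic_on ball 0 1 \<longleftrightarrow> (\<lambda>z. (1 - z) / 2) holomorphic_on ball 0 1"
    by (rule holomorphic_cong) (auto simp: half_symbol_def)
  then have "half_symbol holomorphic_on ball 0 1" by (auto intro!: holomorphic_intros)
  then show "half_symbol \<in> disk_holomorphic" by (simp add: disk_holomorphic_def half_symbol_def)
  show "cmod (half_symbol z) \<le> 1" for z
    using norm_triangle_ineq4[of 1 z] by (auto simp: half_symbol_def norm_divide)
qed

lift_definition shift :: "ell2 \<Rightarrow> ell2" is "\<lambda>x n. case n of 0 \<Rightarrow> 0 | Suc m \<Rightarrow> x m"
proof -
  fix x :: "nat \<Rightarrow> complex" assume "summable (\<lambda>n. (cmod (x n))\<^sup>2)"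
  then show "summable (\<lambda>n. (cmod (case n of 0 \<Rightarrow> 0 | Suc m \<Rightarrow> x m))\<^sup>2)"
    by (subst summable_Suc_iff[symmetric]) simp
qed

lemma coeff_shift [simp]: "coeff (shift x) 0 = 0" "coeff (shift x) (Suc n) = coeff x n"
  by (transfer, simp)+

lemma ell2_fun_shift:
  assumes "cmod z < 1" shows "ell2_fun (shift x) z = z * ell2_fun x z"
proof -
  have "(\<lambda>n. coeff (shift x) (Suc n) * z ^ Suc n) sums (z * ell2_fun x z)"
    using sums_mult[OF ell2_fun_sums[OF assms, of x], of z] by (simp add: mult_ac)
  then have "(\<lambda>n. coeff (shift x) n * z ^ n) sums (z * ell2_fun x z)"
    by (subst (asm) sums_Suc_iff) simp
  then show ?thesis using ell2_fun_sums[OF assms, of "shift x"] sums_unique2 by blast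
qed

lemma half_mult: "half.mult_op g = cscale (1/2) (g - shift g)"
proof -
  have "half_symbol z * ell2_fun g z = 1/2 * (ell2_fun g z - ell2_fun (shift g) z)" for z
    by (cases "cmod z < 1") (auto simp: half_symbol_def ell2_fun_shift ell2_fun_outside field_simps)
  then have "ell2_fun (half.mult_op g) = ell2_fun (cscale (1/2) (g - shift g))"
    by (simp only: half.ell2_fun_mult ell2_fun_cscale ell2_fun_diff)
  then show ?thesis by (simp only: ell2_fun_eq_iff)
qed

text \<open>
  An element \<open>h\<close> with geometrically decaying coefficients is \<open>T\<^sub>a\<^sup>* h'\<close> for \<open>a = (1 - z) / 2\<close>, where
  the coefficients of \<open>h'\<close> are twice the tail sums of those of \<open>h\<close>.
\<close>

lemma half_coanalytic_range:
  assumes r: "0 \<le> r" "r < 1" and h: "\<And>n. cmod (coeff h n) \<le> C * r ^ n"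
  obtains h' where "\<And>g. inner h g = inner h' (half.mult_op g)"
proof -
  have geo: "summable (\<lambda>j. C * r ^ k * r ^ j)" for k using r by (intro summable_mult summable_geometric) simp
  have bd: "norm (coeff h (j + k)) \<le> C * r ^ k * r ^ j" for j k
    using h[of "j + k"] by (simp add: power_add mult_ac)
  have sm: "summable (\<lambda>j. coeff h (j + k))" for k
    by (rule summable_comparison_test'[OF geo[of k], where N = 0]) (rule bd)
  define a where "a k = 2 * (\<Sum>j. coeff h (j + k))" for k
  have "cmod (a k) \<le> (2 * C / (1 - r)) * r ^ k" for k
  proof -
    have "cmod (\<Sum>j. coeff h (j + k)) \<le> (\<Sum>j. C * r ^ k * r ^ j)"
      by (rule norm_suminf_le[OF bd geo])
    also have "\<dots> = C * r ^ k * (1 / (1 - r))"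
      using r by (simp add: suminf_mult suminf_geometric)
    finally have "2 * cmod (\<Sum>j. coeff h (j + k)) \<le> 2 * (C * r ^ k * (1 / (1 - r)))" by simp
    then show ?thesis by (simp add: a_def norm_mult mult_ac)
  qed
  then have "summable (\<lambda>n. (cmod (a n))\<^sup>2)" using r geometric_ell2 by blast
  then have c: "coeff (Abs_ell2 a) = a" by (rule coeff_Abs_ell2)
  have diff: "a n - a (Suc n) = 2 * coeff h n" for n
  proof -
    have "(\<Sum>j. coeff h (j + n)) = coeff h n + (\<Sum>j. coeff h (j + Suc n))"
      using suminf_split_head[OF sm[of n]] by simp
    then show ?thesis unfolding a_def by simp
  qed
  have "ip (Abs_ell2 a) (half.mult_op g) = ip h g" for g
  proof -
    have "(\<lambda>n. coeff (Abs_ell2 a) (Suc n) * cnj (coeff (shift g) (Suc n))) sums ip (Abs_ell2 a) (shift g)"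
      using ip_sums[of "Abs_ell2 a" "shift g"] by (subst sums_Suc_iff) simp
    then have "(\<lambda>n. a n * cnj (coeff g n) - a (Suc n) * cnj (coeff g n)) sums (ip (Abs_ell2 a) g - ip (Abs_ell2 a) (shift g))"
      using ip_sums[of "Abs_ell2 a" g] by (intro sums_diff) (simp_all add: c)
    then have "(\<lambda>n. 2 * (coeff h n * cnj (coeff g n))) sums (ip (Abs_ell2 a) g - ip (Abs_ell2 a) (shift g))"
      unfolding left_diff_distrib[symmetric] diff mult.assoc .
    then have "ip (Abs_ell2 a) g - ip (Abs_ell2 a) (shift g) = 2 * ip h g"
      using sums_mult[OF ip_sums[of h g], of 2] sums_unique2 by blast
    moreover have "ip (Abs_ell2 a) (half.mult_op g) = 1/2 * (ip (Abs_ell2 a) g - ip (Abs_ell2 a) (shift g))"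
      unfolding half_mult by (subst (1 2 3) ip_commute) (simp add: ip_cscale_left ip_diff_left)
    ultimately show ?thesis by simp
  qed
  then have "inner h g = inner (Abs_ell2 a) (half.mult_op g)" for g by (simp add: inner_ip)
  then show ?thesis by (rule that)
qed

lemma AE_boundary_half: "AE w in \<sigma>. boundary half_symbol w = (1 - w) / 2"
  using half.AE_boundary_symbol AE_circle_norm
proof eventually_elim
  case (elim w)
  have "((\<lambda>r. (1 - of_real r * w) / 2) \<longlongrightarrow> (1 - of_real 1 * w) / 2) (at_left 1)"
    by (intro tendsto_intros) auto
  moreover have "eventually (\<lambda>r. r \<in> {0<..<1::real}) (at_left 1)" by (rule eventually_at_left_real) simp
  then have "eventually (\<lambda>r. (1 - of_real r * w) / 2 = half_symbol (of_real r * w)) (at_left 1)"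
    by eventually_elim (use elim in \<open>simp add: half_symbol_def norm_mult\<close>)
  ultimately have "((\<lambda>r. half_symbol (of_real r * w)) \<longlongrightarrow> (1 - of_real 1 * w) / 2) (at_left 1)"
    by (rule Lim_transform_eventually)
  from tendsto_unique[OF _ elim(1) this] show ?case by simp
qed

section \<open>A Blaschke product with geometric zeros\<close>

definition gap :: "nat \<Rightarrow> real" where
  "gap m = (1/16) ^ m"

lemma gap_bounds: "0 < gap m" "gap m \<le> 1"
  by (simp_all add: gap_def power_le_one)

lemma gap_summable: "summable gap"
  unfolding gap_def[abs_def] by (rule summable_geometric) simp

text \<open>With zeros on the nonnegative radius this sign is the normalisation under which the
  factors tend to 1. Since \<open>gap 0 = 1\<close>, the first zero is 0 and the first factor is
  -z.\<close>

definition blaschke_factor :: "nat \<Rightarrow> complex \<Rightarrow> complex" where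
  "blaschke_factor m z = (of_real (1 - gap m) - z) / (1 - of_real (1 - gap m) * z)"

lemma blaschke_denominator:
  assumes "cmod z \<le> 1"
  shows "gap m \<le> cmod (1 - of_real (1 - gap m) * z)"
    and "cmod (1 - z) \<le> 2 * cmod (1 - of_real (1 - gap m) * z)"
proof -
  let ?w = "1 - gap m"
  have w: "0 \<le> ?w" using gap_bounds[of m] by simp
  have "cmod (of_real ?w * z) \<le> ?w" unfolding norm_mult norm_of_real using w assms by (simp add: mult_left_le)
  then show le: "gap m \<le> cmod (1 - of_real ?w * z)"
    using norm_triangle_ineq2[of 1 "of_real ?w * z"] by (simp del: of_real_diff)
  have "1 - z = (1 - of_real ?w * z) - of_real (gap m) * z" by (simp add: algebra_simps)
  then have "cmod (1 - z) \<le> cmod (1 - of_real ?w * z) + cmod (of_real (gap m) * z)" by (metis norm_triangle_ineq4)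
  also have "cmod (of_real (gap m) * z) \<le> gap m"
    unfolding norm_mult norm_of_real using gap_bounds[of m] assms by (simp add: mult_left_le)
  finally show "cmod (1 - z) \<le> 2 * cmod (1 - of_real ?w * z)" using le by linarith
qed

lemma blaschke_denominator_nonzero: "cmod z \<le> 1 \<Longrightarrow> 1 - of_real (1 - gap m) * z \<noteq> 0"
  using blaschke_denominator(1)[of z m] gap_bounds[of m] by (auto simp del: of_real_diff)

text \<open>The numerator of the difference is exactly \<open>- gap m\<close> times 1 + z, and the
  denominator stays comparable with |1 - z|; hence summability in m away from 1.\<close>

lemma blaschke_factor_deviation:
  assumes "cmod z \<le> 1" "z \<noteq> 1"
  shows "cmod (blaschke_factor m z - 1) \<le> 4 / cmod (1 - z) * gap m"
proof -
  let ?d = "1 - of_real (1 - gap m) * z"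
  have "blaschke_factor m z - 1 = - of_real (gap m) * (1 + z) / ?d"
    using blaschke_denominator_nonzero[OF assms(1), of m] by (simp add: blaschke_factor_def field_simps)
  then have "cmod (blaschke_factor m z - 1) = gap m * cmod (1 + z) / cmod ?d"
    using gap_bounds[of m] by (simp add: norm_mult norm_divide del: of_real_diff)
  also have "\<dots> \<le> gap m * 2 / (cmod (1 - z) / 2)"
  proof (intro frac_le mult_left_mono)
    show "cmod (1 + z) \<le> 2" using norm_triangle_ineq[of 1 z] assms by simp
    show "cmod (1 - z) / 2 \<le> cmod ?d" using blaschke_denominator(2)[OF assms(1), of m] by simp
  qed (use gap_bounds[of m] assms in auto)
  finally show ?thesis by (simp add: mult_ac)
qed

lemma blaschke_identity:
  "(cmod (1 - of_real (1 - gap m) * z))\<^sup>2 - (cmod (of_real (1 - gap m) - z))\<^sup>2 = (1 - (1 - gap m)\<^sup>2) * (1 - (cmod z)\<^sup>2)"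
  unfolding cmod_power2 by (simp add: power2_eq_square algebra_simps)

lemma blaschke_factor_le: assumes "cmod z \<le> 1" shows "cmod (blaschke_factor m z) \<le> 1"
proof -
  have "0 \<le> (1 - (1 - gap m)\<^sup>2) * (1 - (cmod z)\<^sup>2)"
    using gap_bounds[of m] assms by (intro mult_nonneg_nonneg) (auto simp: power_le_one)
  then have "(cmod (of_real (1 - gap m) - z))\<^sup>2 \<le> (cmod (1 - of_real (1 - gap m) * z))\<^sup>2"
    using blaschke_identity[of m z] by linarith
  then have "cmod (of_real (1 - gap m) - z) \<le> cmod (1 - of_real (1 - gap m) * z)"
    by (rule power2_le_imp_le) simp
  then show ?thesis by (simp add: blaschke_factor_def norm_divide divide_le_eq_1 del: of_real_diff)
qed

lemma blaschke_factor_circle: assumes "cmod z = 1" shows "cmod (blaschke_factor m z) = 1"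
proof -
  have "(cmod (of_real (1 - gap m) - z))\<^sup>2 = (cmod (1 - of_real (1 - gap m) * z))\<^sup>2"
    using blaschke_identity[of m z] assms by simp
  then have "cmod (of_real (1 - gap m) - z) = cmod (1 - of_real (1 - gap m) * z)" by simp
  then show ?thesis using blaschke_denominator_nonzero[of z m] assms
    by (simp add: blaschke_factor_def norm_divide del: of_real_diff)
qed

lemma blaschke_factor_holomorphic: "blaschke_factor m holomorphic_on ball 0 1"
  unfolding blaschke_factor_def[abs_def]
proof (intro holomorphic_intros)
  show "1 - complex_of_real (1 - gap m) * z \<noteq> 0" if "z \<in> ball 0 1" for z
    using that by (intro blaschke_denominator_nonzero) simp
qed

lemma blaschke_factor_continuous: "continuous_on (cball 0 1) (blaschke_factor m)"
  unfolding blaschke_factor_def[abs_def]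
proof (intro continuous_intros ballI)
  show "1 - complex_of_real (1 - gap m) * z \<noteq> 0" if "z \<in> cball 0 1" for z
    using that by (intro blaschke_denominator_nonzero) simp
qed

text \<open>Meant for the closed disk without 1: at 1 every factor equals -1 and the partial
  products oscillate.\<close>

definition blaschke :: "complex \<Rightarrow> complex" where
  "blaschke z = lim (\<lambda>N. \<Prod>m<N. blaschke_factor m z)"

text \<open>Removing a neighbourhood of 1 gives a compact set including circle points, on which the
  deviations of the factors from 1 are dominated by \<open>4 / \<delta> * gap m\<close>.\<close>

lemma blaschke_uniform:
  assumes "\<delta> > 0"
  shows "uniform_limit {z. cmod z \<le> 1 \<and> \<delta> \<le> cmod (1 - z)} (\<lambda>N z. \<Prod>m<N. blaschke_factor m z) blaschke sequentially"
proof -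
  let ?K = "{z. cmod z \<le> 1 \<and> \<delta> \<le> cmod (1 - z)}"
  have K: "?K = cball 0 1 \<inter> {z. \<delta> \<le> cmod (1 - z)}" by auto
  have "closed {z. \<delta> \<le> cmod (1 - z)}" by (intro closed_Collect_le continuous_intros)
  then have comp: "compact ?K" unfolding K by (intro compact_Int_closed) auto
  have "uniformly_convergent_on ?K (\<lambda>N z. \<Prod>m<N. blaschke_factor m z)"
  proof (rule Infinite_Products.uniformly_convergent_on_prod'[OF _ comp])
    show "continuous_on ?K (blaschke_factor m)" for m
      by (rule continuous_on_subset[OF blaschke_factor_continuous]) auto
    show "uniformly_convergent_on ?K (\<lambda>N z. \<Sum>m<N. norm (blaschke_factor m z - 1))"
    proof (rule Weierstrass_m_test')
      show "summable (\<lambda>m. 4 / \<delta> * gap m)" by (rule summable_mult[OF gap_summable])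
      fix m z assume z: "z \<in> ?K"
      then have "z \<noteq> 1" using assms by auto
      have "norm (norm (blaschke_factor m z - 1)) \<le> 4 / cmod (1 - z) * gap m"
        using blaschke_factor_deviation[of z m] z \<open>z \<noteq> 1\<close> by simp
      also have "\<dots> \<le> 4 / \<delta> * gap m"
        using z assms gap_bounds[of m] by (intro mult_right_mono divide_left_mono) (auto intro!: mult_pos_pos)
      finally show "norm (norm (blaschke_factor m z - 1)) \<le> 4 / \<delta> * gap m" .
    qed
  qed
  then show ?thesis unfolding blaschke_def by (rule uniformly_convergent_uniform_limit_iff[THEN iffD1])
qed

lemma blaschke_tendsto:
  assumes "cmod z \<le> 1" "z \<noteq> 1" shows "(\<lambda>N. \<Prod>m<N. blaschke_factor m z) \<longlonglongrightarrow> blaschke z"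
  by (rule tendsto_uniform_limitI[OF blaschke_uniform[of "cmod (1 - z)"]]) (use assms in auto)

lemma blaschke_holomorphic: "blaschke holomorphic_on ball 0 1"
proof (rule holomorphic_uniform_sequence[OF open_ball])
  show "(\<lambda>z. \<Prod>m<N. blaschke_factor m z) holomorphic_on ball 0 1" for N
    by (intro holomorphic_intros blaschke_factor_holomorphic)
  fix z :: complex assume z: "z \<in> ball 0 1"
  define d where "d = (1 - cmod z) / 2"
  have d: "0 < d" using z by (simp add: d_def)
  have sub: "cmod u \<le> 1 - d" if "u \<in> cball z d" for u
  proof -
    have "cmod u \<le> cmod z + cmod (u - z)" using norm_triangle_ineq[of z "u - z"] by simp
    also have "cmod (u - z) \<le> d" using that by (simp add: dist_norm norm_minus_commute)
    finally show ?thesis by (simp add: d_def field_simps)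
  qed
  have "uniform_limit (cball z d) (\<lambda>N z. \<Prod>m<N. blaschke_factor m z) blaschke sequentially"
  proof (rule uniform_limit_on_subset[OF blaschke_uniform[OF d]], safe)
    fix u assume u: "u \<in> cball z d"
    show "cmod u \<le> 1" using sub[OF u] d by simp
    show "d \<le> cmod (1 - u)" using sub[OF u] norm_triangle_ineq2[of 1 u] by simp
  qed
  moreover have "cball z d \<subseteq> ball 0 1" using sub d by fastforce
  ultimately show "\<exists>d>0. cball z d \<subseteq> ball 0 1 \<and> uniform_limit (cball z d) (\<lambda>N z. \<Prod>m<N. blaschke_factor m z) blaschke sequentially"
    using d by blast
qed

lemma blaschke_le: assumes "cmod z < 1" shows "cmod (blaschke z) \<le> 1"
proof (rule tendsto_upperbound[OF tendsto_norm[OF blaschke_tendsto]])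
  show "\<forall>\<^sub>F N in sequentially. cmod (\<Prod>m<N. blaschke_factor m z) \<le> 1"
    unfolding prod_norm[symmetric]
    by (intro always_eventually allI prod_le_1) (use assms blaschke_factor_le in auto)
qed (use assms in auto)

lemma blaschke_zero: "blaschke (of_real (1 - gap m)) = 0"
proof -
  let ?w = "of_real (1 - gap m) :: complex"
  have w: "cmod ?w \<le> 1" unfolding norm_of_real using gap_bounds[of m] by simp
  have "?w \<noteq> 1" using gap_bounds[of m] by simp
  from blaschke_tendsto[OF w this] have "(\<lambda>N. \<Prod>m<N. blaschke_factor m ?w) \<longlonglongrightarrow> blaschke ?w" .
  moreover have "(\<lambda>N. \<Prod>m<N. blaschke_factor m ?w) \<longlonglongrightarrow> 0"
  proof (rule tendsto_eventually)
    have "(\<Prod>m<N. blaschke_factor m ?w) = 0" if "N > m" for N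
    proof (rule prod_zero)
      show "\<exists>i\<in>{..<N}. blaschke_factor i ?w = 0" using that by (intro bexI[of _ m]) (auto simp: blaschke_factor_def)
    qed simp
    then show "\<forall>\<^sub>F N in sequentially. (\<Prod>m<N. blaschke_factor m ?w) = 0"
      unfolding eventually_sequentially by (intro exI[of _ "Suc m"]) auto
  qed
  ultimately show ?thesis by (rule LIMSEQ_unique)
qed

lemma blaschke_real: assumes "0 \<le> y" "y < 1" shows "blaschke (of_real y) \<in> \<real>"
proof (rule Lim_in_closed_set[OF closed_complex_Reals])
  have "blaschke_factor m (of_real y) \<in> \<real>" for m
    by (auto simp: blaschke_factor_def intro!: Reals_divide Reals_diff Reals_mult)
  then show "\<forall>\<^sub>F N in sequentially. (\<Prod>m<N. blaschke_factor m (of_real y)) \<in> \<real>"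
    by (intro always_eventually allI prod_in_Reals) auto
  show "(\<lambda>N. \<Prod>m<N. blaschke_factor m (of_real y)) \<longlonglongrightarrow> blaschke (of_real y)"
    by (rule blaschke_tendsto) (use assms in auto)
qed simp

text \<open>The radius to \<open>w\<close> keeps distance at least |1 - w| / 2 from 1, and there
  \<open>blaschke\<close> is a uniform limit of functions continuous up to the circle. At
  \<open>w\<close> itself all partial products have modulus 1.\<close>

lemma blaschke_radial:
  assumes w: "cmod w = 1" "w \<noteq> 1"
  shows "((\<lambda>r. blaschke (of_real r * w)) \<longlongrightarrow> blaschke w) (at_left 1)" and "cmod (blaschke w) = 1"
proof -
  define \<delta> where "\<delta> = cmod (1 - w) / 2"
  have \<delta>: "\<delta> > 0" using w by (simp add: \<delta>_def)
  let ?K = "{z. cmod z \<le> 1 \<and> \<delta> \<le> cmod (1 - z)}"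
  have cont: "continuous_on ?K blaschke"
  proof (rule uniform_limit_theorem[OF _ blaschke_uniform[OF \<delta>]])
    show "\<forall>\<^sub>F N in sequentially. continuous_on ?K (\<lambda>z. \<Prod>m<N. blaschke_factor m z)"
      by (intro always_eventually allI continuous_intros continuous_on_subset[OF blaschke_factor_continuous]) auto
  qed simp
  have sub: "of_real r * w \<in> ?K" if "0 \<le> r" "r \<le> 1" for r
  proof -
    have n: "cmod (of_real r * w) = r" using that w by (simp add: norm_mult)
    have "1 - w = (1 - of_real r * w) - of_real (1 - r) * w" by (simp add: algebra_simps)
    then have "cmod (1 - w) \<le> cmod (1 - of_real r * w) + cmod (of_real (1 - r) * w)" by (metis norm_triangle_ineq4)
    also have "cmod (of_real (1 - r) * w) = 1 - r" unfolding norm_mult norm_of_real using that w by simp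
    also have "1 - r \<le> cmod (1 - of_real r * w)" using norm_triangle_ineq2[of 1 "of_real r * w"] n by simp
    finally show ?thesis using n that by (simp add: \<delta>_def)
  qed
  have "continuous_on {0..1} (\<lambda>r. blaschke (of_real r * w))"
    by (rule continuous_on_compose2[OF cont]) (use sub in \<open>auto intro!: continuous_intros\<close>)
  from this[unfolded continuous_on_def, rule_format, of 1]
  have "((\<lambda>r. blaschke (of_real r * w)) \<longlongrightarrow> blaschke (of_real 1 * w)) (at 1 within {0..1})" by simp
  moreover have "at 1 within {0..1} = at_left (1::real)" by (rule at_within_Icc_at_left) simp
  ultimately show "((\<lambda>r. blaschke (of_real r * w)) \<longlongrightarrow> blaschke w) (at_left 1)" by simp
  have "(\<lambda>N. cmod (\<Prod>m<N. blaschke_factor m w)) \<longlonglongrightarrow> cmod (blaschke w)"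
    by (intro tendsto_norm blaschke_tendsto) (use w in auto)
  moreover have "cmod (\<Prod>m<N. blaschke_factor m w) = 1" for N
    by (simp add: blaschke_factor_circle[OF w(1)] flip: prod_norm)
  ultimately show "cmod (blaschke w) = 1" using LIMSEQ_unique[OF _ tendsto_const] by simp
qed

lemma sum_below: "(\<Sum>m<n. (1/16 :: real) ^ (n - m)) \<le> 1/15"
proof (induction n)
  case (Suc n)
  have "(\<Sum>m<Suc n. (1/16 :: real) ^ (Suc n - m)) = (\<Sum>m<n. 1/16 * (1/16 :: real) ^ (n - m)) + 1/16"
    by (simp add: Suc_diff_le less_imp_le)
  also have "\<dots> = 1/16 * (\<Sum>m<n. (1/16 :: real) ^ (n - m)) + 1/16" by (simp add: sum_distrib_left)
  also have "\<dots> \<le> 1/16 * (1/15) + 1/16" by (intro add_mono mult_left_mono Suc) auto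
  finally show ?case by simp
qed simp

text \<open>The right side is the exact value of the finite geometric sum; the bare bound 1/15 would
  not carry the induction.\<close>

lemma sum_above: "(\<Sum>m\<in>{n<..n + K}. (1/16 :: real) ^ (m - n)) \<le> 1/15 * (1 - (1/16) ^ K)"
proof (induction K)
  case (Suc K)
  have "{n<..n + Suc K} = insert (n + Suc K) {n<..n + K}" by auto
  then show ?case using Suc by simp
qed simp

text \<open>At \<open>1 - \<eta>\<close> the factor of index k has modulus at least
  \<open>\<bar>\<eta> - gap k\<bar> / (gap k + \<eta>)\<close>. The quotient of the smaller of
  \<open>gap k\<close> and \<open>\<eta>\<close> by the larger enters with factor 2: for k < n this
  gives 2 times 3 from the upper bound on \<open>\<eta>\<close>, for k > n only 2, and 6 serves
  both.\<close>

lemma blaschke_factor_near: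
  assumes \<eta>: "1.9 * gap n \<le> \<eta>" "\<eta> \<le> 3 * gap n" "\<eta> < 1"
  shows "m < n \<Longrightarrow> 1 - 6 * (1/16) ^ (n - m) \<le> cmod (blaschke_factor m (of_real (1 - \<eta>)))"
    and "n < m \<Longrightarrow> 1 - 6 * (1/16) ^ (m - n) \<le> cmod (blaschke_factor m (of_real (1 - \<eta>)))"
    and "3 / 10 \<le> cmod (blaschke_factor n (of_real (1 - \<eta>)))"
proof -
  have gn: "0 < gap n" "gap n \<le> 1" by (rule gap_bounds)+
  have \<eta>0: "0 < \<eta>" using \<eta> gn by simp
  have val: "\<bar>\<eta> - gap k\<bar> / (gap k + \<eta>) \<le> cmod (blaschke_factor k (of_real (1 - \<eta>)))" for k
  proof -
    have g: "0 < gap k" "gap k \<le> 1" by (rule gap_bounds)+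
    have den: "0 < gap k + \<eta> - gap k * \<eta>"
      using mult_left_le[of \<eta> "gap k"] g \<eta>0 \<open>\<eta> < 1\<close> by linarith
    have "blaschke_factor k (of_real (1 - \<eta>)) = of_real ((\<eta> - gap k) / (gap k + \<eta> - gap k * \<eta>))"
      by (simp add: blaschke_factor_def algebra_simps)
    then have "cmod (blaschke_factor k (of_real (1 - \<eta>))) = \<bar>\<eta> - gap k\<bar> / (gap k + \<eta> - gap k * \<eta>)"
      unfolding norm_of_real[symmetric, where 'a = complex] using den by (simp add: norm_divide abs_divide flip: of_real_diff of_real_add of_real_mult)
    then show ?thesis using den g \<eta>0 by (simp add: frac_le)
  qed
  show "1 - 6 * (1/16) ^ (n - m) \<le> cmod (blaschke_factor m (of_real (1 - \<eta>)))" if "m < n"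
  proof -
    have "gap n = gap m * (1/16) ^ (n - m)" using that by (simp add: gap_def flip: power_add)
    moreover have "(gap m - \<eta>) / (gap m + \<eta>) \<ge> 1 - 2 * \<eta> / gap m"
      using gap_bounds[of m] \<eta>0 by (simp add: field_simps)
    moreover have "2 * \<eta> / gap m \<le> 6 * (gap n / gap m)"
      using \<eta> gap_bounds[of m] by (simp add: field_simps)
    moreover have "(gap m - \<eta>) / (gap m + \<eta>) \<le> \<bar>\<eta> - gap m\<bar> / (gap m + \<eta>)"
      using gap_bounds[of m] \<eta>0 by (intro divide_right_mono) auto
    ultimately show ?thesis using val[of m] gap_bounds[of m] by simp
  qed
  show "1 - 6 * (1/16) ^ (m - n) \<le> cmod (blaschke_factor m (of_real (1 - \<eta>)))" if "n < m"
  proof -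
    have "gap m = gap n * (1/16) ^ (m - n)" using that by (simp add: gap_def flip: power_add)
    then have "2 * gap m / gap n = 2 * (1/16) ^ (m - n)" using gn by simp
    moreover have "(\<eta> - gap m) / (gap m + \<eta>) \<ge> 1 - 2 * gap m / \<eta>"
      using gap_bounds[of m] \<eta>0 by (simp add: field_simps)
    moreover have "2 * gap m / \<eta> \<le> 2 * gap m / gap n"
      using \<eta> gap_bounds[of m] gn by (intro divide_left_mono) auto
    moreover have "(\<eta> - gap m) / (gap m + \<eta>) \<le> \<bar>\<eta> - gap m\<bar> / (gap m + \<eta>)"
      using gap_bounds[of m] \<eta>0 by (intro divide_right_mono) auto
    moreover have "0 \<le> (1/16 :: real) ^ (m - n)" by simp
    ultimately show ?thesis using val[of m] by linarith
  qed
  \<comment> \<open>The worst case is \<open>\<eta> = 1.9 * gap n\<close>, where the quotient is 0.9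
    / 2.9.\<close>
  have "3 / 10 \<le> (\<eta> - gap n) / (gap n + \<eta>)" using \<eta> gn \<eta>0 by (simp add: field_simps)
  also have "\<dots> \<le> \<bar>\<eta> - gap n\<bar> / (gap n + \<eta>)" using gn \<eta>0 by (intro divide_right_mono) auto
  finally show "3 / 10 \<le> cmod (blaschke_factor n (of_real (1 - \<eta>)))" using val[of n] by linarith
qed

text \<open>The deficits of all factors other than the n-th sum to at most 6/15 + 6/15 = 4/5, so by
  Weierstrass' inequality their product is at least 1/5; the n-th factor contributes 3/10. In this
  estimate a ratio q of consecutive gaps costs 12 q / (1 - q), which is below 1 exactly when q <
  1/13, and 1/16 qualifies.\<close>

lemma blaschke_lower:
  assumes \<eta>: "1.9 * gap n \<le> \<eta>" "\<eta> \<le> 3 * gap n" "\<eta> < 1"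
  shows "3 / 50 \<le> cmod (blaschke (of_real (1 - \<eta>)))"
proof (rule tendsto_lowerbound[OF tendsto_norm[OF blaschke_tendsto]])
  let ?y = "of_real (1 - \<eta>) :: complex"
  have \<eta>0: "0 < \<eta>" using \<eta> gap_bounds[of n] by simp
  show "cmod ?y \<le> 1" unfolding norm_of_real using \<eta>0 \<eta> by simp
  show "?y \<noteq> 1" using \<eta>0 by simp
  have y1: "cmod ?y \<le> 1" unfolding norm_of_real using \<eta>0 \<eta> by simp
  have "3 / 50 \<le> cmod (\<Prod>m<N. blaschke_factor m ?y)" if "N > n" for N
  proof -
    obtain K where K: "N = n + K + 1" using \<open>N > n\<close> less_iff_Suc_add by auto
    define S where "S = {..<N} - {n}"
    have S: "S = {..<n} \<union> {n<..n + K}" using K by (auto simp: S_def)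
    define x where "x m = 1 - cmod (blaschke_factor m ?y)" for m
    have x01: "x m \<in> {0..1}" for m using blaschke_factor_le[OF y1, of m] by (simp add: x_def)
    have "sum x S = (\<Sum>m<n. x m) + (\<Sum>m\<in>{n<..n + K}. x m)"
      unfolding S by (rule sum.union_disjoint) auto
    also have "(\<Sum>m<n. x m) \<le> (\<Sum>m<n. 6 * (1/16) ^ (n - m))"
      using blaschke_factor_near(1)[OF \<eta>] unfolding x_def by (intro sum_mono) (simp add: algebra_simps)
    also have "(\<Sum>m\<in>{n<..n + K}. x m) \<le> (\<Sum>m\<in>{n<..n + K}. 6 * (1/16) ^ (m - n))"
      using blaschke_factor_near(2)[OF \<eta>] unfolding x_def by (intro sum_mono) (simp add: algebra_simps)
    also have "(\<Sum>m<n. 6 * (1/16 :: real) ^ (n - m)) + (\<Sum>m\<in>{n<..n + K}. 6 * (1/16) ^ (m - n)) \<le> 6 * (1/15) + 6 * (1/15)"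
    proof -
      have "1/15 * (1 - (1/16) ^ K) \<le> (1/15 :: real)" by simp
      then have "(\<Sum>m\<in>{n<..n + K}. (1/16 :: real) ^ (m - n)) \<le> 1/15" by (rule order_trans[OF sum_above])
      then show ?thesis using sum_below[of n] unfolding sum_distrib_left[symmetric] by linarith
    qed
    finally have "1 - sum x S \<ge> 1/5" by simp
    moreover have "1 - sum x S \<le> (\<Prod>m\<in>S. 1 - x m)" by (rule Weierstrass_prod_ineq) (rule x01)
    ultimately have "1/5 \<le> (\<Prod>m\<in>S. cmod (blaschke_factor m ?y))" by (simp add: x_def)
    then have "3 / 10 * (1/5) \<le> cmod (blaschke_factor n ?y) * (\<Prod>m\<in>S. cmod (blaschke_factor m ?y))"
      using blaschke_factor_near(3)[OF \<eta>] by (intro mult_mono) auto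
    also have "\<dots> = (\<Prod>m<N. cmod (blaschke_factor m ?y))"
      unfolding S_def by (rule prod.remove[symmetric]) (use \<open>N > n\<close> in auto)
    finally show ?thesis by (simp add: prod_norm)
  qed
  then show "\<forall>\<^sub>F N in sequentially. 3 / 50 \<le> cmod (\<Prod>m<N. blaschke_factor m ?y)"
    unfolding eventually_sequentially by (intro exI[of _ "Suc n"]) auto
qed simp

section \<open>The counterexample\<close>

definition main_symbol :: "complex \<Rightarrow> complex" where
  "main_symbol z = (if cmod z < 1 then (1 + z) / 2 * (blaschke z)\<^sup>2 else 0)"

lemma main_symbol_le: "cmod (main_symbol z) \<le> cmod (1 + z) / 2"
proof (cases "cmod z < 1")
  case True
  have "(cmod (blaschke z))\<^sup>2 \<le> 1" using blaschke_le[OF True] by (simp add: power_le_one)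
  then have "cmod (1 + z) / 2 * (cmod (blaschke z))\<^sup>2 \<le> cmod (1 + z) / 2 * 1" by (intro mult_left_mono) auto
  then show ?thesis using True by (simp add: main_symbol_def norm_mult norm_power norm_divide)
qed (simp add: main_symbol_def)

lemma main_symbol_holomorphic: "main_symbol \<in> disk_holomorphic"
proof -
  have "main_symbol holomorphic_on ball 0 1 \<longleftrightarrow> (\<lambda>z. (1 + z) / 2 * (blaschke z)\<^sup>2) holomorphic_on ball 0 1"
    by (rule holomorphic_cong) (auto simp: main_symbol_def)
  then have "main_symbol holomorphic_on ball 0 1" by (auto intro!: holomorphic_intros blaschke_holomorphic)
  then show ?thesis by (simp add: disk_holomorphic_def main_symbol_def)
qed

interpretation main: schur main_symbol
proof
  show "main_symbol \<in> disk_holomorphic" by (rule main_symbol_holomorphic)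
  fix z
  show "cmod (main_symbol z) \<le> 1"
  proof (cases "cmod z < 1")
    case True
    then show ?thesis using main_symbol_le[of z] norm_triangle_ineq[of 1 z] by simp
  qed (simp add: main_symbol_def)
qed

lemma cmod_sum_squares: "(cmod (1 - z))\<^sup>2 + (cmod (1 + z))\<^sup>2 = 2 * (1 + (cmod z)\<^sup>2)"
  unfolding cmod_power2 by (simp add: power2_eq_square algebra_simps)

text \<open>The squared Blaschke product is unimodular almost everywhere on the circle, so the
  boundary modulus, and with it the mate, is that of the linear factor alone.\<close>

lemma AE_boundary_main: "AE w in \<sigma>. cmod (boundary main_symbol w) = cmod (1 + w) / 2"
  using main.AE_boundary_symbol AE_circle_norm AE_circle_neq_1
proof eventually_elim
  case (elim w)
  have "((\<lambda>r. (1 + of_real r * w) / 2 * (blaschke (of_real r * w))\<^sup>2) \<longlongrightarrow> (1 + of_real 1 * w) / 2 * (blaschke w)\<^sup>2) (at_left 1)"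
    by (intro tendsto_intros blaschke_radial(1) elim) auto
  moreover have "eventually (\<lambda>r. r \<in> {0<..<1::real}) (at_left 1)" by (rule eventually_at_left_real) simp
  then have "eventually (\<lambda>r. (1 + of_real r * w) / 2 * (blaschke (of_real r * w))\<^sup>2 = main_symbol (of_real r * w)) (at_left 1)"
    by eventually_elim (use elim in \<open>simp add: main_symbol_def norm_mult\<close>)
  ultimately have "((\<lambda>r. main_symbol (of_real r * w)) \<longlongrightarrow> (1 + of_real 1 * w) / 2 * (blaschke w)\<^sup>2) (at_left 1)"
    by (rule Lim_transform_eventually)
  from tendsto_unique[OF _ elim(1) this]
  have eq: "boundary main_symbol w = (1 + w) / 2 * (blaschke w)\<^sup>2" by simp
  show ?case unfolding eq using blaschke_radial(2)[OF elim(2,3)] by (simp add: norm_mult norm_power norm_divide)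
qed

interpretation pair: schur_pair half_symbol main_symbol
proof
  show "AE w in \<sigma>. (cmod (boundary half_symbol w))\<^sup>2 + (cmod (boundary main_symbol w))\<^sup>2 = 1"
    using AE_boundary_half AE_boundary_main AE_circle_norm
  proof eventually_elim
    case (elim w)
    have "(cmod (boundary half_symbol w))\<^sup>2 + (cmod (boundary main_symbol w))\<^sup>2 = ((cmod (1 - w))\<^sup>2 + (cmod (1 + w))\<^sup>2) / 4"
      unfolding elim by (simp add: norm_divide power_divide)
    also have "\<dots> = 1" unfolding cmod_sum_squares using elim by simp
    finally show ?case .
  qed
  show "half_symbol z \<noteq> 0" if "cmod z < 1" for z using that by (auto simp: half_symbol_def)
qed

lemma Hinf_unit_ballI:
  assumes "f \<in> disk_holomorphic" "\<And>z. cmod z < 1 \<Longrightarrow> cmod (f z) \<le> 1"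
  shows "f \<in> Hinf_unit_ball"
proof -
  have "bounded (f ` ball 0 1)" by (rule boundedI[where B = 1]) (auto simp: assms(2))
  moreover have "Hinf_norm f \<le> 1" unfolding Hinf_norm_def by (rule cSUP_least) (auto simp: assms(2))
  ultimately show ?thesis using assms(1) by (simp add: Hinf_unit_ball_def Hinf_def)
qed

lemma main_symbol_unit_ball: "main_symbol \<in> Hinf_unit_ball"
  by (rule Hinf_unit_ballI[OF main_symbol_holomorphic main.bound])

text \<open>
  With \<open>a = (1 - z) / 2\<close>, both \<open>main_symbol \<plusminus> a\<^sup>2 / 2\<close> lie in the unit ball,
  since \<open>\<bar>main_symbol\<bar>\<^sup>2 \<le> 1 - \<bar>a\<bar>\<^sup>2\<close>.
\<close>

lemma main_symbol_not_extreme: "\<not> extreme_in main_symbol Hinf_unit_ball"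
proof -
  define p where "p z = (half_symbol z)\<^sup>2 / 2" for z
  have sum_le: "cmod (main_symbol z) + cmod (p z) \<le> 1" if z: "cmod z < 1" for z
  proof -
    let ?q = "cmod (1 - z) / 2" and ?s = "cmod (1 + z) / 2"
    have "?q\<^sup>2 + ?s\<^sup>2 = (1 + (cmod z)\<^sup>2) / 2" using cmod_sum_squares[of z] by (simp add: power_divide field_simps)
    also have "\<dots> \<le> 1" using z by (simp add: power_le_one)
    finally have "?s\<^sup>2 \<le> 1 - ?q\<^sup>2" by simp
    \<comment> \<open>Removes the square root: 1 - s <= (1 - s / 2)^2, applied with s =
      |a|^2.\<close>
    also have "\<dots> \<le> (1 - ?q\<^sup>2 / 2)\<^sup>2" by (simp add: power2_diff)
    finally have sq: "?s\<^sup>2 \<le> (1 - ?q\<^sup>2 / 2)\<^sup>2" .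
    have "?q \<le> 1" using norm_triangle_ineq4[of 1 z] z by simp
    then have "?q\<^sup>2 \<le> 1" by (simp add: power_le_one)
    then have "?s \<le> 1 - ?q\<^sup>2 / 2" by (intro power2_le_imp_le[OF sq]) simp
    moreover have "cmod (p z) = ?q\<^sup>2 / 2" using z by (simp add: p_def half_symbol_def norm_divide norm_power)
    ultimately show ?thesis using main_symbol_le[of z] by simp
  qed
  have "(\<lambda>z. main_symbol z + p z) \<in> Hinf_unit_ball"
  proof (rule Hinf_unit_ballI)
    show "(\<lambda>z. main_symbol z + p z) \<in> disk_holomorphic"
      unfolding p_def using half.holomorphic main.holomorphic
      by (auto intro!: holomorphic_intros simp: disk_holomorphic_def)
    show "cmod (main_symbol z + p z) \<le> 1" if "cmod z < 1" for z
      using sum_le[OF that] norm_triangle_ineq[of "main_symbol z" "p z"] by linarith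
  qed
  moreover have "(\<lambda>z. main_symbol z - p z) \<in> Hinf_unit_ball"
  proof (rule Hinf_unit_ballI)
    show "(\<lambda>z. main_symbol z - p z) \<in> disk_holomorphic"
      unfolding p_def using half.holomorphic main.holomorphic
      by (auto intro!: holomorphic_intros simp: disk_holomorphic_def)
    show "cmod (main_symbol z - p z) \<le> 1" if "cmod z < 1" for z
      using sum_le[OF that] norm_triangle_ineq4[of "main_symbol z" "p z"] by linarith
  qed
  moreover have "(\<lambda>z. main_symbol z + p z) \<noteq> (\<lambda>z. main_symbol z - p z)"
  proof
    assume "(\<lambda>z. main_symbol z + p z) = (\<lambda>z. main_symbol z - p z)"
    then have "main_symbol 0 + p 0 = main_symbol 0 - p 0" by (rule fun_cong)
    then show False by (simp add: p_def half_symbol_def)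
  qed
  moreover have "main_symbol = (\<lambda>z. complex_of_real (1 - 1/2) * (main_symbol z + p z) + complex_of_real (1/2) * (main_symbol z - p z))"
    by (auto simp: field_simps)
  moreover have "0 < (1/2 :: real)" "(1/2 :: real) < 1" by simp_all
  ultimately show ?thesis unfolding extreme_in_def by blast
qed

section \<open>The function f and its membership in H(b)\<close>

definition main_vector :: ell2 where
  "main_vector = (\<Sum>m. gap m *\<^sub>R kern (1 - gap m))"

text \<open>The reproducing property, term by term. The kernel at 1 - \<open>gap m\<close> has
  squared norm at most \<open>1 / gap m\<close>, so the m-th summand has norm at most sqrt
  (\<open>gap m\<close>) = 4^(-m) and the series converges absolutely.\<close>

lemma inner_main_vector:
  "(\<lambda>m. gap m * Re (ell2_fun x (of_real (1 - gap m)))) sums inner main_vector x"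
proof -
  have w: "0 \<le> 1 - gap m" "1 - gap m < 1" for m using gap_bounds[of m] by auto
  have "summable (\<lambda>m. norm (gap m *\<^sub>R kern (1 - gap m)))"
  proof (rule summable_comparison_test'[where N = 0])
    show "summable (\<lambda>m. (1/4 :: real) ^ m)" by simp
    fix m
    have "(norm (gap m *\<^sub>R kern (1 - gap m)))\<^sup>2 = (gap m)\<^sup>2 / (1 - (1 - gap m)\<^sup>2)"
      using norm_kern[OF w[of m]] by (simp add: power_mult_distrib)
    also have "\<dots> \<le> (gap m)\<^sup>2 / gap m"
      using gap_bounds[of m] mult_left_le[of "gap m" "gap m"]
      by (intro divide_left_mono mult_pos_pos) (auto simp: power2_eq_square algebra_simps)
    also have "\<dots> = ((1/4) ^ m)\<^sup>2"
    proof -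
      have "(gap m)\<^sup>2 / gap m = gap m" using gap_bounds[of m] by (simp add: power2_eq_square)
      also have "\<dots> = ((1/4) ^ m)\<^sup>2" by (simp add: power2_eq_square gap_def flip: power_mult_distrib)
      finally show ?thesis .
    qed
    finally have "norm (gap m *\<^sub>R kern (1 - gap m)) \<le> (1/4) ^ m" by (rule power2_le_imp_le) simp
    then show "norm (norm (gap m *\<^sub>R kern (1 - gap m))) \<le> (1/4) ^ m" by simp
  qed
  then have "(\<lambda>m. gap m *\<^sub>R kern (1 - gap m)) sums main_vector"
    unfolding main_vector_def by (rule summable_sums[OF summable_norm_cancel])
  from bounded_linear.sums[OF bounded_linear_inner_left this]
  have "(\<lambda>m. inner (gap m *\<^sub>R kern (1 - gap m)) x) sums inner main_vector x" .
  moreover have "inner (gap m *\<^sub>R kern (1 - gap m)) x = gap m * Re (ell2_fun x (of_real (1 - gap m)))" for m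
  proof -
    have "inner (gap m *\<^sub>R kern (1 - gap m)) x = gap m * inner x (kern (1 - gap m))"
      by (simp add: inner_commute)
    then show ?thesis by (simp only: inner_ip ip_kern[OF w])
  qed
  ultimately show ?thesis by (simp only:)
qed

text \<open>Pairing with \<open>main.mult_op x\<close> samples the symbol at its own zeros, so the
  adjoint annihilates the vector. The squared root then fixes it, which exhibits it in the range of
  the root.\<close>

lemma main_vector_Hb: "ell2_fun main_vector \<in> Hb main_symbol"
proof -
  have zero: "main_symbol (of_real (1 - gap m)) = 0" for m
    using blaschke_zero[of m] by (simp add: main_symbol_def del: of_real_diff)
  have "inner main_vector (main.mult_op x) = 0" for x
    using inner_main_vector[of "main.mult_op x"] sums_unique2[OF _ sums_zero]
    by (simp add: main.ell2_fun_mult zero del: of_real_diff)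
  then have "inner (main.adjoint main_vector) (main.adjoint main_vector) = 0" by (simp only: main.inner_adjoint)
  then have "main.adjoint main_vector = 0" by simp
  then have "main.gram main_vector = 0"
    using linear_0[OF main.mult_linear] by (simp add: main.gram_def)
  then have "main.root (main.root main_vector) = main_vector" by (simp add: main.root_root)
  then show ?thesis unfolding pair.Hb_iff by metis
qed

text \<open>Geometric decay of the coefficients puts the mean in the range of the adjoint of
  multiplication by the mate, and that range lies in H(b).\<close>

lemma log_mean_main_Hb: "0 < r \<Longrightarrow> r < 1 \<Longrightarrow> ell2_fun (log_mean_op r x) \<in> Hb main_symbol"
  using log_mean_op_geometric[of r x] half_coanalytic_range[of r "log_mean_op r x"] pair.Hb_member
  by (metis less_imp_le)

text \<open>The test vector is e k_x^2 with x = 1 - e, obtained in H2 as the kernel k_x multiplied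
  by the Schur function e / (1 - x z). Since |1 - z| / 2 <= |1 - x z|, multiplication by the mate
  leaves at most e |k_x| pointwise, and ||e k_x||^2 = e^2 / (1 - x^2) <= e.\<close>

lemma test_vector_exists:
  assumes e: "0 < e" "e \<le> 1"
  obtains g where "\<And>z. cmod z < 1 \<Longrightarrow> ell2_fun g z = of_real e / (1 - of_real (1 - e) * z)\<^sup>2"
    "norm (half.mult_op g) \<le> sqrt e"
proof -
  define x where "x = 1 - e"
  have x: "0 \<le> x" "x < 1" using e by (auto simp: x_def)
  define c where "c z = (if cmod z < 1 then of_real e / (1 - of_real x * z) else 0)" for z
  have den: "e \<le> cmod (1 - of_real x * z)" if "cmod z < 1" for z
  proof -
    have "cmod (of_real x * z) \<le> x" unfolding norm_mult norm_of_real using x that by (simp add: mult_left_le)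
    then show ?thesis using norm_triangle_ineq2[of 1 "of_real x * z"] by (simp add: x_def del: of_real_diff)
  qed
  interpret c: schur c
  proof
    have "c holomorphic_on ball 0 1 \<longleftrightarrow> (\<lambda>z. of_real e / (1 - of_real x * z)) holomorphic_on ball 0 1"
      by (rule holomorphic_cong) (auto simp: c_def)
    moreover have "(\<lambda>z. of_real e / (1 - of_real x * z)) holomorphic_on ball 0 1"
    proof (intro holomorphic_intros)
      show "1 - complex_of_real x * z \<noteq> 0" if "z \<in> ball 0 1" for z
        using den[of z] that e by auto
    qed
    ultimately show "c \<in> disk_holomorphic" by (simp add: disk_holomorphic_def c_def)
    show "cmod (c z) \<le> 1" for z
      using den[of z] e by (auto simp: c_def norm_divide divide_le_eq_1)
  qed
  define g where "g = c.mult_op (kern x)"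
  have g: "ell2_fun g z = of_real e / (1 - of_real x * z)\<^sup>2" if "cmod z < 1" for z
    using that x by (simp add: g_def c.ell2_fun_mult c_def ell2_fun_kern power2_eq_square)
  have "norm (half.mult_op g) \<le> norm (e *\<^sub>R kern x)"
  proof (rule norm_le_pointwise)
    fix z
    show "cmod (ell2_fun (half.mult_op g) z) \<le> cmod (ell2_fun (e *\<^sub>R kern x) z)"
    proof (cases "cmod z < 1")
      case True
      let ?d = "1 - of_real x * z"
      have d: "0 < cmod ?d" using den[OF True] e by linarith
      have "1 - z = ?d - of_real e * z" by (simp add: x_def algebra_simps)
      then have "cmod (1 - z) \<le> cmod ?d + cmod (of_real e * z)" by (metis norm_triangle_ineq4)
      also have "cmod (of_real e * z) \<le> e" unfolding norm_mult norm_of_real using e True by (simp add: mult_left_le)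
      finally have "cmod (1 - z) / 2 \<le> cmod ?d" using den[OF True] by simp
      then have "cmod (1 - z) / 2 * (e / (cmod ?d)\<^sup>2) \<le> cmod ?d * (e / (cmod ?d)\<^sup>2)"
        using e by (intro mult_right_mono) auto
      also have "\<dots> = e / cmod ?d" using d by (simp add: power2_eq_square)
      finally show ?thesis
        using True e x by (simp add: half.ell2_fun_mult half_symbol_def g scaleR_eq_cscale ell2_fun_cscale ell2_fun_kern norm_mult norm_divide norm_power)
    qed (simp add: ell2_fun_outside)
  qed
  also have "\<dots> \<le> sqrt e"
  proof (rule real_le_rsqrt)
    have "(norm (e *\<^sub>R kern x))\<^sup>2 = e\<^sup>2 / (1 - x\<^sup>2)" using norm_kern[OF x] by (simp add: power_mult_distrib)
    also have "\<dots> \<le> e\<^sup>2 / e"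
      using e mult_left_le[of e e] by (intro divide_left_mono mult_pos_pos) (auto simp: x_def power2_eq_square algebra_simps)
    also have "\<dots> = e" using e by (simp add: power2_eq_square)
    finally show "(norm (e *\<^sub>R kern x))\<^sup>2 \<le> e" .
  qed
  finally have n: "norm (half.mult_op g) \<le> sqrt e" .
  show ?thesis by (rule that[OF g[unfolded x_def] n])
qed

text \<open>The Blaschke product is real on the radius, so its square is its squared modulus; this
  is the source of positivity.\<close>

lemma main_symbol_real:
  assumes "0 \<le> y" "y < 1"
  shows "main_symbol (of_real y) = of_real ((1 + y) / 2 * (cmod (blaschke (of_real y)))\<^sup>2)"
proof -
  obtain v where v: "blaschke (of_real y) = of_real v" using blaschke_real[OF assms] Reals_cases by blast
  show ?thesis using assms by (simp add: main_symbol_def v)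
qed

lemma log_mean_norm_lower_bound:
  assumes n: "1 \<le> n" and r: "1 - gap n \<le> r" "r < 1"
  shows "1 / (40000 * sqrt (gap n) * ln (1 / (1 - r))) \<le> Hb_norm main_symbol (log_mean r (ell2_fun main_vector))"
proof -
  define e where "e = gap n"
  \<comment> \<open>From \<open>n \<ge> 1\<close> comes e <= 1/16, which makes e^2 negligible
    against e in the range of \<open>\<eta>\<close> below.\<close>
  have "gap n \<le> gap 1" unfolding gap_def using n by (intro power_decreasing) auto
  then have e: "0 < e" "e \<le> 1/16" using gap_bounds[of n] by (auto simp: e_def gap_def)
  have r0: "0 < r" using r e by (simp add: e_def)
  obtain g where g: "\<And>z. cmod z < 1 \<Longrightarrow> ell2_fun g z = of_real e / (1 - of_real (1 - e) * z)\<^sup>2"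
    and ng: "norm (half.mult_op g) \<le> sqrt e"
    using test_vector_exists[of e] e by auto
  define G where "G = main.mult_op g"
  define v where "v y = (1 + y) / 2 * (cmod (blaschke (of_real y)))\<^sup>2 * (e / (1 - (1 - e) * y)\<^sup>2)" for y :: real
  have G: "ell2_fun G (of_real y) = of_real (v y)" if "0 \<le> y" "y < 1" for y
    using that by (simp add: G_def main.ell2_fun_mult main_symbol_real g v_def)
  have v0: "0 \<le> v y" if "0 \<le> y" for y using that e by (simp add: v_def)
  have D: "(\<lambda>m. gap m * v (t * (1 - gap m))) sums inner main_vector (dilate t G)" if t: "0 \<le> t" "t < 1" for t
  proof -
    have "Re (ell2_fun (dilate t G) (of_real (1 - gap m))) = v (t * (1 - gap m))" for m
    proof -
      have w: "0 \<le> 1 - gap m" "1 - gap m < 1" using gap_bounds[of m] by auto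
      then have tw: "0 \<le> t * (1 - gap m)" "t * (1 - gap m) < 1"
        using t mult_left_le_one_le[of "1 - gap m" t] by auto
      have "cmod (of_real (1 - gap m)) < 1" unfolding norm_of_real using w by simp
      from ell2_fun_dilate[OF t(1) less_imp_le[OF t(2)] this, of G]
      have "ell2_fun (dilate t G) (of_real (1 - gap m)) = ell2_fun G (of_real (t * (1 - gap m)))" by simp
      then show ?thesis using G[OF tw] by simp
    qed
    then show ?thesis using inner_main_vector[of "dilate t G"] by simp
  qed
  have nonneg: "0 \<le> gap m * v (t * (1 - gap m))" if "0 \<le> t" for m t
    using gap_bounds[of m] that by (intro mult_nonneg_nonneg v0) auto
  have D0: "0 \<le> inner main_vector (dilate t G)" if t: "0 \<le> t" "t < 1" for t
    by (rule sums_le[OF _ sums_zero D[OF t]]) (use nonneg t in auto)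
  have Dn: "1/20000 \<le> inner main_vector (dilate t G)" if t: "1 - 2 * e \<le> t" "t \<le> 1 - e" for t
  proof -
    have t01: "0 \<le> t" "t < 1" using t e by auto
    \<comment> \<open>The sample point of index \<open>n\<close> is \<open>1 - \<eta>\<close>. For 1
      - t in [e, 2 e] the value \<open>\<eta>\<close> lies between 2 e - e^2 and 3 e - 2 e^2, inside
      the window of \<open>blaschke_lower\<close>.\<close>
    define \<eta> where "\<eta> = 1 - t * (1 - e)"
    have "(1 - 2 * e) * (1 - e) \<le> t * (1 - e)" "t * (1 - e) \<le> (1 - e) * (1 - e)"
      using t e by (auto intro!: mult_right_mono)
    then have "1 - 3 * e + 2 * (e * e) \<le> t * (1 - e)" "t * (1 - e) \<le> 1 - 2 * e + e * e"
      by (simp_all add: algebra_simps)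
    moreover have "e * e \<le> e * (1/16)" using e by (intro mult_left_mono) auto
    moreover have "0 \<le> e * e" using e by simp
    ultimately have \<eta>: "1.9 * gap n \<le> \<eta>" "\<eta> \<le> 3 * gap n" "\<eta> < 1"
      unfolding \<eta>_def e_def[symmetric] using e by linarith+
    have \<eta>0: "0 < \<eta>" using \<eta> e by (simp flip: e_def)
    have "(3/50)\<^sup>2 \<le> (cmod (blaschke (of_real (1 - \<eta>))))\<^sup>2"
      using blaschke_lower[OF \<eta>] by (intro power_mono) auto
    then have A: "1/2 * (3/50)\<^sup>2 \<le> (1 + (1 - \<eta>)) / 2 * (cmod (blaschke (of_real (1 - \<eta>))))\<^sup>2"
      using \<eta> by (intro mult_mono) auto
    \<comment> \<open>The denominator before squaring is \<open>e + (1 - e) * \<eta>\<close>, at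
      most e + 3 e.\<close>
    have B: "e / (4 * e)\<^sup>2 \<le> e / (1 - (1 - e) * (1 - \<eta>))\<^sup>2"
    proof -
      have "1 - (1 - e) * (1 - \<eta>) = e + (1 - e) * \<eta>" by (simp add: algebra_simps)
      moreover have "(1 - e) * \<eta> \<le> 1 * \<eta>" using e \<eta>0 by (intro mult_right_mono) auto
      moreover have "0 \<le> (1 - e) * \<eta>" using e \<eta>0 by simp
      ultimately have "0 < 1 - (1 - e) * (1 - \<eta>)" "1 - (1 - e) * (1 - \<eta>) \<le> 4 * e"
        using e \<eta> unfolding e_def[symmetric] by linarith+
      then show ?thesis using e by (intro divide_left_mono power_mono mult_pos_pos) auto
    qed
    \<comment> \<open>After multiplication by the weight \<open>gap n = e\<close> all powers of e
      cancel, leaving 9/80000, which exceeds 1/20000.\<close>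
    have "1/2 * (3/50)\<^sup>2 * (e / (4 * e)\<^sup>2) \<le> v (1 - \<eta>)"
      unfolding v_def by (rule mult_mono[OF A B]) (use e \<eta> in auto)
    then have "e * (1/2 * (3/50)\<^sup>2 * (e / (4 * e)\<^sup>2)) \<le> e * v (1 - \<eta>)" using e by (intro mult_left_mono) auto
    also have "e * v (1 - \<eta>) = (\<Sum>m\<in>{n}. gap m * v (t * (1 - gap m)))" by (simp add: \<eta>_def e_def)
    also have "\<dots> \<le> inner main_vector (dilate t G)"
      using sum_le_suminf[of "\<lambda>m. gap m * v (t * (1 - gap m))" "{n}"] D[OF t01] nonneg[OF t01(1)] by (simp add: sums_iff)
    finally show ?thesis using e by (simp add: power2_eq_square)
  qed
  have "(1/20000) / 2 \<le> ln (1 / (1 - r)) * inner (log_mean_op r main_vector) G"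
    by (rule log_mean_pairing_lower_bound[where e = e]) (use D0 Dn e r in \<open>auto simp: e_def\<close>)
  moreover have L: "0 < ln (1 / (1 - r))" using r r0 by (simp add: ln_div)
  ultimately have "1 / (40000 * ln (1 / (1 - r))) \<le> inner (log_mean_op r main_vector) G"
    by (simp add: field_simps)
  also have "\<dots> \<le> Hb_norm main_symbol (ell2_fun (log_mean_op r main_vector)) * norm (half.mult_op g)"
    unfolding G_def by (rule pair.Hb_norm_lower_bound[OF log_mean_main_Hb[OF r0 r(2)]])
  also have "\<dots> \<le> Hb_norm main_symbol (ell2_fun (log_mean_op r main_vector)) * sqrt e"
  proof (rule mult_left_mono[OF ng])
    show "0 \<le> Hb_norm main_symbol (ell2_fun (log_mean_op r main_vector))"
      using log_mean_main_Hb[OF r0 r(2), of main_vector] pair.Hb_norm_root by (auto simp: pair.Hb_iff)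
  qed
  finally show ?thesis using e L by (simp add: log_mean_ell2[OF r0 r(2)] e_def[symmetric] field_simps)
qed

text \<open>Taking the last index with \<open>gap n\<close> at least 1 - r gives
  \<open>gap n \<le> 16 * (1 - r)\<close>, so the square root loses a factor 4 and 40000 becomes
  160000.\<close>

lemma log_mean_norm_growth:
  assumes r: "15/16 \<le> r" "r < 1"
  shows "1 / (160000 * sqrt (1 - r) * ln (1 / (1 - r))) \<le> Hb_norm main_symbol (log_mean r (ell2_fun main_vector))"
proof -
  have "gap \<longlonglongrightarrow> 0" unfolding gap_def[abs_def] by (rule LIMSEQ_realpow_zero) auto
  then have "\<forall>\<^sub>F m in sequentially. gap m < 1 - r" using r by (intro order_tendstoD) auto
  then have ex: "\<exists>m. gap m < 1 - r" by (auto simp: eventually_sequentially)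
  define N where "N = (LEAST m. gap m < 1 - r)"
  have N: "gap N < 1 - r" unfolding N_def by (rule LeastI_ex[OF ex])
  \<comment> \<open>\<open>N\<close> is the first index with gap below 1 - r. As 1 - r <= 1/16 =
    \<open>gap 1\<close>, it is at least 2, so its predecessor satisfies the requirement
    \<open>1 \<le> n\<close>.\<close>
  have N2: "2 \<le> N"
  proof (rule ccontr)
    assume "\<not> 2 \<le> N"
    then have "gap 1 \<le> gap N" unfolding gap_def by (intro power_decreasing) auto
    then show False using N r by (simp add: gap_def)
  qed
  then obtain n where n: "N = Suc n" "1 \<le> n" by (cases N) auto
  have "\<not> gap n < 1 - r" using not_less_Least[of n "\<lambda>m. gap m < 1 - r"] n by (simp add: N_def[symmetric])
  then have n1: "1 - gap n \<le> r" by simp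
  have "gap n = 16 * gap N" by (simp add: n gap_def)
  then have "gap n \<le> 16 * (1 - r)" using N by simp
  then have "sqrt (gap n) \<le> sqrt (16 * (1 - r))" by (rule real_sqrt_le_mono)
  also have "\<dots> = 4 * sqrt (1 - r)" unfolding real_sqrt_mult by simp
  finally have s: "sqrt (gap n) \<le> 4 * sqrt (1 - r)" .
  have L: "0 < ln (1 / (1 - r))" using r by (simp add: ln_div)
  have "40000 * sqrt (gap n) * ln (1 / (1 - r)) \<le> 160000 * sqrt (1 - r) * ln (1 / (1 - r))"
    using s L by (intro mult_right_mono) auto
  then have "1 / (160000 * sqrt (1 - r) * ln (1 / (1 - r))) \<le> 1 / (40000 * sqrt (gap n) * ln (1 / (1 - r)))"
    using L gap_bounds[of n] r by (intro divide_left_mono mult_pos_pos) auto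
  also have "\<dots> \<le> Hb_norm main_symbol (log_mean r (ell2_fun main_vector))"
    by (rule log_mean_norm_lower_bound[OF n(2) n1 r(2)])
  finally show ?thesis .
qed

theorem theorem1p1:
  "\<exists>b f. b \<in> Hinf_unit_ball \<and> \<not> extreme_in b Hinf_unit_ball \<and> f \<in> Hb b \<and>
     filterlim (\<lambda>r. Hb_norm b (log_mean r f)) at_top (at_left 1)"
proof (intro exI conjI)
  show "main_symbol \<in> Hinf_unit_ball" by (rule main_symbol_unit_ball)
  show "\<not> extreme_in main_symbol Hinf_unit_ball" by (rule main_symbol_not_extreme)
  show "ell2_fun main_vector \<in> Hb main_symbol" by (rule main_vector_Hb)
  \<comment> \<open>The logarithm grows more slowly than 1 / sqrt (1 - r), so the denominator tends
    to 0 through positive values.\<close>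
  have "filterlim (\<lambda>r::real. 1 / (160000 * sqrt (1 - r) * ln (1 / (1 - r)))) at_top (at_left 1)"
    by real_asymp
  moreover have "eventually (\<lambda>r. r \<in> {15/16<..<1::real}) (at_left 1)" by (rule eventually_at_left_real) simp
  then have "eventually (\<lambda>r. 1 / (160000 * sqrt (1 - r) * ln (1 / (1 - r))) \<le>
      Hb_norm main_symbol (log_mean r (ell2_fun main_vector))) (at_left 1)"
    by eventually_elim (auto intro!: log_mean_norm_growth)
  ultimately show "filterlim (\<lambda>r. Hb_norm main_symbol (log_mean r (ell2_fun main_vector))) at_top (at_left 1)"
    by (rule filterlim_at_top_mono)
qed

end
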